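(* Let $n,m\ge0$ with $n+m>0$ and let $\lambda\vdash n+m$. Let $\widetilde{\mathcal{L}}_{n,m}$ be the bidegree-$(n,m)$ component of the free Lie superalgebra on $V_0\oplus V_1=\mathbb{C}^N\oplus\mathbb{C}^N$ with diagonal $\mathrm{GL}(\mathbb{C}^N)$-action, $N\to\infty$. Then the multiplicity of the Schur module $V^\lambda$ in $\widetilde{\mathcal{L}}_{n,m}$ (equivalently, the coefficient of $s_\lambda$ in the limiting character $\operatorname{Ch}(\widetilde{\mathcal{L}}_{n,m})$) equals \[ \#\{\mathcal{T}\in \mathrm{SYT}_\pm(\lambda): \operatorname{maj}(\mathcal{T})\equiv 1 \pmod{n+m},\ \operatorname{neg}(\mathcal{T})=m\}. \]
   Context: The free Lie superalgebra $\widetilde{\mathcal{L}}(V)$ is the span, inside the tensor superalgebra $\widetilde{T}(V)=\bigoplus_d(V_0\oplus V_1)^{\otimes d}$, of iterated super commutators $[x,y]=xy-(-1)^{|x||y|}yx$ of elements of $V$; $\widetilde{\mathcal{L}}_{n,m}$ is spanned by those bracketings with $n$ entries from $V_0$ and $m$ from $V_1$. For $\lambda\vdash k$ (English notation, longest row on top), $\mathrm{SYT}_\pm(\lambda)$ is the set of standard Young tableaux of shape $\lambda$ with entries $1,\dots,k$ in which each cell is additionally marked positive or negative. For $\mathcal{T}\in\mathrm{SYT}_\pm(\lambda)$, $\mathrm{Neg}(\mathcal{T})\subseteq[k]$ is the set of entries in negatively marked cells and $\operatorname{neg}(\mathcal{T})=|\mathrm{Neg}(\mathcal{T})|$. The (super)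 descent set $\mathrm{Des}(\mathcal{T})$ is the set of $i\in\{1,\dots,k-1\}$ such that either ($i+1\notin\mathrm{Neg}(\mathcal{T})$ and $i+1$ lies in a strictly lower row than $i$) or ($i\in\mathrm{Neg}(\mathcal{T})$ and $i+1$ does not lie in a strictly lower row than $i$). The major index is $\operatorname{maj}(\mathcal{T})=\sum_{i\in\mathrm{Des}(\mathcal{T})} i$. *)

theory Defs
  imports Complex_Main "HOL-Library.Function_Algebras"
begin

text \<open>A letter (i, p) is the basis vector e_i of V_p, where p = True means odd (V_1)
  and p = False means even (V_0). Tensors are complex-valued functions on words
  (coefficient of each word); elements of the tensor algebra are those with
  finite support, and everything below is generated from finitely supported ones.\<close>

type_synonym letter = "nat \<times> bool"
type_synonym word = "letter list"
type_synonym tensor = "word \<Rightarrow> complex"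

definition tscale :: "complex \<Rightarrow> tensor \<Rightarrow> tensor" where
  "tscale c f = (\<lambda>w. c * f w)"

definition wvec :: "word \<Rightarrow> tensor" where
  "wvec u = (\<lambda>w. if w = u then 1 else 0)"

definition tmul :: "tensor \<Rightarrow> tensor \<Rightarrow> tensor" where
  "tmul f g = (\<lambda>w. \<Sum>i\<le>length w. f (take i w) * g (drop i w))"

datatype btree = Leaf letter | Node btree btree

fun leaves :: "btree \<Rightarrow> letter list" where
  "leaves (Leaf a) = [a]"
| "leaves (Node s t) = leaves s @ leaves t"

definition odd_count :: "letter list \<Rightarrow> nat" where
  "odd_count w = length (filter snd w)"

definition even_count :: "letter list \<Rightarrow> nat" where
  "even_count w = length (filter (\<lambda>a. \<not> snd a) w)"

definition tpar :: "btree \<Rightarrow> nat" where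
  "tpar t = odd_count (leaves t) mod 2"

fun beval :: "btree \<Rightarrow> tensor" where
  "beval (Leaf a) = wvec [a]"
| "beval (Node s t) =
     tmul (beval s) (beval t) - tscale ((-1) ^ (tpar s * tpar t)) (tmul (beval t) (beval s))"

text \<open>The bidegree (n,m) component of the free Lie superalgebra on C^N + C^N:
  span of bracketings with n entries from V0 and m entries from V1.
  (By multilinearity, it suffices to bracket basis vectors.)\<close>
definition Lnm :: "nat \<Rightarrow> nat \<Rightarrow> nat \<Rightarrow> tensor set" where
  "Lnm N n m = module.span tscale
     (beval ` {t. (\<forall>a\<in>set (leaves t). fst a < N) \<and>
                  even_count (leaves t) = n \<and> odd_count (leaves t) = m})"

definition wweight :: "word \<Rightarrow> nat \<Rightarrow> nat" where
  "wweight w = (\<lambda>i. length (filter (\<lambda>a. fst a = i) w))"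

definition weight_space :: "tensor set \<Rightarrow> (nat \<Rightarrow> nat) \<Rightarrow> tensor set" where
  "weight_space W mu = W \<inter> {f. \<forall>w. f w \<noteq> 0 \<longrightarrow> wweight w = mu}"

definition ch :: "nat \<Rightarrow> nat \<Rightarrow> nat \<Rightarrow> (nat \<Rightarrow> nat) \<Rightarrow> nat" where
  "ch N n m mu = vector_space.dim tscale (weight_space (Lnm N n m) mu)"

definition is_partition :: "nat list \<Rightarrow> bool" where
  "is_partition la \<longleftrightarrow> sorted_wrt (\<ge>) la \<and> (\<forall>x\<in>set la. 0 < x)"

definition partitions :: "nat \<Rightarrow> nat list set" where
  "partitions k = {la. is_partition la \<and> sum_list la = k}"

text \<open>Cells (row, column), 0-indexed, English notation: row 0 is the top (longest) row.\<close>
definition cells :: "nat list \<Rightarrow> (nat \<times> nat) set" where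
  "cells la = {(i, j). i < length la \<and> j < la ! i}"

definition SSYT :: "nat \<Rightarrow> nat list \<Rightarrow> ((nat \<times> nat) \<Rightarrow> nat) set" where
  "SSYT N la = {T. (\<forall>c. c \<notin> cells la \<longrightarrow> T c = 0) \<and>
     (\<forall>c\<in>cells la. T c < N) \<and>
     (\<forall>i j. (i, Suc j) \<in> cells la \<longrightarrow> T (i, j) \<le> T (i, Suc j)) \<and>
     (\<forall>i j. (Suc i, j) \<in> cells la \<longrightarrow> T (i, j) < T (Suc i, j))}"

definition content :: "nat list \<Rightarrow> ((nat \<times> nat) \<Rightarrow> nat) \<Rightarrow> nat \<Rightarrow> nat" where
  "content la T = (\<lambda>i. card {c \<in> cells la. T c = i})"

text \<open>Kostka number: coefficient of x^mu in the Schur polynomial s_la(x_1..x_N).\<close>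
definition kostka :: "nat \<Rightarrow> nat list \<Rightarrow> (nat \<Rightarrow> nat) \<Rightarrow> nat" where
  "kostka N la mu = card {T \<in> SSYT N la. content la T = mu}"

text \<open>Coefficient of s_la in Ch(L_{n,m}) (in N variables): the unique coefficient
  family c on partitions of n+m with  Ch = sum_nu c_nu s_nu.\<close>
definition schur_coeff :: "nat \<Rightarrow> nat \<Rightarrow> nat \<Rightarrow> nat list \<Rightarrow> int" where
  "schur_coeff N n m la =
     (THE c. (\<forall>nu. nu \<notin> partitions (n + m) \<longrightarrow> c nu = 0) \<and>
        (\<forall>mu. (\<forall>i\<ge>N. mu i = 0) \<longrightarrow>
           int (ch N n m mu) = (\<Sum>nu\<in>partitions (n + m). c nu * int (kostka N nu mu)))) la"

definition SYT :: "nat list \<Rightarrow> ((nat \<times> nat) \<Rightarrow> nat) set" where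
  "SYT la = {T. (\<forall>c. c \<notin> cells la \<longrightarrow> T c = 0) \<and>
     bij_betw T (cells la) {1..sum_list la} \<and>
     (\<forall>i j. (i, Suc j) \<in> cells la \<longrightarrow> T (i, j) < T (i, Suc j)) \<and>
     (\<forall>i j. (Suc i, j) \<in> cells la \<longrightarrow> T (i, j) < T (Suc i, j))}"

text \<open>A signed standard tableau is a pair (T, S) with T standard and S the set of
  negatively marked cells.\<close>
definition SYT_pm :: "nat list \<Rightarrow> (((nat \<times> nat) \<Rightarrow> nat) \<times> (nat \<times> nat) set) set" where
  "SYT_pm la = {(T, S). T \<in> SYT la \<and> S \<subseteq> cells la}"

definition Neg :: "((nat \<times> nat) \<Rightarrow> nat) \<Rightarrow> (nat \<times> nat) set \<Rightarrow> nat set" where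
  "Neg T S = T ` S"

definition neg :: "((nat \<times> nat) \<Rightarrow> nat) \<Rightarrow> (nat \<times> nat) set \<Rightarrow> nat" where
  "neg T S = card (Neg T S)"

definition row_of :: "nat list \<Rightarrow> ((nat \<times> nat) \<Rightarrow> nat) \<Rightarrow> nat \<Rightarrow> nat" where
  "row_of la T e = fst (THE c. c \<in> cells la \<and> T c = e)"

definition Des :: "nat list \<Rightarrow> ((nat \<times> nat) \<Rightarrow> nat) \<Rightarrow> (nat \<times> nat) set \<Rightarrow> nat set" where
  "Des la T S = {i \<in> {1..<sum_list la}.
     (i + 1 \<notin> Neg T S \<and> row_of la T (i + 1) > row_of la T i) \<or>
     (i \<in> Neg T S \<and> \<not> row_of la T (i + 1) > row_of la T i)}"

definition maj :: "nat list \<Rightarrow> ((nat \<times> nat) \<Rightarrow> nat) \<Rightarrow> (nat \<times> nat) set \<Rightarrow> nat" where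
  "maj la T S = \<Sum> (Des la T S)"

end

theory Submission
  imports Defs "HOL-Combinatorics.Combinatorics"
    "HOL-Computational_Algebra.Polynomial" "HOL-Number_Theory.Cong"
begin

text \<open>The signs are the crux. A repeated odd letter is a descent, so n equal odd letters
  contribute q^(n choose 2) to the product formula for the major index. At a root of unity these
  powers multiply to exactly the Koszul sign that a rotation picks up on the words it fixes.

  The Klyachko operator is k times a projection onto the Lie part, so its trace gives the dimension
  without any basis of the free Lie superalgebra. Conjugation by the long cycle multiplies the
  weight of a permutation with c cyclic descents by \<omega>^(c-1). Hence the permutations with c
  not congruent to 1 modulo k cancel, and a permutation with a single cyclic descent is a rotation.

  For a tableau, the super descent set is a function of its ordinary descent set and its set of
  negative entries; the same function applies to a word and its odd positions. So each sign set can
  be treated separately and only ordinary descents enter the Cauchy identity. That identity is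
  proved for descents contained in a prescribed set, where words split into increasing blocks and
  tableaux into horizontal strips; inversion over subsets then yields exact descent sets.\<close>

text \<open>
  Pair tensors with super shuffles of words. Iterated super brackets are orthogonal to all proper
  shuffles, since the deconcatenation coproduct is multiplicative, and by the Dynkin--Specht--Wever
  identity every tensor with this property is a combination of right-normed brackets. For a primitive
  k-th root of unity \<omega>, the Klyachko operator, i.e. the sum of the signed place permutations
  weighted by \<omega> to the power of the major index of the inverse, maps tensors of degree k to such
  tensors and acts on them as the scalar k. So k times the dimension of a weight space is its trace.
  Conjugation by the long cycle multiplies its weights by a power of \<omega> that depends on the
  number of cyclic descents, so only rotations contribute to the trace.

  The Garsia--Gessel shuffle lemma factors the generating function of the super major index over the
  words of a given content; at roots of unity it counts words fixed by a rotation. This cyclic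
  sieving turns the trace into the number of super words with major index congruent to 1.
  Inverting the local rule of growth diagrams gives the Cauchy identity refined by descent sets, which
  expands that number into Kostka numbers with the asserted coefficients. They are the only ones
  possible because the Kostka matrix is triangular for the dominance order.\<close>

section \<open>Major index and shuffles\<close>

text \<open>A strict total order whose diagonal is left free: a repeated letter may or may not be a
  descent, depending on the letter. Transitivity is required of the complement too, because the
  shuffle lemma compares in both directions.\<close>

definition descent_rel :: "('a \<Rightarrow> 'a \<Rightarrow> bool) \<Rightarrow> bool" where
  "descent_rel D \<longleftrightarrow> (\<forall>x y z. D x y \<longrightarrow> D y z \<longrightarrow> D x z) \<and>
     (\<forall>x y z. \<not> D x y \<longrightarrow> \<not> D y z \<longrightarrow> \<not> D x z) \<and> (\<forall>x y. x \<noteq> y \<longrightarrow> D x y \<noteq> D y x)"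

definition list_maj :: "('a \<Rightarrow> 'a \<Rightarrow> bool) \<Rightarrow> 'a list \<Rightarrow> nat" where
  "list_maj D xs = (\<Sum>i\<in>{1..<length xs}. if D (xs ! (i - 1)) (xs ! i) then i else 0)"

lemma list_maj_Nil [simp]: "list_maj D [] = 0"
  and list_maj_single [simp]: "list_maj D [a] = 0"
  by (simp_all add: list_maj_def)

lemma list_maj_snoc:
  "list_maj D (ys @ [b, a]) = list_maj D (ys @ [b]) + (if D b a then Suc (length ys) else 0)"
proof -
  have "list_maj D (ys @ [b, a]) =
      (\<Sum>i\<in>{1..<Suc (length ys)}. if D ((ys @ [b, a]) ! (i - 1)) ((ys @ [b, a]) ! i) then i else 0)
      + (if D b a then Suc (length ys) else 0)"
    by (simp add: list_maj_def nth_append)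
  also have "(\<Sum>i\<in>{1..<Suc (length ys)}. if D ((ys @ [b, a]) ! (i - 1)) ((ys @ [b, a]) ! i) then i else 0)
     = list_maj D (ys @ [b])"
    unfolding list_maj_def by (rule sum.cong) (auto simp: nth_append)
  finally show ?thesis .
qed

lemma list_maj_map: "list_maj D (map f xs) = list_maj (\<lambda>a b. D (f a) (f b)) xs"
  unfolding list_maj_def length_map by (rule sum.cong) auto

text \<open>Shuffles recurse on the first letter, while the largest contribution to the major index sits
  at the end; hence words are read from right to left here.\<close>
definition rmaj :: "('a \<Rightarrow> 'a \<Rightarrow> bool) \<Rightarrow> 'a list \<Rightarrow> nat" where
  "rmaj D xs = list_maj D (rev xs)"

lemma rmaj_simps [simp]:
  "rmaj D [] = 0" "rmaj D [a] = 0"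
  "rmaj D (a # b # x) = rmaj D (b # x) + (if D b a then Suc (length x) else 0)"
  using list_maj_snoc[of D "rev x" b a] by (simp_all add: rmaj_def)

text \<open>The q-integer, over any commutative ring, so that q can be an indeterminate as well as a
  root of unity.\<close>

definition qnum :: "'a::comm_ring_1 \<Rightarrow> nat \<Rightarrow> 'a" where
  "qnum q n = (\<Sum>i<n. q ^ i)"

definition qfact :: "'a::comm_ring_1 \<Rightarrow> nat \<Rightarrow> 'a" where
  "qfact q n = (\<Prod>i<n. qnum q (Suc i))"

lemma qfact_simps [simp]: "qfact q 0 = 1" "qfact q (Suc n) = qfact q n * qnum q (Suc n)"
  by (simp_all add: qfact_def)

lemma qnum_add: "qnum q (m + n) = qnum q m + q ^ m * qnum q n"
proof -
  have "{..<m + n} = {..<m} \<union> {m..<m + n}" by auto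
  then have "qnum q (m + n) = qnum q m + (\<Sum>i\<in>{m..<m + n}. q ^ i)"
    unfolding qnum_def by (metis finite_atLeastLessThan finite_lessThan ivl_disj_int_one(2) sum.union_disjoint)
  also have "(\<Sum>i\<in>{m..<m + n}. q ^ i) = q ^ m * qnum q n"
    unfolding qnum_def sum_distrib_left power_add[symmetric]
    by (rule sum.reindex_bij_witness[of _ "\<lambda>i. m + i" "\<lambda>i. i - m"]) auto
  finally show ?thesis .
qed

lemma sum_shuffles_Cons:
  assumes "a \<noteq> b"
  shows "(\<Sum>x\<in>shuffles (a # u) (b # v). F x) =
    (\<Sum>x\<in>shuffles u (b # v). F (a # x)) + (\<Sum>x\<in>shuffles (a # u) v. F (b # x))"
proof -
  have "(\<Sum>x\<in>shuffles (a # u) (b # v). F x) =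
     (\<Sum>x\<in>(#) a ` shuffles u (b # v). F x) + (\<Sum>x\<in>(#) b ` shuffles (a # u) v. F x)"
    using assms by (simp, intro sum.union_disjoint) auto
  then show ?thesis by (simp add: sum.reindex)
qed

text \<open>Prepending a letter only asks for the first letter of the shuffle, so the induction
  fixes the letter \<open>a\<close> in front and splits by which word supplies the next one. The
  statement is free of division because the q-factorials may vanish at roots of unity.\<close>

lemma shuffle_maj_Cons:
  fixes q :: "'r::comm_ring_1"
  assumes D: "descent_rel D" and "set (a # u) \<inter> set v = {}"
  shows "(\<Sum>x\<in>shuffles u v. q ^ rmaj D (a # x)) * qfact q (length u) * qfact q (length v) =
     q ^ (rmaj D (a # u) + rmaj D v + (if v \<noteq> [] \<and> D (hd v) a then length v else 0))
      * qfact q (length u + length v)"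
  using assms(2)
proof (induction "length u + length v" arbitrary: a u v rule: less_induct)
  case less
  show ?case
  proof (cases v)
    case Nil
    then show ?thesis by simp
  next
    case v: (Cons b v')
    have neq: "a \<noteq> b" using less.prems v by auto
    have tot: "D b a \<noteq> D a b" using D neq unfolding descent_rel_def by metis
    show ?thesis
    proof (cases u)
      case Nil
      have "length v' = length v - 1" using v by simp
      then show ?thesis using Nil v by (simp add: algebra_simps power_add)
    next
      case u: (Cons a' u')
      define m n where "m = length u" and "n = length v"
      have neq': "a' \<noteq> b" using less.prems u v by auto
      have tot': "D b a' \<noteq> D a' b" using D neq' unfolding descent_rel_def by metis
      have t1: "D b a' \<Longrightarrow> D a' a \<Longrightarrow> D b a" and t2: "\<not> D b a' \<Longrightarrow> \<not> D a' a \<Longrightarrow> \<not> D b a"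
        using D unfolding descent_rel_def by metis+
      let ?E = "\<lambda>a u v. \<Sum>x\<in>shuffles u v. q ^ rmaj D (a # x)"
      have len: "x \<in> shuffles u' (b # v') \<Longrightarrow> Suc (length x) = m + n"
           "x \<in> shuffles (a' # u') v' \<Longrightarrow> Suc (length x) = m + n" for x
        using u v by (auto simp: length_shuffles m_def n_def)
      have split: "?E a u v = q ^ (if D a' a then m + n else 0) * ?E a' u' v
            + q ^ (if D b a then m + n else 0) * ?E b v' u"
        unfolding u v sum_shuffles_Cons[OF neq'] sum_distrib_left shuffles_commutes[of v' "a' # u'"]
        by (intro arg_cong2[where f = "(+)"] sum.cong refl)
           (auto simp: len power_add mult_ac)
      have IH1: "?E a' u' v * qfact q (length u') * qfact q n =
          q ^ (rmaj D u + rmaj D v + (if D b a' then n else 0)) * qfact q (length u' + n)"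
        using less.hyps[of u' v a'] less.prems u v by (auto simp: n_def)
      have IH2: "?E b v' u * qfact q (length v') * qfact q m =
          q ^ (rmaj D u + rmaj D v + (if D a' b then m else 0)) * qfact q (length v' + m)"
        using less.hyps[of v' u b] less.prems u v by (auto simp: m_def add_ac Int_commute)
      have m: "m = Suc (length u')" and n: "n = Suc (length v')" using u v by (simp_all add: m_def n_def)
      define Z where "Z = qfact q (length u' + n)"
      have Z: "qfact q (length v' + m) = Z" "qfact q (m + n) = Z * qnum q (m + n)"
        by (simp_all add: Z_def m n add_ac)
      define R where "R = q ^ (rmaj D u + rmaj D v)"
      have qm: "qfact q m = qfact q (length u') * qnum q m" and qn: "qfact q n = qfact q (length v') * qnum q n"
        by (simp_all add: m n)
      have "?E a u v * qfact q m * qfact q n =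
         q ^ (if D a' a then m + n else 0) * (?E a' u' v * qfact q (length u') * qfact q n) * qnum q m
       + q ^ (if D b a then m + n else 0) * (?E b v' u * qfact q (length v') * qfact q m) * qnum q n"
        unfolding split qm qn by (simp add: algebra_simps)
      also have "\<dots> = Z * R * (q ^ (if D a' a then m + n else 0) * q ^ (if D b a' then n else 0) * qnum q m
         + q ^ (if D b a then m + n else 0) * q ^ (if D a' b then m else 0) * qnum q n)"
        unfolding IH1 IH2 Z Z_def[symmetric] by (simp add: R_def power_add algebra_simps)
      also have "(q ^ (if D a' a then m + n else 0) * q ^ (if D b a' then n else 0) * qnum q m
         + q ^ (if D b a then m + n else 0) * q ^ (if D a' b then m else 0) * qnum q n) =
         q ^ (if D a' a then m else 0) * q ^ (if D b a then n else 0) * qnum q (m + n)"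
      proof -
        \<comment> \<open>The two q-Pascal rules. Which one closes a case depends on the comparisons
          among \<open>a\<close>, \<open>a'\<close> and \<open>b\<close>; \<open>t1\<close> and
          \<open>t2\<close> exclude the combinations in which neither does.\<close>
        have A: "qnum q (m + n) = qnum q m + q ^ m * qnum q n" by (rule qnum_add)
        have B: "qnum q (m + n) = qnum q n + q ^ n * qnum q m" using qnum_add[of q n m] by (simp add: add_ac)
        show ?thesis
        proof (cases "D b a'")
          case True
          then have "\<not> D a' b" using tot' by simp
          show ?thesis using True \<open>\<not> D a' b\<close> t1
            by (cases "D a' a"; cases "D b a"; ((simp add: A power_add algebra_simps; fail)
                 | (simp add: B power_add algebra_simps; fail) | simp))
        next
          case False
          then have "D a' b" using tot' by simp
          show ?thesis using False \<open>D a' b\<close> t2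
            by (cases "D a' a"; cases "D b a"; ((simp add: A power_add algebra_simps; fail)
                 | (simp add: B power_add algebra_simps; fail) | simp))
        qed
      qed
      finally have "?E a u v * qfact q m * qfact q n = Z * R *
          (q ^ (if D a' a then m else 0) * q ^ (if D b a then n else 0) * qnum q (m + n))" .
      also have "\<dots> = q ^ (rmaj D (a # u) + rmaj D v + (if v \<noteq> [] \<and> D (hd v) a then length v else 0))
          * qfact q (m + n)"
        unfolding Z(2) using u v by (simp add: R_def power_add m n algebra_simps)
      finally show ?thesis by (simp add: m_def n_def)
    qed
  qed
qed

text \<open>The Garsia--Gessel lemma. Splitting by the first letter leaves two sums with a fixed
  front letter, and one more q-Pascal step joins them.\<close>

theorem sum_shuffles_rmaj:
  fixes q :: "'r::comm_ring_1"
  assumes D: "descent_rel D" and disj: "set u \<inter> set v = {}"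
  shows "(\<Sum>x\<in>shuffles u v. q ^ rmaj D x) * qfact q (length u) * qfact q (length v) =
     q ^ (rmaj D u + rmaj D v) * qfact q (length u + length v)"
proof (cases u)
  case Nil
  then show ?thesis by simp
next
  case u: (Cons a u')
  show ?thesis
  proof (cases v)
    case Nil
    then show ?thesis by simp
  next
    case v: (Cons b v')
    have neq: "a \<noteq> b" using disj u v by auto
    have tot: "D b a \<noteq> D a b" using D neq unfolding descent_rel_def by metis
    let ?E = "\<lambda>a u v. \<Sum>x\<in>shuffles u v. q ^ rmaj D (a # x)"
    define m n where "m = length u" and "n = length v"
    have m: "m = Suc (length u')" and n: "n = Suc (length v')" using u v by (simp_all add: m_def n_def)
    have sp: "(\<Sum>x\<in>shuffles u v. q ^ rmaj D x) = ?E a u' v + ?E b v' u"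
      unfolding u v sum_shuffles_Cons[OF neq] by (simp add: shuffles_commutes)
    have 1: "?E a u' v * qfact q (length u') * qfact q n =
        q ^ (rmaj D u + rmaj D v + (if D b a then n else 0)) * qfact q (length u' + n)"
      using shuffle_maj_Cons[OF D, of a u' v q] disj u v by (auto simp: n_def)
    have 2: "?E b v' u * qfact q (length v') * qfact q m =
        q ^ (rmaj D u + rmaj D v + (if D a b then m else 0)) * qfact q (length u' + n)"
      using shuffle_maj_Cons[OF D, of b v' u q] disj u v by (auto simp: m_def n_def add_ac Int_commute)
    have qm: "qfact q m = qfact q (length u') * qnum q m" and qn: "qfact q n = qfact q (length v') * qnum q n"
      by (simp_all add: m n)
    have "(\<Sum>x\<in>shuffles u v. q ^ rmaj D x) * qfact q m * qfact q n =
       (?E a u' v * qfact q (length u') * qfact q n) * qnum q m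
        + (?E b v' u * qfact q (length v') * qfact q m) * qnum q n"
      unfolding sp qm qn by (simp add: algebra_simps)
    also have "\<dots> = q ^ (rmaj D u + rmaj D v) * qfact q (length u' + n) * qnum q (m + n)"
    proof (cases "D a b")
      case True
      then have "\<not> D b a" using tot by simp
      then show ?thesis unfolding 1 2 qnum_add[of q m n] using True
        by (simp add: power_add algebra_simps)
    next
      case False
      then have "D b a" using tot by simp
      then show ?thesis unfolding 1 2 add.commute[of m n] qnum_add[of q n m] using False
        by (simp add: power_add algebra_simps)
    qed
    also have "\<dots> = q ^ (rmaj D u + rmaj D v) * qfact q (m + n)" by (simp add: m)
    finally show ?thesis by (simp add: m_def n_def)
  qed
qed

text \<open>For disjoint alphabets both words are recovered from a shuffle by filtering, and
  filtering commutes with reversal.\<close>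

lemma rev_shuffles: "rev ` shuffles u v = shuffles (rev u) (rev v)" if "set u \<inter> set v = {}"
proof -
  have sub: "rev ` shuffles u v \<subseteq> shuffles (rev u) (rev v)" if "set u \<inter> set v = {}" for u v :: "'b list"
  proof
    fix y assume "y \<in> rev ` shuffles u v"
    then obtain x where x: "x \<in> shuffles u v" "y = rev x" by auto
    have "filter (\<lambda>z. z \<in> set u) x = u" "filter (\<lambda>z. z \<notin> set u) x = v"
      using filter_shuffles_disjoint1[OF that x(1)] by auto
    then show "y \<in> shuffles (rev u) (rev v)"
      using partition_in_shuffles[of y "\<lambda>z. z \<in> set u"] by (simp add: x(2) rev_filter[symmetric])
  qed
  show ?thesis
  proof
    show "rev ` shuffles u v \<subseteq> shuffles (rev u) (rev v)" by (rule sub[OF that])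
    have "rev ` rev ` shuffles (rev u) (rev v) \<subseteq> rev ` shuffles u v"
      using sub[of "rev u" "rev v"] that by (intro image_mono) simp
    then show "shuffles (rev u) (rev v) \<subseteq> rev ` shuffles u v" by (simp add: image_image)
  qed
qed

theorem sum_shuffles_list_maj:
  fixes q :: "'r::comm_ring_1"
  assumes D: "descent_rel D" and disj: "set u \<inter> set v = {}"
  shows "(\<Sum>x\<in>shuffles u v. q ^ list_maj D x) * qfact q (length u) * qfact q (length v) =
     q ^ (list_maj D u + list_maj D v) * qfact q (length u + length v)"
proof -
  have "(\<Sum>x\<in>shuffles u v. q ^ list_maj D x) = (\<Sum>x\<in>rev ` shuffles (rev u) (rev v). q ^ list_maj D x)"
    using rev_shuffles[of "rev u" "rev v"] disj by simp
  also have "\<dots> = (\<Sum>x\<in>shuffles (rev u) (rev v). q ^ rmaj D x)"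
    by (simp add: sum.reindex rmaj_def)
  finally show ?thesis
    using sum_shuffles_rmaj[OF D, of "rev u" "rev v" q] disj by (simp add: rmaj_def)
qed

lemma mset_shuffles: "x \<in> shuffles u v \<Longrightarrow> mset x = mset u + mset v"
proof (induction u v arbitrary: x rule: shuffles.induct)
  case (3 a u b v)
  then consider y where "x = a # y" "y \<in> shuffles u (b # v)" | y where "x = b # y" "y \<in> shuffles (a # u) v"
    by auto
  then show ?case
  proof cases
    case 1
    show ?thesis using "3.IH"(1)[OF 1(2)] 1(1) by simp
  next
    case 2
    show ?thesis using "3.IH"(2)[OF 2(2)] 2(1) by simp
  qed
qed simp_all

text \<open>Words of given content arise by shuffling in all copies of one new letter at a time. The
  alphabets are then disjoint, as the shuffle lemma demands, although letters repeat.\<close>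

lemma permutations_of_multiset_add_replicate:
  assumes "a \<notin># M"
  shows "permutations_of_multiset (M + replicate_mset n a) =
    (\<Union>w\<in>permutations_of_multiset M. shuffles w (replicate n a))"
proof (intro equalityI subsetI)
  fix x assume "x \<in> permutations_of_multiset (M + replicate_mset n a)"
  then have x: "mset x = M + replicate_mset n a" by (rule permutations_of_multisetD)
  have "mset (filter (\<lambda>z. z \<noteq> a) x) = filter_mset (\<lambda>z. z \<noteq> a) M"
    by (simp add: x)
  also have "\<dots> = M" using assms by (auto simp: filter_mset_eq_conv)
  finally have 1: "filter (\<lambda>z. z \<noteq> a) x \<in> permutations_of_multiset M"
    by (rule permutations_of_multisetI)
  have "(\<lambda>z. \<not> z \<noteq> a) = (=) a" by auto
  then have "length (filter (\<lambda>z. \<not> z \<noteq> a) x) = count (mset x) a"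
    by (simp only: count_mset count_list_eq_length_filter)
  also have "\<dots> = n" using assms by (simp add: x not_in_iff)
  finally have "filter (\<lambda>z. \<not> z \<noteq> a) x = replicate n a"
    by (intro replicate_eqI) auto
  then show "x \<in> (\<Union>w\<in>permutations_of_multiset M. shuffles w (replicate n a))"
    using 1 partition_in_shuffles[of x "\<lambda>z. z \<noteq> a"] by auto
next
  fix x assume "x \<in> (\<Union>w\<in>permutations_of_multiset M. shuffles w (replicate n a))"
  then obtain w where w: "mset w = M" "x \<in> shuffles w (replicate n a)"
    by (auto simp: permutations_of_multiset_def)
  have "mset x = mset w + mset (replicate n a)"
    by (rule mset_shuffles[OF w(2)])
  then show "x \<in> permutations_of_multiset (M + replicate_mset n a)"
    using w by (simp add: permutations_of_multiset_def)
qed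

text \<open>A q-multinomial formula by induction on the number of distinct letters. A constant word
  of length n contributes 0 or n choose 2 to the exponent, according to the diagonal of
  \<open>D\<close>. Cancelling q-factorials requires that none vanish, so this is applied to an
  indeterminate and evaluated afterwards.\<close>

theorem sum_permutations_of_multiset_rmaj:
  fixes q :: "'r::idom"
  assumes D: "descent_rel D" and nz: "\<And>n. qfact q n \<noteq> 0"
  shows "(\<Sum>x\<in>permutations_of_multiset M. q ^ rmaj D x) * (\<Prod>a\<in>set_mset M. qfact q (count M a)) =
     q ^ (\<Sum>a\<in>set_mset M. rmaj D (replicate (count M a) a)) * qfact q (size M)"
proof (induction "card (set_mset M)" arbitrary: M)
  case 0
  then have "M = {#}" by simp
  then show ?case by simp
next
  case (Suc c)
  then obtain a where a: "a \<in># M" by (metis card.empty equals0I nat.distinct(1))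
  define N where "N = filter_mset (\<lambda>z. z \<noteq> a) M"
  define n where "n = count M a"
  have M: "M = N + replicate_mset n a"
    unfolding N_def n_def by (rule multiset_eqI) simp
  have aN: "a \<notin># N" by (simp add: N_def)
  have sM: "set_mset M = insert a (set_mset N)" using a by (auto simp: N_def)
  have cN: "c = card (set_mset N)" using Suc(2) aN sM by simp
  have cnt: "count M b = count N b" if "b \<in># N" for b using that aN by (auto simp: N_def)
  let ?F = "\<lambda>M. \<Sum>x\<in>permutations_of_multiset M. q ^ rmaj D x"
  have dis: "set w \<inter> set (replicate n a) = {}" if "w \<in> permutations_of_multiset N" for w
    using that aN by (auto simp: permutations_of_multiset_def)
  have len: "length w = size N" if "w \<in> permutations_of_multiset N" for w
    using that by (auto simp: permutations_of_multiset_def)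
  have F: "?F M = (\<Sum>w\<in>permutations_of_multiset N. \<Sum>x\<in>shuffles w (replicate n a). q ^ rmaj D x)"
    unfolding M permutations_of_multiset_add_replicate[OF aN]
  proof (rule sum.UNION_disjoint, goal_cases)
    case 3
    show ?case
    proof (intro ballI impI equals0I, elim IntE)
      fix w w' x assume w: "w \<in> permutations_of_multiset N" "w' \<in> permutations_of_multiset N" "w \<noteq> w'"
        and x: "x \<in> shuffles w (replicate n a)" "x \<in> shuffles w' (replicate n a)"
      have "w = filter (\<lambda>z. z \<notin> set (replicate n a)) x" "w' = filter (\<lambda>z. z \<notin> set (replicate n a)) x"
        using filter_shuffles_disjoint2[OF dis[OF w(1)] x(1)] filter_shuffles_disjoint2[OF dis[OF w(2)] x(2)]
        by metis+
      then show False using w(3) by simp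
    qed
  qed auto
  have "?F M * qfact q (size N) * qfact q n =
     (\<Sum>w\<in>permutations_of_multiset N. q ^ (rmaj D w + rmaj D (replicate n a)) * qfact q (size N + n))"
    unfolding F sum_distrib_right
    by (rule sum.cong[OF refl])
       (use sum_shuffles_rmaj[OF D dis, of _ q] len in \<open>simp add: sum_distrib_right\<close>)
  also have "\<dots> = ?F N * q ^ rmaj D (replicate n a) * qfact q (size N + n)"
    by (simp add: power_add sum_distrib_right)
  finally have *: "?F M * qfact q (size N) * qfact q n =
      ?F N * q ^ rmaj D (replicate n a) * qfact q (size N + n)" .
  have IH: "?F N * (\<Prod>a\<in>set_mset N. qfact q (count N a)) =
     q ^ (\<Sum>a\<in>set_mset N. rmaj D (replicate (count N a) a)) * qfact q (size N)"
    using Suc(1)[OF cN] .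
  have sz: "size M = size N + n" by (simp add: M)
  have P: "(\<Prod>a\<in>set_mset M. qfact q (count M a)) = qfact q n * (\<Prod>a\<in>set_mset N. qfact q (count N a))"
    unfolding sM using aN cnt by (simp add: n_def)
  have S: "(\<Sum>a\<in>set_mset M. rmaj D (replicate (count M a) a)) =
      rmaj D (replicate n a) + (\<Sum>a\<in>set_mset N. rmaj D (replicate (count N a) a))"
    unfolding sM using aN cnt by (simp add: n_def)
  have "qfact q (size N) * (?F M * (\<Prod>a\<in>set_mset M. qfact q (count M a))) =
      (?F M * qfact q (size N) * qfact q n) * (\<Prod>a\<in>set_mset N. qfact q (count N a))"
    unfolding P by (simp add: mult_ac)
  also have "\<dots> = (?F N * (\<Prod>a\<in>set_mset N. qfact q (count N a))) * q ^ rmaj D (replicate n a) * qfact q (size M)"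
    unfolding * sz by (simp add: mult_ac)
  also have "\<dots> = qfact q (size N) *
      (q ^ (\<Sum>a\<in>set_mset M. rmaj D (replicate (count M a) a)) * qfact q (size M))"
    unfolding IH S power_add by (simp add: mult_ac)
  finally show ?case unfolding mult_left_cancel[OF nz] .
qed

lemma qnum_poly_nz: "qnum [:0, 1::complex:] (Suc n) \<noteq> 0"
proof
  assume "qnum [:0, 1::complex:] (Suc n) = 0"
  then have "poly (qnum [:0, 1::complex:] (Suc n)) 1 = 0" by simp
  then have "of_nat (Suc n) = (0::complex)" by (simp add: qnum_def poly_sum add.commute)
  then show False by (metis of_nat_neq_0)
qed

lemma qfact_poly_nz: "qfact [:0, 1::complex:] n \<noteq> 0"
  by (induction n) (simp_all add: qnum_poly_nz)

lemma poly_qnum: "poly (qnum p n) x = qnum (poly p x) n"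
  by (simp add: qnum_def poly_sum)

section \<open>Evaluation at roots of unity\<close>

definition prim_root :: "nat \<Rightarrow> complex \<Rightarrow> bool" where
  "prim_root d q \<longleftrightarrow> d > 0 \<and> q ^ d = 1 \<and> (\<forall>i. 0 < i \<and> i < d \<longrightarrow> q ^ i \<noteq> 1)"

lemma qnum_geom: "(q - 1) * qnum q n = q ^ n - (1::'a::comm_ring_1)"
proof (induction n)
  case (Suc n)
  have "qnum q (Suc n) = qnum q n + q ^ n" by (simp add: qnum_def)
  then have "(q - 1) * qnum q (Suc n) = (q - 1) * qnum q n + (q - 1) * q ^ n" by (simp add: distrib_left)
  then show ?case unfolding Suc by (simp add: algebra_simps)
qed (simp add: qnum_def)

lemma prim_root_power_eq_1_iff:
  assumes "prim_root d q"
  shows "q ^ i = 1 \<longleftrightarrow> d dvd i"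
proof -
  have "q ^ i = (q ^ d) ^ (i div d) * q ^ (i mod d)" by (simp flip: power_mult power_add)
  also have "\<dots> = q ^ (i mod d)" using assms by (simp add: prim_root_def)
  finally have "q ^ i = q ^ (i mod d)" .
  then show ?thesis using assms unfolding prim_root_def
    by (metis dvd_imp_mod_0 mod_0_imp_dvd mod_less_divisor neq0_conv power_0)
qed

lemma qnum_prim_root_eq_0_iff:
  assumes "prim_root d q"
  shows "qnum q n = 0 \<longleftrightarrow> (if d = 1 then n = 0 else d dvd n)"
proof (cases "d = 1")
  case True
  then have "q = 1" using assms by (simp add: prim_root_def)
  then show ?thesis using True by (simp add: qnum_def)
next
  case False
  then have "q \<noteq> 1" using assms by (auto simp: prim_root_def dest: spec[of _ 1])
  then have "qnum q n = 0 \<longleftrightarrow> q ^ n = 1" using qnum_geom[of q n] by (metis eq_iff_diff_eq_0 mult_eq_0_iff)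
  then show ?thesis using False prim_root_power_eq_1_iff[OF assms] by simp
qed

lemma qnum_mult: "qnum q (d * t) = qnum q d * qnum (q ^ d) t"
proof (induction t)
  case (Suc t)
  have "qnum (q ^ d) (Suc t) = qnum (q ^ d) t + q ^ (d * t)" by (simp add: qnum_def power_mult)
  then show ?case using Suc by (simp add: qnum_add[of q "d * t" d, simplified add.commute[of _ d]] algebra_simps)
qed (simp add: qnum_def)

text \<open>What is left of the q-factorial when its zeros at primitive d-th roots of unity are divided out.\<close>
definition qfact_reg :: "nat \<Rightarrow> nat \<Rightarrow> complex poly" where
  "qfact_reg d n = (\<Prod>i<n. if d dvd Suc i then qnum ([:0, 1:] ^ d) (Suc i div d) else qnum [:0, 1:] (Suc i))"

lemma qfact_eq_reg:
  assumes "d > 0"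
  shows "qfact [:0, 1:] n = qnum [:0, 1:] d ^ (n div d) * qfact_reg d n"
proof (induction n)
  case (Suc n)
  show ?case
  proof (cases "d dvd Suc n")
    case True
    then have "qnum [:0, 1::complex:] (Suc n) = qnum [:0, 1:] d * qnum ([:0, 1:] ^ d) (Suc n div d)"
      using qnum_mult[of "[:0, 1::complex:]" d "Suc n div d"] by simp
    moreover have "Suc n div d = Suc (n div d)" using True by (simp add: div_Suc)
    ultimately show ?thesis using True Suc by (simp add: qfact_reg_def)
  next
    case False
    then have "Suc n div d = n div d" by (simp add: div_Suc dvd_eq_mod_eq_0)
    then show ?thesis using False Suc by (simp add: qfact_reg_def)
  qed
qed (simp add: qfact_reg_def)

text \<open>At q a factor whose index is a multiple of d becomes the integer quotient by d; the
  other factors are q-integers that do not vanish at q.\<close>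

lemma qfact_reg_nz:
  assumes "prim_root d q"
  shows "poly (qfact_reg d n) q \<noteq> 0"
proof -
  have d: "d > 0" "q ^ d = 1" using assms by (auto simp: prim_root_def)
  have "of_nat (Suc i div d) \<noteq> (0::complex)" if "d dvd Suc i" for i
    using that d by (metis Suc_neq_Zero dvd_div_eq_0_iff of_nat_eq_0_iff)
  moreover have "qnum q (Suc i) \<noteq> 0" if "\<not> d dvd Suc i" for i
    using that qnum_prim_root_eq_0_iff[OF assms] by simp
  ultimately show ?thesis
    unfolding qfact_reg_def poly_prod
    by (subst prod_zero_iff) (auto simp: poly_qnum d qnum_def[of 1])
qed

text \<open>The q-integers at q are periodic with period d. Each block of d factors thus contributes
  the same constant, times the integer left by its last factor.\<close>

lemma qfact_reg_mult:
  assumes "prim_root d q"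
  shows "poly (qfact_reg d (d * t)) q = fact t * (\<Prod>i<d - 1. qnum q (Suc i)) ^ t"
proof (induction t)
  case (Suc t)
  have d: "d > 0" "q ^ d = 1" using assms by (auto simp: prim_root_def)
  let ?g = "\<lambda>i. poly (if d dvd Suc i then qnum ([:0, 1:] ^ d) (Suc i div d) else qnum [:0, 1:] (Suc i)) q"
  have *: "{..<d * Suc t} = {..<d * t} \<union> {d * t..<d * Suc t}" by auto
  have "poly (qfact_reg d (d * Suc t)) q = poly (qfact_reg d (d * t)) q * (\<Prod>i\<in>{d * t..<d * Suc t}. ?g i)"
    unfolding qfact_reg_def poly_prod * by (rule prod.union_disjoint) auto
  also have "(\<Prod>i\<in>{d * t..<d * Suc t}. ?g i) = (\<Prod>j<d. ?g (d * t + j))"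
    by (rule prod.reindex_bij_witness[of _ "\<lambda>j. d * t + j" "\<lambda>i. i - d * t"]) auto
  also have "\<dots> = (\<Prod>j<Suc (d - 1). ?g (d * t + j))" using d by simp
  also have "\<dots> = (\<Prod>j<d - 1. ?g (d * t + j)) * ?g (d * t + (d - 1))" by simp
  also have "?g (d * t + (d - 1)) = of_nat (Suc t)"
  proof -
    have "Suc (d * t + (d - 1)) = d * Suc t" using d by simp
    then show ?thesis using d by (simp only:) (simp add: poly_qnum qnum_def[of 1] del: mult_Suc_right)
  qed
  also have "(\<Prod>j<d - 1. ?g (d * t + j)) = (\<Prod>j<d - 1. qnum q (Suc j))"
  proof (rule prod.cong[OF refl])
    fix j assume "j \<in> {..<d - 1}"
    then have j: "Suc j < d" by auto
    have "\<not> d dvd Suc (d * t + j)"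
      using j by (metis Suc_neq_Zero add_Suc_right dvd_add_right_iff dvd_triv_left nat_dvd_not_less zero_less_Suc)
    moreover have "qnum q (Suc (d * t + j)) = qnum q (Suc j)"
    proof -
      have "qnum q (d * t + Suc j) = qnum q (d * t) + q ^ (d * t) * qnum q (Suc j)" by (rule qnum_add)
      moreover have "qnum q (d * t) = qnum q d * of_nat t" using d by (simp add: qnum_mult qnum_def[of 1])
      moreover have "qnum q d = 0" using qnum_prim_root_eq_0_iff[OF assms, of d] j by auto
      ultimately show ?thesis using d by (simp add: power_mult)
    qed
    ultimately show "?g (d * t + j) = qnum q (Suc j)" by (simp add: poly_qnum)
  qed
  finally show ?case using Suc by (simp add: algebra_simps)
qed (simp add: qfact_reg_def)

lemma poly_sum_rmaj:
  "poly (\<Sum>x\<in>A. [:0, 1:] ^ f x) q = (\<Sum>x\<in>A. (q::complex) ^ f x)"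
  by (simp add: poly_sum)

text \<open>The zero of the numerator at q has order \<open>t\<close>, that of the denominator only
  \<open>s\<close>: rounding down the quotients of the multiplicities loses something as soon as one
  of them is not divisible by d.\<close>

lemma sum_rmaj_root_of_unity_0:
  assumes D: "descent_rel D" and q: "prim_root d q" and sz: "d dvd size M" and nd: "\<exists>a. \<not> d dvd count M a"
  shows "(\<Sum>x\<in>permutations_of_multiset M. q ^ rmaj D x) = 0"
proof -
  let ?X = "[:0, 1::complex:]"
  let ?F = "\<Sum>x\<in>permutations_of_multiset M. ?X ^ rmaj D x"
  let ?Q = "qnum ?X d"
  define e where "e = (\<Sum>a\<in>set_mset M. rmaj D (replicate (count M a) a))"
  define s where "s = (\<Sum>a\<in>set_mset M. count M a div d)"
  define t where "t = size M div d"
  have d: "d > 0" using q by (simp add: prim_root_def)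
  obtain a where a: "\<not> d dvd count M a" using nd by auto
  then have aM: "a \<in># M" by (metis count_eq_zero_iff dvd_0_right)
  have "s * d = (\<Sum>a\<in>set_mset M. count M a div d * d)" by (simp add: s_def sum_distrib_right)
  also have "\<dots> < (\<Sum>a\<in>set_mset M. count M a)"
    by (rule sum_strict_mono_ex1) (use aM a d in \<open>auto simp: dvd_eq_mod_eq_0 minus_mod_eq_div_mult[symmetric] intro!: bexI[of _ a]\<close>)
  also have "\<dots> = t * d" using sz by (simp add: size_multiset_overloaded_eq t_def)
  finally have st: "s < t" by simp
  have "?F * (\<Prod>a\<in>set_mset M. qfact ?X (count M a)) = ?X ^ e * qfact ?X (size M)"
    unfolding e_def by (rule sum_permutations_of_multiset_rmaj[OF D qfact_poly_nz])
  then have "?F * (?Q ^ s * (\<Prod>a\<in>set_mset M. qfact_reg d (count M a))) = ?X ^ e * (?Q ^ t * qfact_reg d (size M))"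
    unfolding qfact_eq_reg[OF d] prod.distrib power_sum[symmetric] s_def t_def .
  also have "?Q ^ t = ?Q ^ s * ?Q ^ (t - s)" using st by (simp add: power_add[symmetric])
  finally have "?Q ^ s * (?F * (\<Prod>a\<in>set_mset M. qfact_reg d (count M a))) =
      ?Q ^ s * (?X ^ e * (?Q ^ (t - s) * qfact_reg d (size M)))" by (simp only: mult_ac)
  moreover have "?Q \<noteq> 0" using qnum_poly_nz[of "d - 1"] d by simp
  ultimately have *: "?F * (\<Prod>a\<in>set_mset M. qfact_reg d (count M a)) =
      ?X ^ e * (?Q ^ (t - s) * qfact_reg d (size M))" by simp
  have "d \<noteq> 1" using a by auto
  then have "qnum q d = 0" using qnum_prim_root_eq_0_iff[OF q, of d] by simp
  then have "poly (?X ^ e * (?Q ^ (t - s) * qfact_reg d (size M))) q = 0"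
    using st by (simp add: poly_qnum)
  then have "poly ?F q * (\<Prod>a\<in>set_mset M. poly (qfact_reg d (count M a)) q) = 0"
    using arg_cong[OF *, of "\<lambda>p. poly p q"] by (simp add: poly_prod)
  then show ?thesis using qfact_reg_nz[OF q] unfolding poly_sum_rmaj by simp
qed

text \<open>Here the zeros of numerator and denominator have equal order. The periodic constants
  cancel as well, and an ordinary multinomial coefficient of the quotients remains.\<close>

lemma sum_rmaj_root_of_unity:
  assumes D: "descent_rel D" and q: "prim_root d q" and dv: "\<And>a. d dvd count M a"
  shows "(\<Sum>x\<in>permutations_of_multiset M. q ^ rmaj D x) * (\<Prod>a\<in>set_mset M. fact (count M a div d)) =
     q ^ (\<Sum>a\<in>set_mset M. rmaj D (replicate (count M a) a)) * fact (size M div d)"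
proof -
  let ?X = "[:0, 1::complex:]"
  let ?F = "\<Sum>x\<in>permutations_of_multiset M. ?X ^ rmaj D x"
  let ?Q = "qnum ?X d"
  define e where "e = (\<Sum>a\<in>set_mset M. rmaj D (replicate (count M a) a))"
  define t where "t = size M div d"
  define c where "c = (\<Prod>i<d - 1. qnum q (Suc i))"
  have d: "d > 0" using q by (simp add: prim_root_def)
  have t: "t = (\<Sum>a\<in>set_mset M. count M a div d)"
  proof -
    have "(\<Sum>a\<in>set_mset M. count M a div d) * d = size M"
      unfolding size_multiset_overloaded_eq sum_distrib_right by (rule sum.cong) (simp_all add: dv)
    then show ?thesis using d by (metis t_def div_mult_self_is_m)
  qed
  have szd: "d dvd size M" by (simp add: size_multiset_overloaded_eq dv dvd_sum)
  have "?F * (\<Prod>a\<in>set_mset M. qfact ?X (count M a)) = ?X ^ e * qfact ?X (size M)"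
    unfolding e_def by (rule sum_permutations_of_multiset_rmaj[OF D qfact_poly_nz])
  then have "?F * (?Q ^ t * (\<Prod>a\<in>set_mset M. qfact_reg d (count M a))) = ?X ^ e * (?Q ^ t * qfact_reg d (size M))"
    unfolding qfact_eq_reg[OF d] prod.distrib power_sum[symmetric] t t_def[symmetric] .
  then have "?Q ^ t * (?F * (\<Prod>a\<in>set_mset M. qfact_reg d (count M a))) =
      ?Q ^ t * (?X ^ e * qfact_reg d (size M))" by (simp only: mult_ac)
  moreover have "?Q \<noteq> 0" using qnum_poly_nz[of "d - 1"] d by simp
  ultimately have *: "?F * (\<Prod>a\<in>set_mset M. qfact_reg d (count M a)) = ?X ^ e * qfact_reg d (size M)"
    by simp
  have reg: "poly (qfact_reg d n) q = fact (n div d) * c ^ (n div d)" if "d dvd n" for n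
    using qfact_reg_mult[OF q, of "n div d"] that by (simp add: c_def)
  have "c \<noteq> 0" using qnum_prim_root_eq_0_iff[OF q]
    unfolding c_def by (subst prod_zero_iff) (auto dest: dvd_imp_le split: if_splits)
  then have ct: "c ^ t \<noteq> 0" by simp
  have "(poly ?F q * (\<Prod>a\<in>set_mset M. fact (count M a div d))) * c ^ t = (q ^ e * fact t) * c ^ t"
    using arg_cong[OF *, of "\<lambda>p. poly p q"]
    by (simp add: poly_prod reg dv szd prod.distrib t_def[symmetric] power_sum[symmetric] t[symmetric] mult.assoc)
  then show ?thesis unfolding mult_right_cancel[OF ct] poly_sum_rmaj e_def[symmetric] t_def[symmetric] .
qed

section \<open>Cyclic sieving for super words\<close>

text \<open>The super descent rule of signed tableaux, with "strictly lower row" replaced by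
  "strictly smaller letter". A repeated letter is a descent exactly when it is odd.\<close>

definition super_desc :: "letter \<Rightarrow> letter \<Rightarrow> bool" where
  "super_desc a b \<longleftrightarrow> \<not> snd b \<and> fst b < fst a \<or> snd a \<and> fst a \<le> fst b"

text \<open>An odd letter descends to every even one and no even letter to an odd one; odd letters
  compare by \<le> and even letters by >. So this is a total order with true diagonal on the odd
  letters.\<close>

lemma descent_rel_super_desc: "descent_rel super_desc"
  unfolding descent_rel_def super_desc_def
  by (intro conjI allI impI; force simp: prod_eq_iff)

lemma rmaj_super_desc_replicate:
  "2 * rmaj super_desc (replicate n a) = (if snd a then n * (n - 1) else 0)"
proof (induction n)
  case (Suc n)
  show ?case
  proof (cases n)
    case (Suc m)
    then show ?thesis using Suc.IH by (auto simp: super_desc_def)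
  qed simp
qed simp

section \<open>Powers of words and words fixed by a rotation\<close>

abbreviation list_pow :: "nat \<Rightarrow> 'a list \<Rightarrow> 'a list" where
  "list_pow d u \<equiv> concat (replicate d u)"

lemma list_pow_commute: "list_pow d u @ u = u @ list_pow d u"
  by (induction d) simp_all

lemma list_pow_add: "list_pow (c + d) u = list_pow c u @ list_pow d u"
  by (simp add: replicate_add)

lemma length_list_pow: "length (list_pow d u) = d * length u"
  by (induction d) simp_all

lemma commuting_imp_list_pow:
  assumes "x @ u = u @ x" "length x = d * length u" "u \<noteq> []"
  shows "x = list_pow d u"
  using assms
proof (induction d arbitrary: x)
  case (Suc d)
  have "take (length u) (x @ u) = u" using Suc.prems(1) by simp
  then have "take (length u) x = u" using Suc.prems(2) by simp
  then obtain y where y: "x = u @ y" by (metis append_take_drop_id)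
  have "y = list_pow d u"
    by (rule Suc.IH) (use Suc.prems y in auto)
  then show ?case using y by simp
qed simp

lemma rotate_mult_fixed: "rotate j w = w \<Longrightarrow> rotate (j * x) w = w"
  by (induction x) (simp_all add: rotate_rotate[symmetric] add.commute)

lemma rotate_list_pow: "rotate (j * length u) (list_pow d u) = list_pow d u"
proof -
  have "rotate (length u) (list_pow d u) = list_pow d u"
    by (cases d) (simp_all add: rotate_append list_pow_commute)
  from rotate_mult_fixed[OF this, of j] show ?thesis by (simp add: mult.commute)
qed

text \<open>By Bezout the rotation by the gcd also fixes \<open>w\<close>. Its prefix of that length
  then commutes with the rest of the word, which forces a power.\<close>

lemma rotate_fixed_imp_list_pow:
  assumes "rotate j w = w" "length w = k" "k > 0"
  defines "p \<equiv> gcd j k"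
  shows "w = list_pow (k div p) (take p w)"
proof -
  have p: "p > 0" "p dvd k" using assms(3) by (auto simp: p_def)
  have pk: "p \<le> k" using p assms(3) by (simp add: dvd_imp_le)
  have "rotate p w = w"
  proof (cases "j = 0")
    case True
    then show ?thesis using assms by simp
  next
    case False
    then obtain x y where xy: "j * x = k * y + p" using bezout_nat[OF False, of k] p_def by auto
    have "rotate p w = rotate ((k * y + p) mod length w) w"
      using rotate_conv_mod[of p w] assms(2) by simp
    also have "\<dots> = rotate (j * x) w" using xy rotate_conv_mod[of "j * x" w] by simp
    also have "\<dots> = w" by (rule rotate_mult_fixed) fact
    finally show ?thesis .
  qed
  define u x where "u = take p w" and "x = drop p w"
  have w: "w = u @ x" and lu: "length u = p" using pk assms(2) by (simp_all add: u_def x_def)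
  have "rotate p (u @ x) = x @ u" unfolding lu[symmetric] by (rule rotate_append)
  then have "x @ u = u @ x" using \<open>rotate p w = w\<close> w by simp
  moreover have "length x = (k div p - 1) * length u"
    using p lu assms(2) by (simp add: x_def diff_mult_distrib)
  ultimately have "x = list_pow (k div p - 1) u"
    using commuting_imp_list_pow p lu by (metis length_greater_0_conv)
  moreover have "k div p = Suc (k div p - 1)" using p pk by (simp add: div_greater_zero_iff)
  ultimately show ?thesis unfolding u_def[symmetric]
    by (metis concat.simps(2) replicate_Suc w)
qed

lemma mset_list_pow: "mset (list_pow d u) = repeat_mset d (mset u)"
  by (induction d) simp_all

lemma odd_count_append: "odd_count (u @ v) = odd_count u + odd_count v"
  by (simp add: odd_count_def)

lemma odd_count_list_pow: "odd_count (list_pow d u) = d * odd_count u"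
  by (induction d) (simp_all add: odd_count_append, simp add: odd_count_def)

lemma odd_count_mset: "odd_count u = (\<Sum>a\<in>set_mset (mset u). if snd a then count (mset u) a else 0)"
proof -
  have "odd_count u = size (filter_mset snd (mset u))"
    unfolding odd_count_def by (metis mset_filter size_mset)
  also have "\<dots> = (\<Sum>a\<in>set_mset (filter_mset snd (mset u)). count (mset u) a)"
    by (simp add: size_multiset_overloaded_eq)
  also have "\<dots> = (\<Sum>a\<in>set_mset (mset u). if snd a then count (mset u) a else 0)"
    by (rule sum.mono_neutral_cong_left) auto
  finally show ?thesis .
qed

text \<open>The Koszul sign for exchanging the first j letters with the others.\<close>

definition rotate_sign :: "nat \<Rightarrow> word \<Rightarrow> complex" where
  "rotate_sign j w = (-1) ^ (odd_count (take j w) * odd_count (drop j w))"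

lemma power_half_prim_root:
  assumes "prim_root d q" "even d"
  shows "q ^ (d div 2) = -1"
proof -
  have d: "d > 0" using assms by (simp add: prim_root_def)
  then have "d div 2 < d" "d div 2 > 0" using assms(2) by auto
  then have "q ^ (d div 2) \<noteq> 1" using assms by (auto simp: prim_root_def)
  moreover have "(q ^ (d div 2))\<^sup>2 = 1"
    using assms by (simp flip: power_mult add: prim_root_def)
  ultimately show ?thesis using power2_eq_1_iff by blast
qed

lemma minus_one_power_parity: "(-1::'a::ring_1) ^ m = (-1) ^ n" if "even m = even n"
  using that by (cases "even m") auto

text \<open>For even d both i and d - i are odd, so the right side is (-1)^b, while q^(d/2) = -1
  reduces the exponent (dn choose 2) of an odd letter to the sign (-1)^n. For odd d the exponent is
  a multiple of d, and one of i and d - i is even.\<close>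

lemma sieving_sign:
  assumes q: "prim_root d q" and cop: "coprime i d" and id: "i \<le> d"
    and b: "b = (\<Sum>a\<in>set_mset M. if snd a then count M a else 0)"
  shows "q ^ (\<Sum>a\<in>set_mset M. rmaj super_desc (replicate (d * count M a) a)) =
    (-1) ^ ((i * b) * ((d - i) * b))" (is "q ^ ?e = _")
proof -
  have d: "d > 0" "q ^ d = 1" using q by (auto simp: prim_root_def)
  show ?thesis
  proof (cases "even d")
    case True
    then have "odd i" using cop by (metis coprime_common_divisor odd_one)
    have "q ^ rmaj super_desc (replicate (d * n) a) = (-1) ^ (if snd a then n else 0)" for n a
    proof (cases "snd a \<and> n > 0")
      case t: True
      have "2 * rmaj super_desc (replicate (d * n) a) = 2 * ((d div 2) * (n * (d * n - 1)))"
        unfolding rmaj_super_desc_replicate using True t by simp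
      then have "rmaj super_desc (replicate (d * n) a) = (d div 2) * (n * (d * n - 1))" by simp
      then have "q ^ rmaj super_desc (replicate (d * n) a) = (-1) ^ (n * (d * n - 1))"
        by (simp only: power_mult power_half_prim_root[OF q True])
      also have "\<dots> = (-1) ^ n"
        using True t d by (intro minus_one_power_parity) auto
      finally show ?thesis using t by simp
    next
      case False
      then show ?thesis using rmaj_super_desc_replicate[of "d * n" a] by auto
    qed
    then have "q ^ ?e = (\<Prod>a\<in>set_mset M. (-1) ^ (if snd a then count M a else 0))"
      unfolding power_sum by (intro prod.cong refl) auto
    also have "\<dots> = (-1) ^ b" unfolding b power_sum ..
    also have "\<dots> = (-1) ^ ((i * b) * ((d - i) * b))"
      using True \<open>odd i\<close> id by (intro minus_one_power_parity) auto
    finally show ?thesis .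
  next
    case False
    have "d dvd rmaj super_desc (replicate (d * n) a)" for n a
    proof (cases "snd a")
      case True
      have "d dvd 2 * rmaj super_desc (replicate (d * n) a)"
        unfolding rmaj_super_desc_replicate using True by simp
      then show ?thesis using False by (simp add: coprime_dvd_mult_right_iff)
    next
      case False
      then show ?thesis using rmaj_super_desc_replicate[of "d * n" a] by auto
    qed
    then have "d dvd ?e" by (intro dvd_sum) auto
    then have "q ^ ?e = 1" using prim_root_power_eq_1_iff[OF q] by blast
    moreover have "even ((i * b) * ((d - i) * b))" using False id by auto
    ultimately show ?thesis by simp
  qed
qed

text \<open>With d = k / gcd(j,k), a fixed word is a d-th power. If d fails to divide some
  multiplicity, both sides vanish. Otherwise all fixed words carry the same sign, namely the power
  of q in the evaluated formula, and the remaining multinomial coefficient counts them.\<close>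

lemma sum_rmaj_eq_fixed_rotations:
  assumes k: "size M = k" "k > 0" and j: "j \<le> k" and q: "prim_root (k div gcd j k) q"
  shows "(\<Sum>w\<in>permutations_of_multiset M. q ^ rmaj super_desc w) =
     (\<Sum>w\<in>{w\<in>permutations_of_multiset M. rotate j w = w}. rotate_sign j w)"
proof -
  define p d where "p = gcd j k" and "d = k div p"
  have p: "p > 0" "k = d * p" using k by (simp_all add: p_def d_def)
  have d: "d > 0" using p k by (metis mult_0 neq0_conv)
  have q': "prim_root d q" using q by (simp add: d_def p_def)
  have len: "length w = k" if "w \<in> permutations_of_multiset M" for w
    using that k by (auto simp: permutations_of_multiset_def)
  show ?thesis
  proof (cases "\<forall>a. d dvd count M a")
    case False
    have "{w\<in>permutations_of_multiset M. rotate j w = w} = {}"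
    proof (intro equals0I, elim CollectE conjE)
      fix w assume w: "w \<in> permutations_of_multiset M" "rotate j w = w"
      have "w = list_pow d (take p w)"
        using rotate_fixed_imp_list_pow[OF w(2) len[OF w(1)] k(2)] by (simp add: d_def p_def)
      then have "M = repeat_mset d (mset (take p w))"
        using w(1) mset_list_pow by (metis permutations_of_multisetD)
      then show False using False by auto
    qed
    moreover have "(\<Sum>w\<in>permutations_of_multiset M. q ^ rmaj super_desc w) = 0"
      by (rule sum_rmaj_root_of_unity_0[OF descent_rel_super_desc q']) (use False k p in auto)
    ultimately show ?thesis by (simp only: sum.empty)
  next
    case True
    define i where "i = j div p"
    have i: "j = i * p" "i \<le> d" "coprime i d"
      using j p k unfolding i_def d_def p_def
      by (auto intro: div_le_mono div_gcd_coprime)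
    \<comment> \<open>The content of the word whose d-th power is the fixed word.\<close>
    define N where "N = Abs_multiset (\<lambda>a. count M a div d)"
    have "finite {a. 0 < count M a div d}"
      by (rule finite_subset[of _ "set_mset M"]) (auto simp: div_greater_zero_iff count_greater_zero_iff[symmetric] simp del: count_greater_zero_iff)
    then have cN: "count N a = count M a div d" for a by (simp add: N_def)
    have M: "M = repeat_mset d N" by (rule multiset_eqI) (metis True cN count_repeat_mset dvd_mult_div_cancel)
    have cM: "count M a = d * count N a" for a by (subst M) simp
    have sN: "set_mset M = set_mset N"
      using d cM by (auto simp flip: count_greater_zero_iff)
    have "size M = d * size N" by (subst M) simp
    then have szN: "size N = p" using k p d by simp
    have ex: "{w\<in>permutations_of_multiset M. rotate j w = w} = list_pow d ` permutations_of_multiset N"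
    proof (intro equalityI subsetI)
      fix w assume "w \<in> {w\<in>permutations_of_multiset M. rotate j w = w}"
      then have w: "w \<in> permutations_of_multiset M" "rotate j w = w" by auto
      have wp: "w = list_pow d (take p w)"
        using rotate_fixed_imp_list_pow[OF w(2) len[OF w(1)] k(2)] by (simp add: d_def p_def)
      then have "repeat_mset d N = repeat_mset d (mset (take p w))"
        using w(1) mset_list_pow M by (metis permutations_of_multisetD)
      then have "mset (take p w) = N" using d by (simp add: multiset_eq_iff)
      then show "w \<in> list_pow d ` permutations_of_multiset N" using wp by (auto simp: permutations_of_multiset_def)
    next
      fix w assume "w \<in> list_pow d ` permutations_of_multiset N"
      then obtain u where u: "w = list_pow d u" "mset u = N" by (auto simp: permutations_of_multiset_def)
      then have "length u = p" using szN by auto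
      then show "w \<in> {w\<in>permutations_of_multiset M. rotate j w = w}"
        using u rotate_list_pow[of i u d] i(1) M mset_list_pow[of d u] by (auto simp: permutations_of_multiset_def)
    qed
    have inj: "inj_on (list_pow d) (permutations_of_multiset N)"
    proof (rule inj_onI)
      fix u v assume uv: "u \<in> permutations_of_multiset N" "v \<in> permutations_of_multiset N" "list_pow d u = list_pow d v"
      obtain c where c: "d = Suc c" using d by (cases d) auto
      have "length u = length v" using uv by (metis permutations_of_multisetD size_mset)
      then show "u = v" using uv(3) c by simp
    qed
    define b where "b = (\<Sum>a\<in>set_mset N. if snd a then count N a else 0)"
    have sgn: "rotate_sign j (list_pow d u) = (-1) ^ ((i * b) * ((d - i) * b))"
      if "u \<in> permutations_of_multiset N" for u
    proof -
      have u: "mset u = N" using that by (rule permutations_of_multisetD)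
      then have lu: "length u = p" using szN by auto
      have ob: "odd_count u = b" unfolding odd_count_mset u b_def ..
      have "list_pow d u = list_pow i u @ list_pow (d - i) u"
        using list_pow_add[of i "d - i" u] i(2) by simp
      then have "take j (list_pow d u) = list_pow i u" "drop j (list_pow d u) = list_pow (d - i) u"
        using lu i(1) by (simp_all add: length_list_pow)
      then show ?thesis by (simp add: rotate_sign_def odd_count_list_pow ob)
    qed
    have F: "(\<Sum>w\<in>permutations_of_multiset M. q ^ rmaj super_desc w) * (\<Prod>a\<in>set_mset N. fact (count N a)) =
       q ^ (\<Sum>a\<in>set_mset N. rmaj super_desc (replicate (d * count N a) a)) * fact p"
      using sum_rmaj_root_of_unity[OF descent_rel_super_desc q', of M] True d p
      unfolding sN k(1) by (simp add: cM)
    have card: "of_nat (card (permutations_of_multiset N)) * (\<Prod>a\<in>set_mset N. fact (count N a)) = (fact p :: complex)"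
      using arg_cong[OF card_permutations_of_multiset_aux[of N], of "of_nat :: nat \<Rightarrow> complex"] szN by simp
    have nz: "(\<Prod>a\<in>set_mset N. fact (count N a)) \<noteq> (0::complex)" by simp
    have "(\<Sum>w\<in>permutations_of_multiset M. q ^ rmaj super_desc w) =
       (-1) ^ ((i * b) * ((d - i) * b)) * of_nat (card (permutations_of_multiset N))"
      using F unfolding sieving_sign[OF q' i(3,2) b_def] card[symmetric] mult.assoc[symmetric] mult_right_cancel[OF nz] .
    also have "\<dots> = (\<Sum>u\<in>permutations_of_multiset N. rotate_sign j (list_pow d u))"
      by (simp add: sgn)
    finally show ?thesis unfolding ex sum.reindex[OF inj] o_def .
  qed
qed

section \<open>Isolating a residue class of the major index by roots of unity\<close>

lemma prim_root_inverse: "prim_root k om \<Longrightarrow> prim_root k (inverse om)"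
  by (simp add: prim_root_def power_inverse)

lemma prim_root_power:
  assumes "prim_root k om"
  shows "prim_root (k div gcd j k) (om ^ j)"
proof -
  have k: "k > 0" using assms by (simp add: prim_root_def)
  define p where "p = gcd j k"
  have "p > 0" using k by (simp add: p_def)
  obtain k' j' where p: "k = p * k'" "j = p * j'" "coprime j' k'"
    using \<open>p > 0\<close> gcd_coprime_exists[of j k] unfolding p_def by (metis mult.commute not_gr_zero)
  have k': "k div p = k'" using p \<open>p > 0\<close> by simp
  have "(om ^ j) ^ i = 1 \<longleftrightarrow> k' dvd i" for i
  proof -
    have "(om ^ j) ^ i = 1 \<longleftrightarrow> k dvd j * i"
      by (simp flip: power_mult add: prim_root_power_eq_1_iff[OF assms])
    also have "\<dots> \<longleftrightarrow> k' dvd j' * i" using p \<open>p > 0\<close> by (simp add: mult.assoc)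
    also have "\<dots> \<longleftrightarrow> k' dvd i" using p(3)
      by (simp add: coprime_dvd_mult_right_iff coprime_commute)
    finally show ?thesis .
  qed
  moreover have "k' > 0" using p(1) k by (cases k') auto
  ultimately show ?thesis unfolding p_def[symmetric] prim_root_def k' by (auto dest: dvd_imp_le)
qed

lemma sum_powers_prim_root:
  assumes "prim_root k q"
  shows "(\<Sum>j<k. (q ^ i) ^ j) = (if k dvd i then of_nat k else 0)"
proof (cases "k dvd i")
  case True
  then have "q ^ i = 1" using prim_root_power_eq_1_iff[OF assms] by blast
  then show ?thesis using True by simp
next
  case False
  then have "q ^ i \<noteq> 1" using prim_root_power_eq_1_iff[OF assms] by simp
  moreover have "(q ^ i) ^ k = 1" using prim_root_power_eq_1_iff[OF assms] by (simp flip: power_mult)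
  ultimately have "qnum (q ^ i) k = 0" using qnum_geom[of "q ^ i" k] by simp
  then show ?thesis using False by (simp add: qnum_def)
qed

text \<open>Fourier inversion modulo k: the coefficient at j is the major index generating function
  at a power of the inverse root, hence the signed number of words fixed by rotation by j. Closure
  under rearrangement lets the set split into full content classes.\<close>

theorem card_maj_eq_1:
  assumes fin: "finite W" and len: "\<And>w. w \<in> W \<Longrightarrow> length w = k" and k: "k > 0"
    and closed: "\<And>w w'. w \<in> W \<Longrightarrow> mset w' = mset w \<Longrightarrow> w' \<in> W"
    and om: "prim_root k om"
  shows "of_nat k * of_nat (card {w\<in>W. list_maj super_desc w mod k = 1 mod k}) =
     (\<Sum>j<k. om ^ j * (\<Sum>w\<in>{w\<in>W. rotate j w = w}. rotate_sign j w))"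
proof -
  define ze where "ze = inverse om"
  have ze: "prim_root k ze" unfolding ze_def by (rule prim_root_inverse[OF om])
  have om0: "om \<noteq> 0" using om by (auto simp: prim_root_def power_0_left)
  have W: "W = (\<Union>M\<in>mset ` W. permutations_of_multiset M)"
    using closed by (auto simp: permutations_of_multiset_def)
  have split: "(\<Sum>w\<in>W. f w) = (\<Sum>M\<in>mset ` W. \<Sum>w\<in>permutations_of_multiset M. f w)" for f :: "word \<Rightarrow> complex"
    by (subst W, rule sum.UNION_disjoint)
       (use fin in \<open>auto, metis permutations_of_multisetD\<close>)
  have maj: "(\<Sum>w\<in>W. (ze ^ j) ^ list_maj super_desc w) = (\<Sum>w\<in>{w\<in>W. rotate j w = w}. rotate_sign j w)"
    if j: "j < k" for j
  proof -
    have "(\<Sum>w\<in>permutations_of_multiset M. (ze ^ j) ^ list_maj super_desc w) =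
       (\<Sum>w\<in>permutations_of_multiset M. if rotate j w = w then rotate_sign j w else 0)" if M: "M \<in> mset ` W" for M
    proof -
      \<comment> \<open>Reversal preserves the content, so both readings of the major index have the
        same distribution.\<close>
      have "(\<Sum>w\<in>permutations_of_multiset M. (ze ^ j) ^ list_maj super_desc w) =
         (\<Sum>w\<in>rev ` permutations_of_multiset M. (ze ^ j) ^ list_maj super_desc w)" by simp
      also have "\<dots> = (\<Sum>w\<in>permutations_of_multiset M. (ze ^ j) ^ rmaj super_desc w)"
        by (subst sum.reindex) (auto simp: rmaj_def)
      also have "\<dots> = (\<Sum>w\<in>{w\<in>permutations_of_multiset M. rotate j w = w}. rotate_sign j w)"
        by (rule sum_rmaj_eq_fixed_rotations[OF _ k _ prim_root_power[OF ze]]) (use M len j in auto)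
      finally show ?thesis by (simp add: sum.inter_filter)
    qed
    then have "(\<Sum>w\<in>W. (ze ^ j) ^ list_maj super_desc w) = (\<Sum>w\<in>W. if rotate j w = w then rotate_sign j w else 0)"
      unfolding split by (rule sum.cong[OF refl])
    then show ?thesis using fin by (simp add: sum.inter_filter)
  qed
  have *: "(\<Sum>j<k. om ^ j * (ze ^ j) ^ t) = (if t mod k = 1 mod k then of_nat k else 0)" for t
  proof -
    \<comment> \<open>The exponent t + (k - 1) stands for t - 1 modulo k without leaving the natural
      numbers.\<close>
    have "(\<Sum>j<k. om ^ j * (ze ^ j) ^ t) = (\<Sum>j<k. (ze ^ (t + (k - 1))) ^ j)"
    proof (rule sum.cong[OF refl])
      fix j
      have "ze ^ (k - 1) = om"
      proof -
        have "ze ^ (k - 1) * ze = 1" using ze k by (metis Suc_diff_1 power_Suc2 prim_root_def)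
        then show ?thesis using om0 by (simp add: ze_def field_simps)
      qed
      then show "om ^ j * (ze ^ j) ^ t = (ze ^ (t + (k - 1))) ^ j"
        by (simp add: power_add power_mult_distrib mult.commute flip: power_mult)
    qed
    also have "\<dots> = (if k dvd t + (k - 1) then of_nat k else 0)" by (rule sum_powers_prim_root[OF ze])
    also have "k dvd t + (k - 1) \<longleftrightarrow> t mod k = 1 mod k"
    proof -
      have "int (t + (k - 1)) = int t - 1 + int k" using k by simp
      then have "k dvd t + (k - 1) \<longleftrightarrow> int k dvd int t - 1"
        by (metis dvd_add_left_iff dvd_refl int_dvd_int_iff)
      also have "\<dots> \<longleftrightarrow> int t mod int k = 1 mod int k" by (simp add: mod_eq_dvd_iff)
      also have "\<dots> \<longleftrightarrow> t mod k = 1 mod k" by (metis of_nat_1 of_nat_eq_iff of_nat_mod)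
      finally show ?thesis .
    qed
    finally show ?thesis .
  qed
  have "(\<Sum>j<k. om ^ j * (\<Sum>w\<in>{w\<in>W. rotate j w = w}. rotate_sign j w)) =
     (\<Sum>j<k. \<Sum>w\<in>W. om ^ j * (ze ^ j) ^ list_maj super_desc w)"
    by (intro sum.cong refl) (simp add: maj[symmetric] sum_distrib_left)
  also have "\<dots> = (\<Sum>w\<in>W. if list_maj super_desc w mod k = 1 mod k then of_nat k else 0)"
    by (subst sum.swap) (simp only: *)
  also have "\<dots> = of_nat k * of_nat (card {w\<in>W. list_maj super_desc w mod k = 1 mod k})"
    using fin by (simp add: sum.inter_filter[symmetric])
  finally show ?thesis ..
qed

section \<open>Super shuffles and Lie elements\<close>

definition koszul :: "word \<Rightarrow> word \<Rightarrow> complex" where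
  "koszul u v = (-1) ^ (odd_count u * odd_count v)"

lemma odd_count_simps [simp]:
  "odd_count [] = 0" "odd_count (a # u) = (if snd a then 1 else 0) + odd_count u"
  "odd_count (u @ v) = odd_count u + odd_count v" "odd_count (rev u) = odd_count u"
  by (simp_all add: odd_count_def flip: rev_filter)

lemma koszul_simps [simp]: "koszul [] v = 1" "koszul u [] = 1"
  by (simp_all add: koszul_def)

lemma koszul_append: "koszul (u @ u') v = koszul u v * koszul u' v" "koszul u (v @ v') = koszul u v * koszul u v'"
  by (simp_all add: koszul_def power_add algebra_simps)

lemma koszul_Cons: "koszul (a # u) v = koszul [a] v * koszul u v" "koszul u (b # v) = koszul u [b] * koszul u v"
  using koszul_append(1)[of "[a]" u v] koszul_append(2)[of u "[b]" v] by simp_all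

lemma koszul_commute: "koszul u v = koszul v u"
  by (simp add: koszul_def mult.commute)

lemma koszul_square [simp]: "koszul u v * (koszul u v * z) = z"
proof -
  have "koszul u v * koszul u v = 1" by (simp add: koszul_def flip: power_mult_distrib)
  then show ?thesis by (simp flip: mult.assoc)
qed

lemma koszul_rev [simp]: "koszul (rev u) v = koszul u v" "koszul u (rev v) = koszul u v"
  by (simp_all add: koszul_def)

text \<open>The pairing of a tensor with the super shuffle product of two words.\<close>
fun shuffle_pairing :: "tensor \<Rightarrow> word \<Rightarrow> word \<Rightarrow> complex" where
  "shuffle_pairing f [] v = f v"
| "shuffle_pairing f u [] = f u"
| "shuffle_pairing f (a # u) (b # v) =
     shuffle_pairing (\<lambda>w. f (a # w)) u (b # v) + koszul [b] (a # u) * shuffle_pairing (\<lambda>w. f (b # w)) (a # u) v"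

lemma shuffle_pairing_Nil2 [simp]: "shuffle_pairing f u [] = f u"
  by (cases u) auto

lemma shuffle_pairing_add:
  "shuffle_pairing (\<lambda>w. f w + g w) u v = shuffle_pairing f u v + shuffle_pairing g u v"
proof (induction f u v arbitrary: g rule: shuffle_pairing.induct)
  case (3 f a u b v)
  show ?case using "3.IH"(1)[of "\<lambda>w. g (a # w)"] "3.IH"(2)[of "\<lambda>w. g (b # w)"]
    by (simp add: distrib_left)
qed simp_all

lemma shuffle_pairing_cmult:
  "shuffle_pairing (\<lambda>w. c * f w) u v = c * shuffle_pairing f u v"
  by (induction f u v rule: shuffle_pairing.induct) (simp_all add: algebra_simps)

lemma shuffle_pairing_0: "shuffle_pairing (\<lambda>w. 0) u v = 0"
  using shuffle_pairing_cmult[of 0 "\<lambda>w. 0" u v] by simp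

text \<open>The recursion at the other end of the words. The sign now belongs to the term ending in
  \<open>a\<close>, since that letter has to pass the whole second word.\<close>

lemma shuffle_pairing_snoc:
  "shuffle_pairing f (u @ [a]) (v @ [b]) =
     koszul [a] (v @ [b]) * shuffle_pairing (\<lambda>w. f (w @ [a])) u (v @ [b])
     + shuffle_pairing (\<lambda>w. f (w @ [b])) (u @ [a]) v"
proof (induction "length u + length v" arbitrary: f u v rule: less_induct)
  case less
  show ?case
  proof (cases u)
    case Nil
    show ?thesis
    proof (cases v)
      case Nil
      then show ?thesis using \<open>u = []\<close> by (simp add: koszul_commute add.commute)
    next
      case v: (Cons c v')
      have IH: "shuffle_pairing (\<lambda>w. f (c # w)) [a] (v' @ [b]) =
         koszul [a] (v' @ [b]) * f (c # v' @ [b] @ [a]) + shuffle_pairing (\<lambda>w. f (c # w @ [b])) [a] v'"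
        using less[of u v' "\<lambda>w. f (c # w)"] v Nil by simp
      have k: "koszul [a] (c # v' @ [b]) = koszul [c] [a] * koszul [a] (v' @ [b])"
        by (simp only: koszul_Cons(2)[of "[a]" c "v' @ [b]"] koszul_commute[of "[c]" "[a]"])
      show ?thesis using IH Nil v by (simp add: k algebra_simps)
    qed
  next
    case u: (Cons d u')
    show ?thesis
    proof (cases v)
      case Nil
      have IH: "shuffle_pairing (\<lambda>w. f (d # w)) (u' @ [a]) [b] =
         koszul [a] [b] * shuffle_pairing (\<lambda>w. f (d # w @ [a])) u' [b] + f (d # u' @ [a, b])"
        using less[of u' v "\<lambda>w. f (d # w)"] u Nil by simp
      have k: "koszul [b] (d # u' @ [a]) = koszul [a] [b] * koszul [b] (d # u')"
        by (simp add: koszul_append(2)[of "[b]" "d # u'" "[a]", simplified] koszul_commute mult.commute)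
      show ?thesis using IH Nil u by (simp add: k algebra_simps)
    next
      case v: (Cons c v')
      have IH1: "shuffle_pairing (\<lambda>w. f (d # w)) (u' @ [a]) (v @ [b]) =
         koszul [a] (v @ [b]) * shuffle_pairing (\<lambda>w. f (d # w @ [a])) u' (v @ [b])
         + shuffle_pairing (\<lambda>w. f (d # w @ [b])) (u' @ [a]) v"
        using less[of u' v "\<lambda>w. f (d # w)"] u by simp
      have IH2: "shuffle_pairing (\<lambda>w. f (c # w)) (u @ [a]) (v' @ [b]) =
         koszul [a] (v' @ [b]) * shuffle_pairing (\<lambda>w. f (c # w @ [a])) u (v' @ [b])
         + shuffle_pairing (\<lambda>w. f (c # w @ [b])) (u @ [a]) v'"
        using less[of u v' "\<lambda>w. f (c # w)"] v by simp
      have k1: "koszul [c] (d # u' @ [a]) = koszul [a] [c] * koszul [c] (d # u')"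
        by (simp add: koszul_append(2)[of "[c]" "d # u'" "[a]", simplified] koszul_commute mult.commute)
      have k2: "koszul [a] (c # v' @ [b]) = koszul [a] [c] * koszul [a] (v' @ [b])"
        by (rule koszul_Cons)
      show ?thesis using IH1 IH2 u v by (simp add: k1 k2 algebra_simps)
    qed
  qed
qed

section \<open>Deconcatenation and the pairing of products\<close>

lemma tmul_Nil [simp]: "tmul f g [] = f [] * g []"
  by (simp add: tmul_def)

lemma tmul_Cons: "tmul f g (a # w) = f [] * g (a # w) + tmul (\<lambda>w. f (a # w)) g w"
  unfolding tmul_def by (simp add: sum.atMost_Suc_shift del: sum.atMost_Suc)

text \<open>The pairing of f and g with the product of the deconcatenations of u and v in the super
  tensor square. The sign moves the second part of u past the first part of v.\<close>

definition coproduct_sum :: "tensor \<Rightarrow> tensor \<Rightarrow> word \<Rightarrow> word \<Rightarrow> complex" where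
  "coproduct_sum f g u v = (\<Sum>i\<le>length u. \<Sum>j\<le>length v. koszul (drop i u) (take j v) *
      (shuffle_pairing f (take i u) (take j v) * shuffle_pairing g (drop i u) (drop j v)))"

lemma coproduct_sum_Nil1: "coproduct_sum f g [] v = tmul f g v"
  by (simp add: coproduct_sum_def tmul_def)

lemma coproduct_sum_Nil2: "coproduct_sum f g u [] = tmul f g u"
  by (simp add: coproduct_sum_def tmul_def)

text \<open>The left factor is either empty or starts with the first letter of one of the two words.
  This recursion matches that of \<open>tmul\<close> and of the pairing.\<close>

lemma coproduct_sum_Cons:
  "coproduct_sum f g (a # u) (b # v) = f [] * shuffle_pairing g (a # u) (b # v)
     + coproduct_sum (\<lambda>w. f (a # w)) g u (b # v)
     + koszul [b] (a # u) * coproduct_sum (\<lambda>w. f (b # w)) g (a # u) v"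
proof -
  let ?m = "length u" and ?n = "length v"
  let ?t = "\<lambda>f u v i j. koszul (drop i u) (take j v) *
      (shuffle_pairing f (take i u) (take j v) * shuffle_pairing g (drop i u) (drop j v))"
  let ?fa = "\<lambda>w. f (a # w)" and ?fb = "\<lambda>w. f (b # w)"
  have "coproduct_sum f g (a # u) (b # v) =
     (\<Sum>j\<le>Suc ?n. ?t f (a # u) (b # v) 0 j) + (\<Sum>i\<le>?m. \<Sum>j\<le>Suc ?n. ?t f (a # u) (b # v) (Suc i) j)"
    unfolding coproduct_sum_def by (simp add: sum.atMost_Suc_shift del: sum.atMost_Suc take_Suc_Cons drop_Suc_Cons shuffle_pairing.simps)
  also have "\<dots> = (?t f (a # u) (b # v) 0 0 + (\<Sum>j\<le>?n. ?t f (a # u) (b # v) 0 (Suc j)))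
      + (\<Sum>i\<le>?m. ?t f (a # u) (b # v) (Suc i) 0 + (\<Sum>j\<le>?n. ?t f (a # u) (b # v) (Suc i) (Suc j)))"
    by (simp only: sum.atMost_Suc_shift)
  also have "\<dots> = f [] * shuffle_pairing g (a # u) (b # v) + (\<Sum>j\<le>?n. ?t f (a # u) (b # v) 0 (Suc j))
      + (\<Sum>i\<le>?m. ?t f (a # u) (b # v) (Suc i) 0) + (\<Sum>i\<le>?m. \<Sum>j\<le>?n. ?t f (a # u) (b # v) (Suc i) (Suc j))"
    by (simp add: sum.distrib add.assoc)
  also have "(\<Sum>i\<le>?m. ?t f (a # u) (b # v) (Suc i) 0) = (\<Sum>i\<le>?m. ?t ?fa u (b # v) i 0)"
    by simp
  also have "(\<Sum>j\<le>?n. ?t f (a # u) (b # v) 0 (Suc j)) = (\<Sum>j\<le>?n. koszul [b] (a # u) * ?t ?fb (a # u) v 0 j)"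
  proof (rule sum.cong[OF refl])
    fix j
    have "koszul (a # u) (b # take j v) = koszul [b] (a # u) * koszul (a # u) (take j v)"
      by (simp only: koszul_Cons(2)[of "a # u" b "take j v"] koszul_commute[of "a # u" "[b]"])
    then show "?t f (a # u) (b # v) 0 (Suc j) = koszul [b] (a # u) * ?t ?fb (a # u) v 0 j" by simp
  qed
  also have "(\<Sum>i\<le>?m. \<Sum>j\<le>?n. ?t f (a # u) (b # v) (Suc i) (Suc j)) =
     (\<Sum>i\<le>?m. \<Sum>j\<le>?n. ?t ?fa u (b # v) i (Suc j) + koszul [b] (a # u) * ?t ?fb (a # u) v (Suc i) j)"
  proof (intro sum.cong refl)
    fix i j
    have "koszul [b] (a # u) = koszul [b] (a # take i u) * koszul [b] (drop i u)"
      using koszul_append(2)[of "[b]" "a # take i u" "drop i u"] by simp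
    moreover have "koszul (drop i u) (b # take j v) = koszul [b] (drop i u) * koszul (drop i u) (take j v)"
      by (simp only: koszul_Cons(2)[of "drop i u" b "take j v"] koszul_commute[of "drop i u" "[b]"])
    ultimately have *: "koszul (drop i u) (b # take j v) * koszul [b] (a # take i u) =
        koszul [b] (a # u) * koszul (drop i u) (take j v)" by simp
    have "?t f (a # u) (b # v) (Suc i) (Suc j) = ?t ?fa u (b # v) i (Suc j) +
        (koszul (drop i u) (b # take j v) * koszul [b] (a # take i u)) *
        (shuffle_pairing ?fb (a # take i u) (take j v) * shuffle_pairing g (drop i u) (drop j v))"
      by (simp add: distrib_left distrib_right mult.assoc)
    then show "?t f (a # u) (b # v) (Suc i) (Suc j) =
        ?t ?fa u (b # v) i (Suc j) + koszul [b] (a # u) * ?t ?fb (a # u) v (Suc i) j"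
      unfolding * by (simp add: mult.assoc)
  qed
  also have "f [] * shuffle_pairing g (a # u) (b # v) + (\<Sum>j\<le>?n. koszul [b] (a # u) * ?t ?fb (a # u) v 0 j)
      + (\<Sum>i\<le>?m. ?t ?fa u (b # v) i 0)
      + (\<Sum>i\<le>?m. \<Sum>j\<le>?n. ?t ?fa u (b # v) i (Suc j) + koszul [b] (a # u) * ?t ?fb (a # u) v (Suc i) j)
    = f [] * shuffle_pairing g (a # u) (b # v)
      + (\<Sum>i\<le>?m. ?t ?fa u (b # v) i 0 + (\<Sum>j\<le>?n. ?t ?fa u (b # v) i (Suc j)))
      + koszul [b] (a # u) * ((\<Sum>j\<le>?n. ?t ?fb (a # u) v 0 j) + (\<Sum>i\<le>?m. \<Sum>j\<le>?n. ?t ?fb (a # u) v (Suc i) j))"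
    by (simp only: sum.distrib sum_distrib_left[symmetric] distrib_left add_ac)
  also have "(\<Sum>i\<le>?m. ?t ?fa u (b # v) i 0 + (\<Sum>j\<le>?n. ?t ?fa u (b # v) i (Suc j))) = coproduct_sum ?fa g u (b # v)"
    unfolding coproduct_sum_def by (simp only: sum.atMost_Suc_shift list.size add_0_right add_Suc_right)
  also have "(\<Sum>j\<le>?n. ?t ?fb (a # u) v 0 j) + (\<Sum>i\<le>?m. \<Sum>j\<le>?n. ?t ?fb (a # u) v (Suc i) j) =
      coproduct_sum ?fb g (a # u) v"
    unfolding coproduct_sum_def by (simp only: sum.atMost_Suc_shift list.size add_0_right add_Suc_right)
  finally show ?thesis .
qed

text \<open>The deconcatenation coproduct is an algebra morphism for the super shuffle product, dually.\<close>
theorem shuffle_pairing_tmul: "shuffle_pairing (tmul f g) u v = coproduct_sum f g u v"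
proof (induction "length u + length v" arbitrary: f u v rule: less_induct)
  case less
  show ?case
  proof (cases u)
    case Nil
    then show ?thesis by (simp add: coproduct_sum_Nil1)
  next
    case u: (Cons a u')
    show ?thesis
    proof (cases v)
      case Nil
      then show ?thesis by (simp add: coproduct_sum_Nil2)
    next
      case v: (Cons b v')
      have "shuffle_pairing (tmul f g) u v =
         shuffle_pairing (\<lambda>w. f [] * g (a # w) + tmul (\<lambda>w. f (a # w)) g w) u' v
         + koszul [b] u * shuffle_pairing (\<lambda>w. f [] * g (b # w) + tmul (\<lambda>w. f (b # w)) g w) u v'"
        unfolding u v by (simp add: tmul_Cons)
      also have "\<dots> = f [] * shuffle_pairing g u v + coproduct_sum (\<lambda>w. f (a # w)) g u' v
         + koszul [b] u * coproduct_sum (\<lambda>w. f (b # w)) g u v'"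
        using less[of u' v] less[of u v'] u v
        by (simp add: shuffle_pairing_add shuffle_pairing_cmult algebra_simps)
      finally show ?thesis unfolding u v coproduct_sum_Cons .
    qed
  qed
qed

text \<open>The super form of Ree's criterion for Lie elements, expressed in coefficients.\<close>

definition primitive :: "tensor \<Rightarrow> bool" where
  "primitive f \<longleftrightarrow> f [] = 0 \<and> (\<forall>u v. u \<noteq> [] \<longrightarrow> v \<noteq> [] \<longrightarrow> shuffle_pairing f u v = 0)"

text \<open>In a nonzero term each factor is paired with one empty and one nonempty word. Only the
  two splittings that give all of u to one factor and all of v to the other satisfy this.\<close>

lemma coproduct_sum_primitive:
  assumes f: "primitive f" and g: "primitive g" and "u \<noteq> []" "v \<noteq> []"
  shows "coproduct_sum f g u v = f u * g v + koszul u v * (f v * g u)"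
proof -
  let ?t = "\<lambda>i j. koszul (drop i u) (take j v) *
      (shuffle_pairing f (take i u) (take j v) * shuffle_pairing g (drop i u) (drop j v))"
  have t: "?t i j = (if i = length u \<and> j = 0 then f u * g v else 0) +
     (if i = 0 \<and> j = length v then koszul u v * (f v * g u) else 0)" if "i \<le> length u" "j \<le> length v" for i j
  proof -
    have f0: "f [] = 0" "x \<noteq> [] \<Longrightarrow> y \<noteq> [] \<Longrightarrow> shuffle_pairing f x y = 0" for x y
      using f by (auto simp: primitive_def)
    have g0: "g [] = 0" "x \<noteq> [] \<Longrightarrow> y \<noteq> [] \<Longrightarrow> shuffle_pairing g x y = 0" for x y
      using g by (auto simp: primitive_def)
    have l: "length u > 0" "length v > 0" using assms(3,4) by auto
    show ?thesis
    proof (cases "i > 0 \<and> j > 0")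
      case True
      then have "shuffle_pairing f (take i u) (take j v) = 0" using l by (intro f0) auto
      then show ?thesis using True by auto
    next
      case ij: False
      show ?thesis
      proof (cases "i < length u \<and> j < length v")
        case True
        then have "shuffle_pairing g (drop i u) (drop j v) = 0" by (intro g0) auto
        then show ?thesis using True by auto
      next
        case False
        then have "i = 0 \<and> j = length v \<or> j = 0 \<and> i = length u" using ij that l by auto
        then show ?thesis
        proof (elim disjE conjE)
          assume "i = 0" "j = length v"
          then show ?thesis using l by simp
        next
          assume "j = 0" "i = length u"
          then show ?thesis using l by simp
        qed
      qed
    qed
  qed
  have "coproduct_sum f g u v = (\<Sum>i\<le>length u. \<Sum>j\<le>length v. (if i = length u \<and> j = 0 then f u * g v else 0) +
     (if i = 0 \<and> j = length v then koszul u v * (f v * g u) else 0))"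
    unfolding coproduct_sum_def by (intro sum.cong refl t) auto
  also have "\<dots> = (\<Sum>i\<le>length u. (if i = length u then f u * g v else 0) +
      (if i = 0 then koszul u v * (f v * g u) else 0))"
  proof (rule sum.cong[OF refl])
    fix i
    have "(\<Sum>j\<le>length v. if i = length u \<and> j = 0 then f u * g v else 0) = (if i = length u then f u * g v else 0)"
      by (cases "i = length u") simp_all
    moreover have "(\<Sum>j\<le>length v. if i = 0 \<and> j = length v then koszul u v * (f v * g u) else 0) =
        (if i = 0 then koszul u v * (f v * g u) else 0)"
      by (cases "i = 0") simp_all
    ultimately show "(\<Sum>j\<le>length v. (if i = length u \<and> j = 0 then f u * g v else 0) +
        (if i = 0 \<and> j = length v then koszul u v * (f v * g u) else 0)) =
      (if i = length u then f u * g v else 0) + (if i = 0 then koszul u v * (f v * g u) else 0)"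
      by (simp only: sum.distrib)
  qed
  also have "\<dots> = f u * g v + koszul u v * (f v * g u)"
    by (simp add: sum.distrib)
  finally show ?thesis .
qed

text \<open>Brackets are multihomogeneous. In particular the parity is constant on the support,
  which lets the sign in a bracket be read as a Koszul sign of words.\<close>

lemma beval_support: "beval t w \<noteq> 0 \<Longrightarrow> mset w = mset (leaves t)"
proof (induction t arbitrary: w)
  case (Leaf a)
  then show ?case by (simp add: wvec_def split: if_splits)
next
  case (Node s t)
  have *: "mset w = mset (leaves s) + mset (leaves t)"
    if "tmul f g w \<noteq> 0" "\<And>w. f w \<noteq> 0 \<Longrightarrow> mset w = A" "\<And>w. g w \<noteq> 0 \<Longrightarrow> mset w = B"
       "A + B = mset (leaves s) + mset (leaves t)" for f g and A B :: "letter multiset"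
  proof -
    from that(1) obtain i where "f (take i w) * g (drop i w) \<noteq> 0"
      unfolding tmul_def by (rule sum.not_neutral_contains_not_neutral)
    then have "f (take i w) \<noteq> 0" "g (drop i w) \<noteq> 0" by simp_all
    then have "mset (take i w) = A" "mset (drop i w) = B" using that(2,3) by blast+
    moreover have "mset w = mset (take i w) + mset (drop i w)" by (simp flip: mset_append)
    ultimately show ?thesis using that(4) by simp
  qed
  consider "tmul (beval s) (beval t) w \<noteq> 0" | "tmul (beval t) (beval s) w \<noteq> 0"
    using Node.prems by (cases "tmul (beval t) (beval s) w = 0") (auto simp: tscale_def)
  then show ?case
  proof cases
    case 1
    then show ?thesis using *[OF 1 Node.IH] by simp
  next
    case 2
    then show ?thesis using *[OF 2 Node.IH(2,1)] by (simp add: add.commute)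
  qed
qed

lemma odd_count_cong: "mset u = mset v \<Longrightarrow> odd_count u = odd_count v"
  unfolding odd_count_def by (metis mset_filter size_mset)

text \<open>The pairing of a product of primitive tensors with two nonempty words has two terms; the
  sign of the bracket is the one for which the opposite product cancels both.\<close>

lemma primitive_beval: "primitive (beval t)"
proof (induction t)
  case (Leaf a)
  have "shuffle_pairing (wvec [a]) u v = 0" if "u \<noteq> []" "v \<noteq> []" for u v
  proof -
    have z: "shuffle_pairing f u v = 0" if "\<And>w. length w = length u + length v \<Longrightarrow> f w = 0" for f u v
      using that by (induction f u v rule: shuffle_pairing.induct) auto
    show ?thesis by (rule z) (use that in \<open>auto simp: wvec_def neq_Nil_conv\<close>)
  qed
  then show ?case by (simp add: primitive_def wvec_def)
next
  case (Node s t)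
  let ?c = "(-1) ^ (tpar s * tpar t) :: complex"
  have c: "koszul u v = ?c" if "beval s u \<noteq> 0" "beval t v \<noteq> 0" for u v
  proof -
    have "odd_count u = odd_count (leaves s)" "odd_count v = odd_count (leaves t)"
      using that beval_support odd_count_cong by blast+
    moreover have "(-1::complex) ^ (a * b) = (-1) ^ (a mod 2 * (b mod 2))" for a b :: nat
      by (simp add: minus_one_power_iff)
    ultimately show ?thesis by (simp add: koszul_def tpar_def)
  qed
  have "shuffle_pairing (beval (Node s t)) u v = 0" if uv: "u \<noteq> []" "v \<noteq> []" for u v
  proof -
    have "beval (Node s t) = (\<lambda>w. tmul (beval s) (beval t) w + (- ?c) * tmul (beval t) (beval s) w)"
      by (auto simp: tscale_def)
    then have "shuffle_pairing (beval (Node s t)) u v =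
       coproduct_sum (beval s) (beval t) u v - ?c * coproduct_sum (beval t) (beval s) u v"
      by (simp only: shuffle_pairing_add shuffle_pairing_cmult shuffle_pairing_tmul) simp
    also have "\<dots> = (beval s u * beval t v + koszul u v * (beval s v * beval t u))
        - ?c * (beval t u * beval s v + koszul u v * (beval t v * beval s u))"
      unfolding coproduct_sum_primitive[OF Node.IH uv] coproduct_sum_primitive[OF Node.IH(2,1) uv] ..
    also have "\<dots> = beval s u * beval t v * (1 - ?c * koszul u v) + beval s v * beval t u * (koszul u v - ?c)"
      by (simp add: algebra_simps)
    also have "\<dots> = 0"
    proof -
      have A: "beval s u * beval t v * (1 - ?c * koszul u v) = 0"
        using c[of u v] by (cases "beval s u = 0 \<or> beval t v = 0") (auto simp flip: power_mult_distrib)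
      have B: "beval s v * beval t u * (koszul u v - ?c) = 0"
        using c[of v u] by (cases "beval s v = 0 \<or> beval t u = 0") (auto simp: koszul_commute)
      show ?thesis unfolding A B by simp
    qed
    finally show ?thesis .
  qed
  moreover have "beval (Node s t) [] = 0" using Node by (simp add: tscale_def primitive_def)
  ultimately show ?case unfolding primitive_def by blast
qed


section \<open>Right-normed brackets and the Dynkin operator\<close>

fun right_comb :: "word \<Rightarrow> btree" where
  "right_comb [] = Leaf undefined"
| "right_comb [a] = Leaf a"
| "right_comb (a # b # w) = Node (Leaf a) (right_comb (b # w))"

lemma leaves_right_comb: "w \<noteq> [] \<Longrightarrow> leaves (right_comb w) = w"
  by (induction w rule: right_comb.induct) auto

lemma tmul_letter_left: "tmul (wvec [a]) g x = (if x \<noteq> [] \<and> hd x = a then g (tl x) else 0)"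
proof (cases x)
  case (Cons b y)
  have 1: "tmul (\<lambda>w. wvec [a] (b # w)) g y = (if b = a then g y else 0)" for y
  proof -
    have "tmul (\<lambda>w. wvec [a] (b # w)) g y =
        (\<Sum>i\<le>length y. if i = 0 then (if b = a then g y else 0) else 0)"
      unfolding tmul_def by (rule sum.cong) (auto simp: wvec_def)
    then show ?thesis by simp
  qed
  show ?thesis unfolding Cons tmul_Cons 1 by (simp add: wvec_def)
qed (simp add: tmul_def wvec_def)

lemma tmul_letter_right: "tmul g (wvec [a]) x = (if x \<noteq> [] \<and> last x = a then g (butlast x) else 0)"
proof (cases x rule: rev_cases)
  case (snoc y b)
  have "tmul g (wvec [a]) x = (\<Sum>i\<le>length x. if i = length y then (if b = a then g y else 0) else 0)"
    unfolding tmul_def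
  proof (rule sum.cong[OF refl])
    fix i assume i: "i \<in> {..length x}"
    show "g (take i x) * wvec [a] (drop i x) = (if i = length y then (if b = a then g y else 0) else 0)"
    proof (cases "i = length y")
      case True
      then show ?thesis using snoc by (simp add: wvec_def)
    next
      case False
      then have "length (drop i x) \<noteq> 1" using i snoc by auto
      then have "drop i x \<noteq> [a]" by (metis One_nat_def length_Cons list.size(3))
      then show ?thesis using False by (simp add: wvec_def)
    qed
  qed
  then show ?thesis using snoc by simp
qed (simp add: tmul_def wvec_def)

text \<open>A coefficient of the bracket with a letter sees this letter only at the front or at the
  back, so the Dynkin operator peels a word from both ends.\<close>

lemma beval_right_comb_Cons:
  assumes "w \<noteq> []"
  shows "beval (right_comb (a # w)) x =
    (if x \<noteq> [] \<and> hd x = a then beval (right_comb w) (tl x) else 0)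
    - (if x \<noteq> [] \<and> last x = a then koszul [a] (butlast x) * beval (right_comb w) (butlast x) else 0)"
proof -
  obtain b v where w: "w = b # v" using assms by (cases w) auto
  have "koszul [a] y = (-1) ^ (tpar (Leaf a) * tpar (right_comb w))" if "beval (right_comb w) y \<noteq> 0" for y
  proof -
    have "odd_count y = odd_count w"
      using beval_support[OF that] leaves_right_comb[OF assms] odd_count_cong by metis
    then show ?thesis using leaves_right_comb[OF assms]
      by (simp add: koszul_def tpar_def minus_one_power_iff)
  qed
  then have "(-1) ^ (tpar (Leaf a) * tpar (right_comb w)) * beval (right_comb w) y =
      koszul [a] y * beval (right_comb w) y" for y
    by (cases "beval (right_comb w) y = 0") auto
  then show ?thesis
    unfolding w by (simp add: tscale_def tmul_letter_left tmul_letter_right)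
qed

definition words_over :: "letter set \<Rightarrow> nat \<Rightarrow> word set" where
  "words_over A n = {w. set w \<subseteq> A \<and> length w = n}"

lemma finite_words_over: "finite A \<Longrightarrow> finite (words_over A n)"
  unfolding words_over_def by (rule finite_lists_length_eq)

lemma sum_words_over_Suc:
  "(\<Sum>w\<in>words_over A (Suc n). F w) = (\<Sum>a\<in>A. \<Sum>w\<in>words_over A n. F (a # w))"
proof -
  have "words_over A (Suc n) = (\<lambda>(a, w). a # w) ` (A \<times> words_over A n)"
    by (auto simp: words_over_def length_Suc_conv)
  then have "(\<Sum>w\<in>words_over A (Suc n). F w) = (\<Sum>(a, w)\<in>A \<times> words_over A n. F (a # w))"
    by (simp add: sum.reindex inj_on_def case_prod_unfold)
  then show ?thesis by (simp add: sum.cartesian_product)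
qed

text \<open>The sign of the antipode, (-1)^length times the sign of reversing the odd letters,
  normalized to 1 on single letters.\<close>

definition rev_sign :: "word \<Rightarrow> complex" where
  "rev_sign y = (-1) ^ (length y + 1 + (odd_count y choose 2))"

lemma rev_sign_Nil [simp]: "rev_sign [] = -1"
  by (simp add: rev_sign_def numeral_2_eq_2)

lemma rev_sign_simps: "rev_sign [c] = 1" "rev_sign (b # y) = - (koszul [b] y * rev_sign y)"
   "rev_sign (rev y) = rev_sign y"
proof -
  have "Suc n choose 2 = n + (n choose 2)" for n by (simp add: numeral_2_eq_2)
  then show "rev_sign (b # y) = - (koszul [b] y * rev_sign y)"
    by (simp add: rev_sign_def koszul_def power_add)
  show "rev_sign [c] = 1" by (simp add: rev_sign_def numeral_2_eq_2)
qed (simp add: rev_sign_def)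

text \<open>The contribution of the brackets whose innermost letter sits at place i of x: letters to
  its left were peeled from the front, those to its right from the back and hence in reverse order,
  in any interleaving.\<close>

definition dynkin_term :: "tensor \<Rightarrow> word \<Rightarrow> nat \<Rightarrow> complex" where
  "dynkin_term f x i = rev_sign (drop i x) *
     shuffle_pairing (\<lambda>w. f (w @ [x ! i])) (take i x) (rev (drop (Suc i) x))"

text \<open>The outermost letter of the bracket was peeled from the front or from the back. The
  exclusions at the two ends hold because the innermost letter itself cannot be peeled.\<close>

lemma dynkin_term_step:
  assumes x: "x = b # y" "x = z @ [c]" and y: "y \<noteq> []" and i: "i < length x"
  shows "dynkin_term f x i = (if i = 0 then 0 else dynkin_term (\<lambda>w. f (b # w)) y (i - 1))
     + (if i = length z then 0 else - koszul [c] z * dynkin_term (\<lambda>w. f (c # w)) z i)"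
proof -
  have len: "length x = Suc (length z)" "length y = length z" "z \<noteq> []"
    using x y by (auto dest: arg_cong[of _ _ length])
  obtain z' where z': "z = b # z'" "y = z' @ [c]"
    using x len by (cases z) auto
  show ?thesis
  proof (cases "i = length z")
    case True
    then have "y ! (i - 1) = c" "x ! i = c" "drop i x = [c]" "drop (i - 1) y = [c]" "take i x = b # take (i - 1) y"
      using x(1) z' by (auto simp: nth_append)
    moreover have "drop (Suc (i - 1)) y = []" "drop (Suc i) x = []" using True len by auto
    ultimately show ?thesis using True len by (simp add: dynkin_term_def)
  next
    case False
    then have iz: "i < length z" using i len by simp
    have d: "drop i x = drop i z @ [c]" "take i x = take i z" "x ! i = z ! i" "drop (Suc i) x = drop (Suc i) z @ [c]"
      using iz by (auto simp: x(2) nth_append)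
    have rs: "rev_sign (drop i z @ [c]) = - (koszul [c] (drop i z) * rev_sign (drop i z))"
      using rev_sign_simps(2)[of c "rev (drop i z)"] rev_sign_simps(3)[of "drop i z @ [c]"]
        rev_sign_simps(3)[of "drop i z"] by simp
    have kz: "koszul [c] (take i z) * koszul [c] (drop i z) = koszul [c] z"
      by (simp flip: koszul_append(2))
    show ?thesis
    proof (cases "i = 0")
      case True
      have "dynkin_term f x i = - (koszul [c] (drop i z) * rev_sign (drop i z)) * f (c # rev (drop (Suc i) z) @ [z ! i])"
        unfolding dynkin_term_def d rs using True by simp
      then show ?thesis using True False by (simp add: dynkin_term_def)
    next
      case i0: False
      then obtain j where j: "i = Suc j" by (cases i) auto
      have t: "take i z = b # take j y" "z ! i = y ! j" "drop (Suc j) y = drop (Suc i) z @ [c]"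
         "drop j y = drop i z @ [c]"
        using d x(1) j by auto
      have "dynkin_term f x i = - (koszul [c] (drop i z) * rev_sign (drop i z)) *
         (shuffle_pairing (\<lambda>w. f (b # w @ [y ! j])) (take j y) (c # rev (drop (Suc i) z)) +
          koszul [c] (take i z) * shuffle_pairing (\<lambda>w. f (c # w @ [z ! i])) (take i z) (rev (drop (Suc i) z)))"
        unfolding dynkin_term_def d rs by (simp add: t)
      also have "\<dots> = dynkin_term (\<lambda>w. f (b # w)) y j - koszul [c] z * dynkin_term (\<lambda>w. f (c # w)) z i"
        unfolding dynkin_term_def t(3,4) rs kz[symmetric] by (simp add: algebra_simps)
      finally show ?thesis using False j by simp
    qed
  qed
qed

text \<open>Removing the outermost letter of w removes an end letter of x, so induction on the
  length sorts the brackets by the place of the innermost letter.\<close>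

lemma dynkin_formula:
  assumes "finite A" "set x \<subseteq> A" "length x = Suc n"
  shows "(\<Sum>w\<in>words_over A (Suc n). f w * beval (right_comb w) x) = (\<Sum>i<Suc n. dynkin_term f x i)"
  using assms
proof (induction n arbitrary: x f)
  case 0
  then obtain c where c: "x = [c]" "c \<in> A" by (auto simp: length_Suc_conv)
  have "words_over A 0 = {[]}" by (auto simp: words_over_def)
  then have "(\<Sum>w\<in>words_over A (Suc 0). f w * beval (right_comb w) x) = (\<Sum>a\<in>A. f [a] * wvec [a] [c])"
    unfolding sum_words_over_Suc by (simp add: c)
  also have "\<dots> = (\<Sum>a\<in>A. if a = c then f [c] else 0)"
    by (rule sum.cong) (auto simp: wvec_def)
  also have "\<dots> = f [c]" using c 0 by simp
  finally show ?case using c by (simp add: dynkin_term_def rev_sign_simps)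
next
  case (Suc n)
  obtain b y where y: "x = b # y" using Suc.prems by (cases x) auto
  obtain z c where z: "x = z @ [c]" using Suc.prems by (cases x rule: rev_cases) auto
  have len: "length y = Suc n" "length z = Suc n" and sub: "set y \<subseteq> A" "set z \<subseteq> A" "b \<in> A" "c \<in> A"
    using Suc.prems(2,3) arg_cong[OF z, of length] arg_cong[OF z, of set] arg_cong[OF y, of set] arg_cong[OF y, of length]
    by auto
  have yn: "y \<noteq> []" using len by auto
  let ?R = "\<lambda>f x. \<Sum>w\<in>words_over A (Suc n). f w * beval (right_comb w) x"
  have "(\<Sum>w\<in>words_over A (Suc (Suc n)). f w * beval (right_comb w) x) =
     (\<Sum>a\<in>A. \<Sum>w\<in>words_over A (Suc n). f (a # w) * beval (right_comb (a # w)) x)"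
    by (rule sum_words_over_Suc)
  also have "\<dots> = (\<Sum>a\<in>A. (if a = b then ?R (\<lambda>w. f (b # w)) y else 0)
      - (if a = c then koszul [c] z * ?R (\<lambda>w. f (c # w)) z else 0))"
  proof (rule sum.cong[OF refl])
    fix a
    have "f (a # w) * beval (right_comb (a # w)) x =
       (if a = b then f (b # w) * beval (right_comb w) y else 0)
        - (if a = c then koszul [c] z * (f (c # w) * beval (right_comb w) z) else 0)"
      if "w \<in> words_over A (Suc n)" for w
    proof -
      have "w \<noteq> []" using that by (auto simp: words_over_def)
      moreover have "hd x = b" "tl x = y" "x \<noteq> []" using y by auto
      moreover have "last x = c" "butlast x = z" using z by auto
      ultimately show ?thesis by (auto simp: beval_right_comb_Cons algebra_simps)
    qed
    then have "(\<Sum>w\<in>words_over A (Suc n). f (a # w) * beval (right_comb (a # w)) x) =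
       (\<Sum>w\<in>words_over A (Suc n). (if a = b then f (b # w) * beval (right_comb w) y else 0)
        - (if a = c then koszul [c] z * (f (c # w) * beval (right_comb w) z) else 0))"
      by (rule sum.cong[OF refl])
    then show "(\<Sum>w\<in>words_over A (Suc n). f (a # w) * beval (right_comb (a # w)) x) =
       (if a = b then ?R (\<lambda>w. f (b # w)) y else 0)
      - (if a = c then koszul [c] z * ?R (\<lambda>w. f (c # w)) z else 0)"
      by (cases "a = b"; cases "a = c") (simp_all add: sum_subtractf sum_distrib_left sum_negf)
  qed
  also have "\<dots> = ?R (\<lambda>w. f (b # w)) y - koszul [c] z * ?R (\<lambda>w. f (c # w)) z"
    using sub \<open>finite A\<close> by (simp add: sum_subtractf)
  also have "\<dots> = (\<Sum>i<Suc n. dynkin_term (\<lambda>w. f (b # w)) y i)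
      + (\<Sum>i<Suc n. - koszul [c] z * dynkin_term (\<lambda>w. f (c # w)) z i)"
    using Suc.IH[of y "\<lambda>w. f (b # w)"] Suc.IH[of z "\<lambda>w. f (c # w)"] len sub \<open>finite A\<close>
    by (simp add: sum_distrib_left sum_negf del: sum.lessThan_Suc)
  also have "(\<Sum>i<Suc n. dynkin_term (\<lambda>w. f (b # w)) y i) =
      (\<Sum>i<Suc (Suc n). if i = 0 then 0 else dynkin_term (\<lambda>w. f (b # w)) y (i - 1))"
    by (subst (2) sum.lessThan_Suc_shift) simp
  also have "(\<Sum>i<Suc n. - koszul [c] z * dynkin_term (\<lambda>w. f (c # w)) z i) =
      (\<Sum>i<Suc (Suc n). if i = length z then 0 else - koszul [c] z * dynkin_term (\<lambda>w. f (c # w)) z i)"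
    using len by (subst (2) sum.lessThan_Suc) (simp del: sum.lessThan_Suc)
  also have "(\<Sum>i<Suc (Suc n). if i = 0 then 0 else dynkin_term (\<lambda>w. f (b # w)) y (i - 1)) +
      (\<Sum>i<Suc (Suc n). if i = length z then 0 else - koszul [c] z * dynkin_term (\<lambda>w. f (c # w)) z i) =
      (\<Sum>i<Suc (Suc n). dynkin_term f x i)"
    unfolding sum.distrib[symmetric]
    by (rule sum.cong[OF refl], rule dynkin_term_step[OF y z yn, symmetric]) (use Suc.prems in auto)
  finally show ?case .
qed

text \<open>A proper shuffle of the first i + 1 letters with the reversed rest ends in
  \<open>x ! i\<close> or in \<open>x ! Suc i\<close>. Primitivity makes the two contributions
  cancel, which equates neighbouring terms; the last term is f x.\<close>

lemma dynkin_term_primitive: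
  assumes f: "primitive f" and i: "i < length x"
  shows "dynkin_term f x i = f x"
proof -
  have "dynkin_term f x (length x - Suc j) = f x" if "j < length x" for j
    using that
  proof (induction j)
    case 0
    then obtain z c where "x = z @ [c]" by (cases x rule: rev_cases) auto
    then show ?case by (simp add: dynkin_term_def rev_sign_simps)
  next
    case (Suc j)
    define i where "i = length x - Suc (Suc j)"
    have i: "Suc i < length x" "Suc i = length x - Suc j" using Suc.prems by (auto simp: i_def)
    let ?P = "\<lambda>i. shuffle_pairing (\<lambda>w. f (w @ [x ! i])) (take i x) (rev (drop (Suc i) x))"
    have d: "drop i x = x ! i # drop (Suc i) x" "drop (Suc i) x = x ! Suc i # drop (Suc (Suc i)) x"
      using Cons_nth_drop_Suc[of i x] Cons_nth_drop_Suc[of "Suc i" x] i(1) by simp_all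
    have "shuffle_pairing f (take i x @ [x ! i]) (rev (drop (Suc (Suc i)) x) @ [x ! Suc i]) = 0"
      using f by (auto simp: primitive_def)
    then have "koszul [x ! i] (drop (Suc i) x) * ?P i + ?P (Suc i) = 0"
      unfolding shuffle_pairing_snoc using i d(2)
      by (metis (no_types, lifting) Suc_lessD koszul_rev(2) rev.simps(2) take_Suc_conv_app_nth)
    then have P: "?P (Suc i) = - (koszul [x ! i] (drop (Suc i) x) * ?P i)"
      by (simp add: add_eq_0_iff)
    have "dynkin_term f x (Suc i) = dynkin_term f x i"
      unfolding dynkin_term_def P d(1) rev_sign_simps(2) by simp
    then show ?case using Suc i by (simp add: i_def)
  qed
  from this[of "length x - Suc i"] show ?thesis using i by simp
qed

text \<open>Every term of the Dynkin formula equals f x, and there is one for each place of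
  x.\<close>

theorem dynkin_specht_wever:
  assumes "primitive f" "finite A" "set x \<subseteq> A" "x \<noteq> []"
  shows "of_nat (length x) * f x = (\<Sum>w\<in>words_over A (length x). f w * beval (right_comb w) x)"
proof -
  obtain n where n: "length x = Suc n" using assms(4) by (cases x) auto
  show ?thesis unfolding n dynkin_formula[OF assms(2,3) n]
    using dynkin_term_primitive[OF assms(1)] n by simp
qed

section \<open>The Klyachko operator\<close>

text \<open>Evaluation at 1 of the factorization of 1 + X + ... + X^(k-1); the two monic polynomials
  of degree k - 1 agree at k - 1 points.\<close>

lemma prod_one_minus_prim_root_powers:
  assumes "prim_root k om"
  shows "(\<Prod>r\<in>{1..<k}. 1 - om ^ r) = of_nat k"
proof -
  have k: "k > 0" using assms by (simp add: prim_root_def)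
  have om: "om \<noteq> 0" using assms by (auto simp: prim_root_def power_0_left)
  let ?p = "\<Prod>r\<in>{1..<k}. [:- (om ^ r), 1:]" and ?q = "\<Sum>i<k. monom (1::complex) i"
  let ?A = "(\<lambda>r. om ^ r) ` {1..<k}"
  have "inj_on (\<lambda>r. om ^ r) {1..<k}"
  proof (rule linorder_inj_onI)
    fix r s assume rs: "r < s" "r \<in> {1..<k}" "s \<in> {1..<k}"
    show "om ^ r \<noteq> om ^ s"
    proof
      assume "om ^ r = om ^ s"
      also have "om ^ s = om ^ r * om ^ (s - r)" using rs(1) by (simp flip: power_add)
      finally have "om ^ (s - r) = 1" using om by simp
      then show False using rs assms by (auto simp: prim_root_def)
    qed
  qed auto
  then have card: "card ?A = k - 1" by (simp add: card_image)
  have degp: "degree ?p = k - 1" by (subst degree_prod_sum_eq) auto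
  have "lead_coeff ?p = 1" by (subst lead_coeff_prod) simp
  then have cp: "coeff ?p (k - 1) = 1" unfolding degp .
  have cq: "coeff ?q (k - 1) = 1" using k by (simp add: coeff_sum)
  have degq: "degree ?q \<le> k - 1" by (rule degree_sum_le) (auto intro: order.trans[OF degree_monom_le])
  have "?p = ?q"
  proof (rule poly_eqI_degree_lead_coeff[of _ "k - 1" _ ?A])
    fix z assume "z \<in> ?A"
    then obtain r where r: "r \<in> {1..<k}" "z = om ^ r" by auto
    have "poly ?p z = 0" unfolding poly_prod r(2) using r(1) by (intro prod_zero) auto
    moreover have "poly ?q z = (\<Sum>i<k. (om ^ r) ^ i)" by (simp add: poly_sum poly_monom r)
    moreover have "\<dots> = 0" using sum_powers_prim_root[OF assms, of r] r by (auto dest: dvd_imp_le)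
    ultimately show "poly ?p z = poly ?q z" by simp
  qed (use card degp degq cp cq in auto)
  then have "poly ?p 1 = poly ?q 1" by simp
  then show ?thesis by (simp add: poly_prod poly_sum poly_monom)
qed

text \<open>Words are rearranged by lists of positions; the sign counts the inversions
  between odd positions.\<close>
fun inv_sign :: "(nat \<Rightarrow> bool) \<Rightarrow> nat list \<Rightarrow> complex" where
  "inv_sign od [] = 1"
| "inv_sign od (a # p) = (-1) ^ (if od a then length (filter (\<lambda>c. od c \<and> c < a) p) else 0) * inv_sign od p"

lemma inv_sign_square: "inv_sign od p * inv_sign od p = 1"
proof (induction p)
  case (Cons a p)
  have "inv_sign od (a # p) * inv_sign od (a # p) =
     (((-1) ^ (if od a then length (filter (\<lambda>c. od c \<and> c < a) p) else 0)) * ((-1) ^ (if od a then length (filter (\<lambda>c. od c \<and> c < a) p) else 0)))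
      * (inv_sign od p * inv_sign od p)"
    by (simp only: inv_sign.simps mult_ac)
  then show ?case using Cons by (simp flip: power_mult_distrib)
qed simp

lemma inv_sign_sorted: "sorted p \<Longrightarrow> inv_sign od p = 1"
proof (induction p)
  case (Cons a p)
  then have "filter (\<lambda>c. od c \<and> c < a) p = []" by (auto simp: filter_empty_conv)
  then show ?case using Cons by simp
qed simp

definition word_of :: "word \<Rightarrow> nat list \<Rightarrow> word" where
  "word_of z p = map ((!) z) p"

abbreviation is_odd :: "word \<Rightarrow> nat \<Rightarrow> bool" where
  "is_odd z \<equiv> \<lambda>i. snd (z ! i)"

lemma word_of_simps [simp]: "word_of z [] = []" "word_of z (a # p) = z ! a # word_of z p"
  "length (word_of z p) = length p" "word_of z (p @ p') = word_of z p @ word_of z p'"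
  by (simp_all add: word_of_def)

lemma odd_count_word_of: "odd_count (word_of z p) = length (filter (is_odd z) p)"
  by (induction p) (auto simp: odd_count_def word_of_def)

lemma length_filter_shuffle:
  assumes "p \<in> shuffles x y"
  shows "length (filter P p) = length (filter P x) + length (filter P y)"
proof -
  have "mset (filter P p) = mset (filter P x) + mset (filter P y)"
    by (simp add: mset_shuffles[OF assms])
  then show ?thesis by (metis size_mset size_union)
qed

text \<open>Positions are shuffled because letters may repeat while \<open>shuffles\<close> is a
  set. As every position of x lies below those of y, taking a letter of y before one of x creates an
  inversion; so the Koszul sign of a shuffle is its inversion sign up to the signs within x and
  y.\<close>

theorem shuffle_pairing_word_of:
  assumes "\<And>a b. a \<in> set x \<Longrightarrow> b \<in> set y \<Longrightarrow> a < b"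
  shows "shuffle_pairing f (word_of z x) (word_of z y) * (inv_sign (is_odd z) x * inv_sign (is_odd z) y) =
     (\<Sum>p\<in>shuffles x y. inv_sign (is_odd z) p * f (word_of z p))"
  using assms
proof (induction x y arbitrary: f rule: shuffles.induct)
  case (3 a x b y)
  let ?s = "inv_sign (is_odd z)"
  have neq: "a \<noteq> b" and ab: "\<And>c. c \<in> set (b # y) \<Longrightarrow> a < c" using "3.prems" by force+
  let ?ca = "\<lambda>p. (-1::complex) ^ (if is_odd z a then length (filter (\<lambda>c. is_odd z c \<and> c < a) p) else 0)"
  let ?cb = "\<lambda>p. (-1::complex) ^ (if is_odd z b then length (filter (\<lambda>c. is_odd z c \<and> c < b) p) else 0)"
  have A: "?ca p = ?ca x" if "p \<in> shuffles x (b # y)" for p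
  proof -
    have "filter (\<lambda>c. is_odd z c \<and> c < a) (b # y) = []"
      using ab by (fastforce simp: filter_empty_conv)
    then show ?thesis using length_filter_shuffle[OF that, of "\<lambda>c. is_odd z c \<and> c < a"] by simp
  qed
  have B: "?cb p = koszul [z ! b] (word_of z (a # x)) * ?cb y" if "p \<in> shuffles (a # x) y" for p
  proof -
    have "filter (\<lambda>c. is_odd z c \<and> c < b) (a # x) = filter (is_odd z) (a # x)"
      by (rule filter_cong[OF refl]) (use "3.prems" in auto)
    then have "length (filter (\<lambda>c. is_odd z c \<and> c < b) p) =
        odd_count (word_of z (a # x)) + length (filter (\<lambda>c. is_odd z c \<and> c < b) y)"
      using length_filter_shuffle[OF that, of "\<lambda>c. is_odd z c \<and> c < b"] odd_count_word_of by metis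
    then show ?thesis by (simp add: koszul_def power_add)
  qed
  have IH1: "shuffle_pairing (\<lambda>w. f (z ! a # w)) (word_of z x) (word_of z (b # y)) * (?s x * ?s (b # y)) =
     (\<Sum>p\<in>shuffles x (b # y). ?s p * f (z ! a # word_of z p))"
    by (rule "3.IH"(1)) (use "3.prems" in auto)
  have IH2: "shuffle_pairing (\<lambda>w. f (z ! b # w)) (word_of z (a # x)) (word_of z y) * (?s (a # x) * ?s y) =
     (\<Sum>p\<in>shuffles (a # x) y. ?s p * f (z ! b # word_of z p))"
    by (rule "3.IH"(2)) (use "3.prems" in auto)
  have "(\<Sum>p\<in>shuffles (a # x) (b # y). ?s p * f (word_of z p)) =
     (\<Sum>p\<in>shuffles x (b # y). ?ca p * ?s p * f (z ! a # word_of z p)) +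
     (\<Sum>p\<in>shuffles (a # x) y. ?cb p * ?s p * f (z ! b # word_of z p))"
    unfolding sum_shuffles_Cons[OF neq] by (simp add: word_of_def)
  also have "\<dots> = ?ca x * (\<Sum>p\<in>shuffles x (b # y). ?s p * f (z ! a # word_of z p)) +
     koszul [z ! b] (word_of z (a # x)) * ?cb y * (\<Sum>p\<in>shuffles (a # x) y. ?s p * f (z ! b # word_of z p))"
    unfolding sum_distrib_left
    by (intro arg_cong2[where f = "(+)"] sum.cong refl) (simp_all only: A B mult.assoc)
  also have "\<dots> = ?ca x * (shuffle_pairing (\<lambda>w. f (z ! a # w)) (word_of z x) (word_of z (b # y)) * (?s x * ?s (b # y))) +
     koszul [z ! b] (word_of z (a # x)) * ?cb y * (shuffle_pairing (\<lambda>w. f (z ! b # w)) (word_of z (a # x)) (word_of z y) * (?s (a # x) * ?s y))"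
    unfolding IH1 IH2 ..
  also have "\<dots> = shuffle_pairing f (word_of z (a # x)) (word_of z (b # y)) * (?s (a # x) * ?s (b # y))"
    by (simp add: word_of_def algebra_simps)
  finally show ?case ..
qed (simp_all add: inv_sign_square)

section \<open>Position lists, permutations and inverse descents\<close>

definition pos_lists :: "nat set \<Rightarrow> nat list set" where
  "pos_lists A = {p. distinct p \<and> set p = A}"

definition perms :: "nat \<Rightarrow> (nat \<Rightarrow> nat) set" where
  "perms k = {\<pi>. \<pi> permutes {..<k}}"

definition plist :: "nat \<Rightarrow> (nat \<Rightarrow> nat) \<Rightarrow> nat list" where
  "plist k \<pi> = map \<pi> [0..<k]"

lemma finite_perms [simp]: "finite (perms k)"
  unfolding perms_def by (rule finite_permutations) simp

lemma length_plist [simp]: "length (plist k \<pi>) = k"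
  by (simp add: plist_def)

lemma nth_plist [simp]: "i < k \<Longrightarrow> plist k \<pi> ! i = \<pi> i"
  by (simp add: plist_def)

lemma bij_betw_plist: "bij_betw (plist k) (perms k) (pos_lists {..<k})"
proof (rule bij_betwI')
  fix \<pi> \<rho> assume p: "\<pi> \<in> perms k" "\<rho> \<in> perms k"
  have "\<pi> = \<rho>" if eq: "plist k \<pi> = plist k \<rho>"
  proof
    fix i
    show "\<pi> i = \<rho> i"
    proof (cases "i < k")
      case True
      then show ?thesis using arg_cong[OF eq, of "\<lambda>p. p ! i"] by simp
    next
      case False
      then show ?thesis using p permutes_not_in[of \<pi> "{..<k}" i] permutes_not_in[of \<rho> "{..<k}" i] by (simp add: perms_def)
    qed
  qed
  then show "(plist k \<pi> = plist k \<rho>) = (\<pi> = \<rho>)" by auto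
next
  fix \<pi> assume "\<pi> \<in> perms k"
  then have "\<pi> permutes {..<k}" by (simp add: perms_def)
  then have "inj_on \<pi> {..<k}" "\<pi> ` {..<k} = {..<k}" by (rule permutes_inj_on, rule permutes_image)
  then show "plist k \<pi> \<in> pos_lists {..<k}"
    by (simp add: pos_lists_def plist_def distinct_map atLeast0LessThan)
next
  fix p assume p: "p \<in> pos_lists {..<k}"
  then have d: "distinct p" and s: "set p = {..<k}" by (simp_all add: pos_lists_def)
  have len: "length p = k" using distinct_card[OF d] s by simp
  let ?\<pi> = "\<lambda>i. if i < k then p ! i else i"
  have "bij_betw ?\<pi> {..<k} {..<k}"
  proof -
    have "bij_betw ((!) p) {..<k} {..<k}" using bij_betw_nth[OF d] len s by simp
    then show ?thesis by (rule bij_betw_cong[THEN iffD1, rotated]) simp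
  qed
  then have "?\<pi> permutes {..<k}" by (rule bij_imp_permutes) simp
  moreover have "p = plist k ?\<pi>" using len by (auto simp: plist_def intro: nth_equalityI)
  ultimately show "\<exists>\<pi>\<in>perms k. p = plist k \<pi>" unfolding perms_def by blast
qed

lemma
  assumes "\<pi> \<in> perms k"
  shows perms_inv: "inv \<pi> \<in> perms k" and perms_less: "\<pi> i < k \<longleftrightarrow> i < k"
    and perms_inv_left: "inv \<pi> (\<pi> i) = i" and perms_inv_right: "\<pi> (inv \<pi> i) = i"
    and perms_inv_inv: "inv (inv \<pi>) = \<pi>"
  using assms permutes_inv permutes_in_image[of \<pi> "{..<k}" i] permutes_inverses permutes_inv_inv
  unfolding perms_def by auto

text \<open>The relative order of two entries, encoded by a filter so that it survives the removal
  of other entries.\<close>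

definition before :: "nat list \<Rightarrow> nat \<Rightarrow> nat \<Rightarrow> bool" where
  "before p a b \<longleftrightarrow> filter (\<lambda>c. c = a \<or> c = b) p = [a, b]"

lemma filter_upt_pair:
  assumes "a \<le> i" "i < j" "j < b"
  shows "filter (\<lambda>c. c = i \<or> c = j) [a..<b] = [i, j]"
proof (rule sorted_distinct_set_unique)
  show "sorted (filter (\<lambda>c. c = i \<or> c = j) [a..<b])" by (simp add: sorted_wrt_filter)
qed (use assms in auto)

lemma before_plist:
  assumes \<pi>: "\<pi> \<in> perms k" and "a < k" "b < k" "a \<noteq> b"
  shows "before (plist k \<pi>) a b \<longleftrightarrow> inv \<pi> a < inv \<pi> b"
proof -
  let ?i = "inv \<pi> a" and ?j = "inv \<pi> b"
  have ij: "?i < k" "?j < k" using assms perms_less[OF perms_inv[OF \<pi>]] by auto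
  have neq: "?i \<noteq> ?j" using assms perms_inv_right[OF \<pi>] by metis
  have "filter (\<lambda>c. c = a \<or> c = b) (plist k \<pi>) = map \<pi> (filter (\<lambda>c. \<pi> c = a \<or> \<pi> c = b) [0..<k])"
    by (simp add: plist_def filter_map o_def)
  also have "(\<lambda>c. \<pi> c = a \<or> \<pi> c = b) = (\<lambda>c. c = ?i \<or> c = ?j)"
    using perms_inv_left[OF \<pi>] perms_inv_right[OF \<pi>] by (auto simp: fun_eq_iff)
  finally have *: "filter (\<lambda>c. c = a \<or> c = b) (plist k \<pi>) = map \<pi> (filter (\<lambda>c. c = ?i \<or> c = ?j) [0..<k])" .
  show ?thesis
  proof (cases "?i < ?j")
    case True
    then show ?thesis unfolding before_def *
      using filter_upt_pair[of 0 ?i ?j k] ij perms_inv_right[OF \<pi>] by simp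
  next
    case False
    then have "filter (\<lambda>c. c = ?i \<or> c = ?j) [0..<k] = [?j, ?i]"
      using filter_upt_pair[of 0 ?j ?i k] ij neq by (simp add: disj_commute)
    then show ?thesis unfolding before_def *
      using False perms_inv_right[OF \<pi>] assms(4) by simp
  qed
qed

definition perm_maj :: "nat \<Rightarrow> (nat \<Rightarrow> nat) \<Rightarrow> nat" where
  "perm_maj k \<tau> = list_maj (\<lambda>a b. b < a) (plist k \<tau>)"

text \<open>For r = k this is the major index of the inverse permutation, read off the list: i
  counts when it stands before i - 1. Smaller r keep only the inverse descents below r.\<close>

definition inverse_maj :: "nat \<Rightarrow> nat list \<Rightarrow> nat" where
  "inverse_maj r p = (\<Sum>i\<in>{1..<r}. if before p i (i - 1) then i else 0)"

lemma perm_maj_inv: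
  assumes \<pi>: "\<pi> \<in> perms k"
  shows "perm_maj k (inv \<pi>) = inverse_maj k (plist k \<pi>)"
  unfolding perm_maj_def list_maj_def inverse_maj_def length_plist
proof (rule sum.cong[OF refl])
  fix i assume i: "i \<in> {1..<k}"
  then obtain j where "i = Suc j" "Suc j < k" by (cases i) auto
  then show "(if plist k (inv \<pi>) ! i < plist k (inv \<pi>) ! (i - 1) then i else 0) =
     (if before (plist k \<pi>) i (i - 1) then i else 0)"
    using before_plist[OF \<pi>, of i "i - 1"] by simp
qed

lemma before_filter: "P a \<Longrightarrow> P b \<Longrightarrow> before (filter P p) a b = before p a b"
  unfolding before_def filter_filter by (rule arg_cong2[where f = "(=)"], rule filter_cong) auto

lemma before_swap:
  assumes "p \<in> pos_lists {..<k}" "a < k" "b < k" "a \<noteq> b"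
  shows "\<not> before p a b \<longleftrightarrow> before p b a"
proof -
  obtain \<pi> where \<pi>: "\<pi> \<in> perms k" "p = plist k \<pi>"
    using bij_betw_plist[of k] assms(1) by (auto simp: bij_betw_def)
  have "inv \<pi> a \<noteq> inv \<pi> b" using assms(4) perms_inv_right[OF \<pi>(1)] by metis
  then show ?thesis unfolding \<pi>(2) using before_plist[OF \<pi>(1)] assms by auto
qed

text \<open>Sums over these lists, with the weight restricted to the first r inverse descents, interpolate
  between the identity and the Klyachko operator.\<close>
definition tail_sorted :: "nat \<Rightarrow> nat \<Rightarrow> nat list set" where
  "tail_sorted k r = {p \<in> pos_lists {..<k}. filter (\<lambda>c. r \<le> c) p = [r..<k]}"

lemma finite_tail_sorted: "finite (tail_sorted k r)"
proof -
  have "finite (pos_lists {..<k})" using bij_betw_finite[OF bij_betw_plist] by simp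
  then show ?thesis unfolding tail_sorted_def by simp
qed

lemma tail_sorted_full: "tail_sorted k k = pos_lists {..<k}"
proof -
  have "filter (\<lambda>c. k \<le> c) p = []" if "p \<in> pos_lists {..<k}" for p
  proof -
    have "set p = {..<k}" using that by (simp add: pos_lists_def)
    then have "\<forall>c\<in>set p. c < k" by simp
    then show ?thesis by (simp add: filter_empty_conv not_le)
  qed
  then show ?thesis unfolding tail_sorted_def by auto
qed

text \<open>The increasing tail grows by one entry exactly when r is not an inverse descent. This
  splits the lists by the status of one inverse descent.\<close>

lemma tail_sorted_pred:
  assumes r: "1 \<le> r" "r < k"
  shows "tail_sorted k (r - 1) = {p \<in> tail_sorted k r. before p (r - 1) r}"
proof (intro equalityI subsetI)
  fix p assume "p \<in> tail_sorted k (r - 1)"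
  then have p: "p \<in> pos_lists {..<k}" "filter (\<lambda>c. r - 1 \<le> c) p = [r - 1..<k]"
    by (auto simp: tail_sorted_def)
  have "filter (\<lambda>c. r \<le> c) p = filter (\<lambda>c. r \<le> c) (filter (\<lambda>c. r - 1 \<le> c) p)"
    unfolding filter_filter by (rule filter_cong) auto
  also have "\<dots> = filter (\<lambda>c. r \<le> c) ((r - 1) # [r..<k])"
    using p(2) r upt_conv_Cons[of "r - 1" k] by simp
  also have "\<dots> = [r..<k]" using r by (simp add: filter_id_conv)
  finally have 1: "filter (\<lambda>c. r \<le> c) p = [r..<k]" .
  have "before p (r - 1) r \<longleftrightarrow> before [r - 1..<k] (r - 1) r"
    using before_filter[of "\<lambda>c. r - 1 \<le> c" "r - 1" r p] p(2) by simp
  also have "\<dots>" unfolding before_def using filter_upt_pair[of "r - 1" "r - 1" r k] r by simp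
  finally show "p \<in> {p \<in> tail_sorted k r. before p (r - 1) r}"
    using 1 p by (simp add: tail_sorted_def)
next
  fix p assume "p \<in> {p \<in> tail_sorted k r. before p (r - 1) r}"
  then have p: "p \<in> pos_lists {..<k}" "filter (\<lambda>c. r \<le> c) p = [r..<k]" "before p (r - 1) r"
    by (auto simp: tail_sorted_def)
  define y where "y = filter (\<lambda>c. r - 1 \<le> c) p"
  have by': "before y (r - 1) r" using p(3) before_filter[of "\<lambda>c. r - 1 \<le> c" "r - 1" r p] by (simp add: y_def)
  have dy: "distinct y" "r - 1 \<in> set y" using p(1) r by (auto simp: y_def pos_lists_def)
  have fy: "filter (\<lambda>c. r \<le> c) y = [r..<k]"
    unfolding y_def filter_filter p(2)[symmetric] by (rule filter_cong) auto
  obtain y1 y2 where y: "y = y1 @ (r - 1) # y2" using dy(2) by (meson split_list)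
  have ge: "r - 1 \<le> c" if "c \<in> set y" for c using that by (auto simp: y_def)
  have "r \<le> c" if "c \<in> set y1 \<union> set y2" for c
  proof -
    have "c \<noteq> r - 1" using that dy(1) y by auto
    moreover have "r - 1 \<le> c" using that ge y by auto
    ultimately show ?thesis by simp
  qed
  then have "filter (\<lambda>c. r \<le> c) y1 = y1" "filter (\<lambda>c. r \<le> c) y2 = y2" by (simp_all add: filter_id_conv)
  then have yy: "y1 @ y2 = [r..<k]" using fy r by (simp add: y split: if_splits)
  have "y1 = []"
  proof (cases y1)
    case (Cons c y1')
    then have "c = r" using yy r by (simp add: upt_conv_Cons)
    then have "filter (\<lambda>c. c = r - 1 \<or> c = r) y = r # filter (\<lambda>c. c = r - 1 \<or> c = r) (y1' @ (r - 1) # y2)"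
      using Cons y by simp
    moreover have "r \<noteq> r - 1" using r by simp
    ultimately show ?thesis using by' unfolding before_def by (metis list.inject)
  qed simp
  then have "y = [r - 1..<k]" using yy y r upt_conv_Cons[of "r - 1" k] by simp
  then show "p \<in> tail_sorted k (r - 1)" using p(1) by (simp add: tail_sorted_def y_def)
qed

text \<open>Sums over these lists become sums of shuffle products, which primitive tensors
  annihilate.\<close>

lemma tail_sorted_eq_shuffles:
  assumes "r \<le> k"
  shows "tail_sorted k r = (\<Union>x\<in>pos_lists {..<r}. shuffles x [r..<k])"
proof (intro equalityI subsetI)
  fix p assume "p \<in> tail_sorted k r"
  then have p: "p \<in> pos_lists {..<k}" "filter (\<lambda>c. r \<le> c) p = [r..<k]" by (auto simp: tail_sorted_def)
  have dp: "distinct p" "set p = {..<k}" using p(1) by (simp_all add: pos_lists_def)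
  have "{c \<in> {..<k}. c < r} = {..<r}" using assms by auto
  then have "filter (\<lambda>c. c < r) p \<in> pos_lists {..<r}" using dp by (simp add: pos_lists_def)
  moreover have "p \<in> shuffles (filter (\<lambda>c. c < r) p) (filter (\<lambda>c. \<not> c < r) p)" by (rule partition_in_shuffles)
  ultimately show "p \<in> (\<Union>x\<in>pos_lists {..<r}. shuffles x [r..<k])" using p(2) by (auto simp: not_less)
next
  fix p assume "p \<in> (\<Union>x\<in>pos_lists {..<r}. shuffles x [r..<k])"
  then obtain x where x0: "x \<in> pos_lists {..<r}" "p \<in> shuffles x [r..<k]" by blast
  then have x: "distinct x" "set x = {..<r}" "p \<in> shuffles x [r..<k]" by (simp_all add: pos_lists_def)
  have dis: "set x \<inter> set [r..<k] = {}" unfolding x(2) by auto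
  have "{..<r} \<union> {r..<k} = {..<k}" using assms by auto
  then have sp: "set p = {..<k}" unfolding set_shuffles[OF x(3)] x(2) by simp
  have "distinct p" using distinct_disjoint_shuffles[OF x(1) _ dis x(3)] by simp
  moreover have "filter (\<lambda>c. r \<le> c) p = [r..<k]"
  proof -
    have "filter (\<lambda>c. r \<le> c) p = filter (\<lambda>c. c \<in> set [r..<k]) p"
      by (rule filter_cong) (use sp in auto)
    also have "\<dots> = [r..<k]" by (rule filter_shuffles_disjoint2(1)[OF dis x(3)])
    finally show ?thesis .
  qed
  ultimately show "p \<in> tail_sorted k r" using sp by (simp add: tail_sorted_def pos_lists_def)
qed

section \<open>Signs of place permutations as products over pairs\<close>

definition ord_pairs :: "nat \<Rightarrow> (nat \<times> nat) set" where
  "ord_pairs k = {(i, j). i < j \<and> j < k}"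

lemma finite_ord_pairs: "finite (ord_pairs k)"
  by (rule finite_subset[of _ "{..<k} \<times> {..<k}"]) (auto simp: ord_pairs_def)

lemma ord_pairs_Suc: "ord_pairs (Suc k) = (\<lambda>j. (0, Suc j)) ` {..<k} \<union> (\<lambda>(i, j). (Suc i, Suc j)) ` ord_pairs k"
proof (intro equalityI subsetI)
  fix x assume "x \<in> ord_pairs (Suc k)"
  then obtain i j where x: "x = (i, Suc j)" "i < Suc j" "j < k"
    unfolding ord_pairs_def by (auto elim: less_natE dest: Suc_lessE)
  then show "x \<in> (\<lambda>j. (0, Suc j)) ` {..<k} \<union> (\<lambda>(i, j). (Suc i, Suc j)) ` ord_pairs k"
    by (cases i) (auto simp: ord_pairs_def image_iff)
qed (auto simp: ord_pairs_def)

lemma minus_one_power_length_filter: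
  "(-1) ^ length (filter P p) = (\<Prod>j<length p. if P (p ! j) then -1 else (1::complex))"
  by (induction p) (simp_all add: prod.lessThan_Suc_shift del: prod.lessThan_Suc)

lemma inv_sign_prod:
  "inv_sign od p = (\<Prod>(i, j)\<in>ord_pairs (length p). if od (p ! i) \<and> od (p ! j) \<and> p ! j < p ! i then -1 else 1)"
proof (induction p)
  case (Cons a p)
  let ?e = "\<lambda>q i j. if od (q ! i) \<and> od (q ! j) \<and> q ! j < q ! i then -1 else (1::complex)"
  have "(\<Prod>(i, j)\<in>ord_pairs (length (a # p)). ?e (a # p) i j) =
     (\<Prod>(i, j)\<in>(\<lambda>j. (0, Suc j)) ` {..<length p}. ?e (a # p) i j) *
     (\<Prod>(i, j)\<in>(\<lambda>(i, j). (Suc i, Suc j)) ` ord_pairs (length p). ?e (a # p) i j)"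
    unfolding list.size(4) add_0_right add_Suc_right ord_pairs_Suc
    by (rule prod.union_disjoint) (auto simp: finite_ord_pairs)
  also have "(\<Prod>(i, j)\<in>(\<lambda>j. (0, Suc j)) ` {..<length p}. ?e (a # p) i j) =
      (\<Prod>j<length p. if od a \<and> od (p ! j) \<and> p ! j < a then -1 else 1)"
    by (subst prod.reindex) (auto simp: inj_on_def)
  also have "\<dots> = (-1) ^ (if od a then length (filter (\<lambda>c. od c \<and> c < a) p) else 0)"
    by (cases "od a") (simp_all add: minus_one_power_length_filter)
  also have "(\<Prod>(i, j)\<in>(\<lambda>(i, j). (Suc i, Suc j)) ` ord_pairs (length p). ?e (a # p) i j) =
      (\<Prod>(i, j)\<in>ord_pairs (length p). ?e p i j)"
    by (subst prod.reindex) (auto simp: inj_on_def case_prod_unfold)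
  finally show ?case using Cons by simp
qed (simp add: ord_pairs_def)

text \<open>Symmetric in two distinct indices, unlike the inversion condition, so that pairs can be
  reindexed by a permutation.\<close>

definition pair_sign :: "(nat \<Rightarrow> bool) \<Rightarrow> (nat \<Rightarrow> nat) \<Rightarrow> nat \<Rightarrow> nat \<Rightarrow> complex" where
  "pair_sign od \<sigma> i j = (if od (\<sigma> i) \<and> od (\<sigma> j) \<and> (i < j) \<noteq> (\<sigma> i < \<sigma> j) then -1 else 1)"

definition word_sign :: "word \<Rightarrow> (nat \<Rightarrow> nat) \<Rightarrow> complex" where
  "word_sign v \<sigma> = inv_sign (is_odd v) (plist (length v) \<sigma>)"

lemma word_sign_prod:
  assumes "\<sigma> \<in> perms (length v)"
  shows "word_sign v \<sigma> = (\<Prod>(i, j)\<in>ord_pairs (length v). pair_sign (is_odd v) \<sigma> i j)"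
  unfolding word_sign_def inv_sign_prod length_plist
proof (rule prod.cong[OF refl], clarify)
  fix i j assume ij: "(i, j) \<in> ord_pairs (length v)"
  then have lt: "i < j" "j < length v" "i < length v" by (auto simp: ord_pairs_def)
  have "\<sigma> i \<noteq> \<sigma> j" using perms_inv_left[OF assms] lt by (metis less_irrefl)
  then show "(if is_odd v (plist (length v) \<sigma> ! i) \<and> is_odd v (plist (length v) \<sigma> ! j) \<and>
      plist (length v) \<sigma> ! j < plist (length v) \<sigma> ! i then -1 else 1) = pair_sign (is_odd v) \<sigma> i j"
    using lt by (auto simp: pair_sign_def)
qed

lemma perms_compose: "\<sigma> \<in> perms k \<Longrightarrow> \<tau> \<in> perms k \<Longrightarrow> \<sigma> \<circ> \<tau> \<in> perms k"
  unfolding perms_def by (auto intro: permutes_compose)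

text \<open>A symmetric factor depends only on the unordered pair, and \<tau> permutes the unordered
  pairs.\<close>

lemma prod_ord_pairs_perm:
  assumes \<tau>: "\<tau> \<in> perms k" and sym: "\<And>i j. i \<noteq> j \<Longrightarrow> g i j = g j i"
  shows "(\<Prod>(i, j)\<in>ord_pairs k. g (\<tau> i) (\<tau> j)) = (\<Prod>(i, j)\<in>ord_pairs k. (g i j :: complex))"
proof -
  let ?srt = "\<lambda>a b. (min a b, max a b)"
  have ne: "\<tau> i \<noteq> \<tau> j" "inv \<tau> i \<noteq> inv \<tau> j" if "i \<noteq> j" for i j
    using that perms_inv_left[OF \<tau>] perms_inv_right[OF \<tau>] by metis+
  have lt: "\<tau> i < k" "inv \<tau> i < k" if "i < k" for i
    using that perms_less[OF \<tau>] perms_less[OF perms_inv[OF \<tau>]] by auto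
  show ?thesis
  proof (rule prod.reindex_bij_witness[of _ "\<lambda>(a, b). ?srt (inv \<tau> a) (inv \<tau> b)" "\<lambda>(a, b). ?srt (\<tau> a) (\<tau> b)"])
    fix x assume x: "x \<in> ord_pairs k"
    then obtain a b where ab: "x = (a, b)" "a < b" "b < k" "a < k" by (auto simp: ord_pairs_def)
    show "(case case x of (a, b) \<Rightarrow> ?srt (\<tau> a) (\<tau> b) of (a, b) \<Rightarrow> ?srt (inv \<tau> a) (inv \<tau> b)) = x"
      using ab perms_inv_left[OF \<tau>] by (auto simp: min_def max_def)
    show "(case case x of (a, b) \<Rightarrow> ?srt (inv \<tau> a) (inv \<tau> b) of (a, b) \<Rightarrow> ?srt (\<tau> a) (\<tau> b)) = x"
      using ab perms_inv_right[OF \<tau>] by (auto simp: min_def max_def)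
    show "(case x of (a, b) \<Rightarrow> ?srt (\<tau> a) (\<tau> b)) \<in> ord_pairs k"
      using ab lt ne[of a b] by (auto simp: ord_pairs_def min_def max_def)
    show "(case x of (a, b) \<Rightarrow> ?srt (inv \<tau> a) (inv \<tau> b)) \<in> ord_pairs k"
      using ab lt ne[of a b] by (auto simp: ord_pairs_def min_def max_def)
    show "(case case x of (a, b) \<Rightarrow> ?srt (\<tau> a) (\<tau> b) of (i, j) \<Rightarrow> g i j) = (case x of (i, j) \<Rightarrow> g (\<tau> i) (\<tau> j))"
      using ab sym ne[of a b] by (auto simp: min_def max_def)
  qed
qed

text \<open>A pair of odd letters is inverted by the composition exactly when one, and only one, of
  the two steps inverts it. This cocycle rule makes signed place permutations an action.\<close>

lemma word_sign_compose:
  assumes \<sigma>: "\<sigma> \<in> perms (length v)" and \<tau>: "\<tau> \<in> perms (length v)"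
  shows "word_sign v (\<sigma> \<circ> \<tau>) = word_sign v \<sigma> * word_sign (permute_list \<sigma> v) \<tau>"
proof -
  let ?k = "length v" and ?od = "is_odd v"
  have \<tau>': "\<tau> \<in> perms (length (permute_list \<sigma> v))" using \<tau> by simp
  have ne: "\<sigma> i \<noteq> \<sigma> j" if "i \<noteq> j" for i j using that perms_inv_left[OF \<sigma>] by metis
  have "word_sign v (\<sigma> \<circ> \<tau>) = (\<Prod>(i, j)\<in>ord_pairs ?k. pair_sign ?od (\<sigma> \<circ> \<tau>) i j)"
    by (rule word_sign_prod[OF perms_compose[OF assms]])
  also have "\<dots> = (\<Prod>(i, j)\<in>ord_pairs ?k. pair_sign ?od \<sigma> (\<tau> i) (\<tau> j) * pair_sign (is_odd (permute_list \<sigma> v)) \<tau> i j)"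
  proof (rule prod.cong[OF refl], clarify)
    fix i j assume "(i, j) \<in> ord_pairs ?k"
    then have "\<tau> i < ?k" "\<tau> j < ?k" using perms_less[OF \<tau>] by (auto simp: ord_pairs_def)
    then have "is_odd (permute_list \<sigma> v) (\<tau> i) = ?od (\<sigma> (\<tau> i))" "is_odd (permute_list \<sigma> v) (\<tau> j) = ?od (\<sigma> (\<tau> j))"
      by (simp_all add: permute_list_def)
    then show "pair_sign ?od (\<sigma> \<circ> \<tau>) i j = pair_sign ?od \<sigma> (\<tau> i) (\<tau> j) * pair_sign (is_odd (permute_list \<sigma> v)) \<tau> i j"
      unfolding pair_sign_def by auto
  qed
  also have "\<dots> = (\<Prod>(i, j)\<in>ord_pairs ?k. pair_sign ?od \<sigma> (\<tau> i) (\<tau> j)) *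
      (\<Prod>(i, j)\<in>ord_pairs ?k. pair_sign (is_odd (permute_list \<sigma> v)) \<tau> i j)"
    by (simp add: case_prod_unfold prod.distrib)
  also have "(\<Prod>(i, j)\<in>ord_pairs ?k. pair_sign ?od \<sigma> (\<tau> i) (\<tau> j)) = (\<Prod>(i, j)\<in>ord_pairs ?k. pair_sign ?od \<sigma> i j)"
    by (rule prod_ord_pairs_perm[OF \<tau>]) (use ne in \<open>auto simp: pair_sign_def linorder_neq_iff\<close>)
  finally show ?thesis by (simp only: word_sign_prod[OF \<sigma>] word_sign_prod[OF \<tau>'] length_permute_list)
qed

lemma word_of_plist: "word_of v (plist (length v) \<sigma>) = permute_list \<sigma> v"
  by (simp add: word_of_def plist_def permute_list_def)

lemma word_sign_id: "word_sign v id = 1"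
  by (simp add: word_sign_def plist_def inv_sign_sorted)

definition klyachko :: "complex \<Rightarrow> tensor \<Rightarrow> tensor" where
  "klyachko om f v = (\<Sum>\<pi>\<in>perms (length v). om ^ perm_maj (length v) (inv \<pi>) *
      (word_sign v \<pi> * f (permute_list \<pi> v)))"

lemma klyachko_pos_lists:
  "klyachko om f v = (\<Sum>p\<in>pos_lists {..<length v}. om ^ inverse_maj (length v) p *
     (inv_sign (is_odd v) p * f (word_of v p)))"
proof -
  have "klyachko om f v = (\<Sum>\<pi>\<in>perms (length v). om ^ inverse_maj (length v) (plist (length v) \<pi>) *
      (inv_sign (is_odd v) (plist (length v) \<pi>) * f (word_of v (plist (length v) \<pi>))))"
    unfolding klyachko_def word_sign_def word_of_plist
    by (rule sum.cong[OF refl]) (simp add: perm_maj_inv)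
  also have "\<dots> = (\<Sum>p\<in>pos_lists {..<length v}. om ^ inverse_maj (length v) p *
     (inv_sign (is_odd v) p * f (word_of v p)))"
    by (rule sum.reindex_bij_betw[OF bij_betw_plist])
  finally show ?thesis .
qed

text \<open>Inverse descents are switched on one at a time. Each new one at r multiplies the sum by
  1 - \<open>om\<close>^r, and the product of these factors is k.\<close>

theorem klyachko_primitive:
  assumes om: "prim_root (length v) om" and f: "primitive f"
  shows "klyachko om f v = of_nat (length v) * f v"
proof -
  define k where "k = length v"
  have k: "k > 0" using om by (simp add: prim_root_def k_def)
  let ?\<psi> = "\<lambda>p. inv_sign (is_odd v) p * f (word_of v p)"
  let ?W = "\<lambda>r p. om ^ inverse_maj r p * ?\<psi> p"
  \<comment> \<open>With weights that see only the order of the first r positions, the sum factors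
    through proper shuffles with the increasing tail.\<close>
  have T: "(\<Sum>p\<in>tail_sorted k r. ?W r p) = 0" if r: "1 \<le> r" "r < k" for r
  proof -
    have dis: "set x \<inter> set [r..<k] = {}" if "x \<in> pos_lists {..<r}" for x
      using that by (simp add: pos_lists_def ivl_disj_int)
    have fx: "filter (\<lambda>c. c < r) p = x" if "x \<in> pos_lists {..<r}" "p \<in> shuffles x [r..<k]" for x p
    proof -
      have "filter (\<lambda>c. c < r) p = filter (\<lambda>c. c \<in> set x) p"
        by (rule filter_cong) (use that in \<open>simp_all add: pos_lists_def\<close>)
      then show ?thesis using filter_shuffles_disjoint1(1)[OF dis that(2)] that(1) by simp
    qed
    have fin: "finite (pos_lists {..<r})" using bij_betw_finite[OF bij_betw_plist] by simp
    have "(\<Sum>p\<in>tail_sorted k r. ?W r p) = (\<Sum>x\<in>pos_lists {..<r}. \<Sum>p\<in>shuffles x [r..<k]. ?W r p)"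
      unfolding tail_sorted_eq_shuffles[OF less_imp_le[OF r(2)]]
    proof (rule sum.UNION_disjoint[OF fin], goal_cases)
      case 2
      show ?case using fx by blast
    qed simp
    also have "\<dots> = (\<Sum>x\<in>pos_lists {..<r}. om ^ inverse_maj r x * (\<Sum>p\<in>shuffles x [r..<k]. ?\<psi> p))"
    proof (rule sum.cong[OF refl])
      fix x assume x: "x \<in> pos_lists {..<r}"
      have "inverse_maj r p = inverse_maj r x" if "p \<in> shuffles x [r..<k]" for p
        unfolding inverse_maj_def
      proof (rule sum.cong[OF refl])
        fix i assume "i \<in> {1..<r}"
        then have "before (filter (\<lambda>c. c < r) p) i (i - 1) = before p i (i - 1)"
          by (intro before_filter) auto
        then show "(if before p i (i - 1) then i else 0) = (if before x i (i - 1) then i else 0)"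
          using fx[OF x that] by simp
      qed
      then show "(\<Sum>p\<in>shuffles x [r..<k]. ?W r p) = om ^ inverse_maj r x * (\<Sum>p\<in>shuffles x [r..<k]. ?\<psi> p)"
        by (simp add: sum_distrib_left)
    qed
    also have "\<dots> = 0"
    proof (rule sum.neutral, rule ballI)
      fix x assume x: "x \<in> pos_lists {..<r}"
      have sx: "set x = {..<r}" using x by (simp add: pos_lists_def)
      have "x \<noteq> []" using sx r by (metis empty_iff empty_set lessThan_iff less_eq_Suc_le One_nat_def)
      then have ne: "word_of v x \<noteq> []" "word_of v [r..<k] \<noteq> []"
        using r by (simp_all add: word_of_def)
      have "(\<Sum>p\<in>shuffles x [r..<k]. ?\<psi> p) = shuffle_pairing f (word_of v x) (word_of v [r..<k]) *
          (inv_sign (is_odd v) x * inv_sign (is_odd v) [r..<k])"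
        by (rule shuffle_pairing_word_of[symmetric]) (simp add: sx)
      also have "\<dots> = 0" using f ne by (simp add: primitive_def)
      finally show "om ^ inverse_maj r x * (\<Sum>p\<in>shuffles x [r..<k]. ?\<psi> p) = 0" by simp
    qed
    finally show ?thesis .
  qed
  have U: "(\<Sum>p\<in>tail_sorted k r. ?W (Suc r) p) = (\<Prod>s\<in>{1..<Suc r}. 1 - om ^ s) * f v" if "r < k" for r
    using that
  proof (induction r)
    case 0
    have "[0..<k] \<in> pos_lists {..<k}" by (simp add: pos_lists_def atLeast0LessThan)
    then have "tail_sorted k 0 = {[0..<k]}" unfolding tail_sorted_def by auto
    then show ?case by (simp add: inverse_maj_def inv_sign_sorted word_of_def k_def map_nth)
  next
    case (Suc r)
    let ?A = "tail_sorted k r" and ?B = "{p \<in> tail_sorted k (Suc r). \<not> before p r (Suc r)}"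
    have un: "tail_sorted k (Suc r) = ?A \<union> ?B" "?A \<inter> ?B = {}"
      using tail_sorted_pred[of "Suc r" k] Suc.prems by auto
    have split: "(\<Sum>p\<in>tail_sorted k (Suc r). g p) = (\<Sum>p\<in>?A. g p) + (\<Sum>p\<in>?B. g p)" for g :: "nat list \<Rightarrow> complex"
    proof -
      have "(\<Sum>p\<in>?A \<union> ?B. g p) = (\<Sum>p\<in>?A. g p) + (\<Sum>p\<in>?B. g p)"
        by (rule sum.union_disjoint) (use un(2) in \<open>auto simp: finite_tail_sorted\<close>)
      then show ?thesis using un(1) by simp
    qed
    have mA: "inverse_maj (Suc (Suc r)) p = inverse_maj (Suc r) p" if "p \<in> ?A" for p
    proof -
      have "p \<in> pos_lists {..<k}" "before p r (Suc r)"
        using that tail_sorted_pred[of "Suc r" k] Suc.prems by (auto simp: tail_sorted_def)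
      then have "\<not> before p (Suc r) r" using before_swap[of p k r "Suc r"] Suc.prems before_swap[of p k "Suc r" r] by auto
      then show ?thesis by (simp add: inverse_maj_def)
    qed
    have mB: "inverse_maj (Suc (Suc r)) p = inverse_maj (Suc r) p + Suc r" if "p \<in> ?B" for p
    proof -
      have "p \<in> pos_lists {..<k}" using that by (auto simp: tail_sorted_def)
      then have "before p (Suc r) r" using before_swap[of p k r "Suc r"] Suc.prems that by auto
      then show ?thesis by (simp add: inverse_maj_def)
    qed
    \<comment> \<open>Under the old weight the two parts cancel; the new weight differs from it only
      by \<open>om ^ Suc r\<close> on the second part.\<close>
    have "(\<Sum>p\<in>?A. ?W (Suc r) p) + (\<Sum>p\<in>?B. ?W (Suc r) p) = 0"
      using T[of "Suc r"] Suc.prems unfolding split[symmetric] by simp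
    then have B: "(\<Sum>p\<in>?B. ?W (Suc r) p) = - (\<Sum>p\<in>?A. ?W (Suc r) p)"
      by (simp add: add_eq_0_iff)
    have "(\<Sum>p\<in>tail_sorted k (Suc r). ?W (Suc (Suc r)) p) =
        (\<Sum>p\<in>?A. ?W (Suc r) p) + om ^ Suc r * (\<Sum>p\<in>?B. ?W (Suc r) p)"
      unfolding split sum_distrib_left
      by (intro arg_cong2[where f = "(+)"] sum.cong refl) (simp_all only: mA mB power_add mult_ac)
    also have "\<dots> = (1 - om ^ Suc r) * (\<Sum>p\<in>?A. ?W (Suc r) p)"
      unfolding B by (simp add: algebra_simps)
    also have "\<dots> = (1 - om ^ Suc r) * ((\<Prod>s\<in>{1..<Suc r}. 1 - om ^ s) * f v)"
      using Suc by simp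
    finally show ?case by (simp add: mult_ac)
  qed
  have "klyachko om f v = (\<Sum>p\<in>tail_sorted k k. ?W k p)"
    unfolding klyachko_pos_lists tail_sorted_full k_def ..
  \<comment> \<open>A tail with a single entry is always sorted.\<close>
  also have "tail_sorted k k = tail_sorted k (k - 1)"
  proof -
    have "filter (\<lambda>c. k - 1 \<le> c) p = [k - 1..<k]" if "p \<in> pos_lists {..<k}" for p
    proof -
      have "mset (filter (\<lambda>c. k - 1 \<le> c) p) = filter_mset (\<lambda>c. k - 1 \<le> c) (mset_set {..<k})"
      proof -
        have "distinct p" "set p = {..<k}" using that by (simp_all add: pos_lists_def)
        then have "mset p = mset_set {..<k}" using mset_set_set[of p] by simp
        then show ?thesis by simp
      qed
      also have "\<dots> = mset_set {k - 1}" unfolding filter_mset_mset_set[OF finite_lessThan]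
        using k by (intro arg_cong[where f = mset_set]) auto
      also have "mset_set {k - 1} = {#k - 1#}" by simp
      finally have "filter (\<lambda>c. k - 1 \<le> c) p = [k - 1]" unfolding mset_single_iff .
      then show ?thesis using k upt_conv_Cons[of "k - 1" k] by simp
    qed
    then show ?thesis unfolding tail_sorted_full by (auto simp: tail_sorted_def)
  qed
  also have "(\<Sum>p\<in>tail_sorted k (k - 1). ?W k p) = (\<Prod>s\<in>{1..<k}. 1 - om ^ s) * f v"
    using U[of "k - 1"] k by simp
  also have "(\<Prod>s\<in>{1..<k}. 1 - om ^ s) = of_nat k"
    by (rule prod_one_minus_prim_root_powers) (use om in \<open>simp add: k_def\<close>)
  finally show ?thesis unfolding k_def .
qed

text \<open>By the shuffle lemma each coefficient is a q-binomial coefficient at a primitive k-th root of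
  unity, which vanishes.\<close>
theorem klyachko_image_primitive:
  assumes om: "prim_root k om" and u: "u \<noteq> []" and w: "w \<noteq> []" and k: "length u + length w = k"
  shows "shuffle_pairing (klyachko om f) u w = 0"
proof -
  define v r where "v = u @ w" and "r = length u"
  have lv: "length v = k" and r: "0 < r" "r < k" using u w k by (auto simp: v_def r_def)
  let ?x = "[0..<r]" and ?y = "[r..<k]"
  have uw: "word_of v ?x = u" "word_of v ?y = w"
    using k by (auto simp: word_of_def v_def r_def nth_append intro!: nth_equalityI)
  have dis: "set ?x \<inter> set ?y = {}" by auto
  have shp: "shuffles ?x ?y \<subseteq> pos_lists {..<k}"
  proof
    fix p assume p: "p \<in> shuffles ?x ?y"
    show "p \<in> pos_lists {..<k}"
    proof -
      have "{0..<r} \<union> {r..<k} = {..<k}" using r by auto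
      then show ?thesis
        using distinct_disjoint_shuffles[OF _ _ dis p] set_shuffles[OF p] by (simp add: pos_lists_def)
    qed
  qed
  \<comment> \<open>Composing with the permutation of p moves p into the exponent. For fixed \<pi>
    it is then the major index of the shuffle p in the order by which the inverse of \<pi> ranks the
    positions.\<close>
  have key: "inv_sign (is_odd v) p * klyachko om f (word_of v p) =
     (\<Sum>\<pi>\<in>perms k. om ^ list_maj (\<lambda>a b. inv \<pi> b < inv \<pi> a) p * (word_sign v \<pi> * f (permute_list \<pi> v)))"
    if p: "p \<in> shuffles ?x ?y" for p
  proof -
    obtain \<eta> where \<eta>: "\<eta> \<in> perms k" "p = plist k \<eta>"
      using p shp bij_betw_plist[of k] by (auto simp: bij_betw_def)
    have "inv_sign (is_odd v) p * klyachko om f (word_of v p) =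
       word_sign v \<eta> * klyachko om f (permute_list \<eta> v)"
      unfolding \<eta>(2) lv[symmetric] word_of_plist by (simp add: word_sign_def)
    also have "\<dots> = (\<Sum>\<pi>\<in>perms k. om ^ perm_maj k (inv \<pi>) * (word_sign v (\<eta> \<circ> \<pi>) * f (permute_list (\<eta> \<circ> \<pi>) v)))"
      unfolding klyachko_def sum_distrib_left length_permute_list lv
    proof (rule sum.cong[OF refl])
      fix \<pi> assume \<pi>: "\<pi> \<in> perms k"
      have "word_sign v (\<eta> \<circ> \<pi>) = word_sign v \<eta> * word_sign (permute_list \<eta> v) \<pi>"
        by (rule word_sign_compose) (use \<eta> \<pi> lv in auto)
      moreover have "permute_list (\<eta> \<circ> \<pi>) v = permute_list \<pi> (permute_list \<eta> v)"
        by (rule permute_list_compose) (use \<pi> lv in \<open>simp add: perms_def\<close>)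
      ultimately show "word_sign v \<eta> * (om ^ perm_maj k (inv \<pi>) * (word_sign (permute_list \<eta> v) \<pi> *
          f (permute_list \<pi> (permute_list \<eta> v)))) =
        om ^ perm_maj k (inv \<pi>) * (word_sign v (\<eta> \<circ> \<pi>) * f (permute_list (\<eta> \<circ> \<pi>) v))"
        by (simp add: mult_ac)
    qed
    also have "\<dots> = (\<Sum>\<pi>\<in>perms k. om ^ list_maj (\<lambda>a b. inv \<pi> b < inv \<pi> a) p * (word_sign v \<pi> * f (permute_list \<pi> v)))"
    proof (rule sum.reindex_bij_witness[of _ "\<lambda>\<pi>. inv \<eta> \<circ> \<pi>" "\<lambda>\<pi>. \<eta> \<circ> \<pi>"])
      fix \<pi> assume \<pi>: "\<pi> \<in> perms k"
      show "inv \<eta> \<circ> (\<eta> \<circ> \<pi>) = \<pi>" "\<eta> \<circ> (inv \<eta> \<circ> \<pi>) = \<pi>"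
        using perms_inv_left[OF \<eta>(1)] perms_inv_right[OF \<eta>(1)] by (auto simp: fun_eq_iff)
      show "\<eta> \<circ> \<pi> \<in> perms k" "inv \<eta> \<circ> \<pi> \<in> perms k"
        using \<eta>(1) \<pi> perms_inv perms_compose by blast+
      have bij: "bij \<eta>" "bij \<pi>" using \<eta>(1) \<pi> by (auto simp: perms_def permutes_bij)
      have "inv (\<eta> \<circ> \<pi>) = inv \<pi> \<circ> inv \<eta>" using bij by (intro o_inv_distrib) auto
      then have "inv (\<eta> \<circ> \<pi>) (\<eta> i) = inv \<pi> i" for i using perms_inv_left[OF \<eta>(1)] by simp
      then have "list_maj (\<lambda>a b. inv (\<eta> \<circ> \<pi>) b < inv (\<eta> \<circ> \<pi>) a) p = perm_maj k (inv \<pi>)"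
        unfolding perm_maj_def \<eta>(2) plist_def list_maj_map by simp
      then show "om ^ list_maj (\<lambda>a b. inv (\<eta> \<circ> \<pi>) b < inv (\<eta> \<circ> \<pi>) a) p *
          (word_sign v (\<eta> \<circ> \<pi>) * f (permute_list (\<eta> \<circ> \<pi>) v)) =
        om ^ perm_maj k (inv \<pi>) * (word_sign v (\<eta> \<circ> \<pi>) * f (permute_list (\<eta> \<circ> \<pi>) v))" by simp
    qed
    finally show ?thesis .
  qed
  have "shuffle_pairing (klyachko om f) u w =
      shuffle_pairing (klyachko om f) (word_of v ?x) (word_of v ?y) * (inv_sign (is_odd v) ?x * inv_sign (is_odd v) ?y)"
    unfolding uw by (simp add: inv_sign_sorted)
  also have "\<dots> = (\<Sum>p\<in>shuffles ?x ?y. inv_sign (is_odd v) p * klyachko om f (word_of v p))"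
    by (rule shuffle_pairing_word_of) auto
  also have "\<dots> = (\<Sum>p\<in>shuffles ?x ?y. \<Sum>\<pi>\<in>perms k. om ^ list_maj (\<lambda>a b. inv \<pi> b < inv \<pi> a) p *
      (word_sign v \<pi> * f (permute_list \<pi> v)))"
    by (rule sum.cong[OF refl key])
  also have "\<dots> = (\<Sum>\<pi>\<in>perms k. (\<Sum>p\<in>shuffles ?x ?y. om ^ list_maj (\<lambda>a b. inv \<pi> b < inv \<pi> a) p) *
      (word_sign v \<pi> * f (permute_list \<pi> v)))"
    by (subst sum.swap) (simp only: sum_distrib_right)
  also have "\<dots> = 0"
  proof (rule sum.neutral, rule ballI)
    fix \<pi> assume \<pi>: "\<pi> \<in> perms k"
    let ?D = "\<lambda>a b. inv \<pi> b < inv \<pi> a"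
    have "inv \<pi> a \<noteq> inv \<pi> b" if "a \<noteq> b" for a b using that perms_inv_right[OF \<pi>] by metis
    then have D: "descent_rel ?D" unfolding descent_rel_def by (auto simp: linorder_neq_iff)
    have "(\<Sum>p\<in>shuffles ?x ?y. om ^ list_maj ?D p) * qfact om r * qfact om (k - r) =
        om ^ (list_maj ?D ?x + list_maj ?D ?y) * qfact om k"
      using sum_shuffles_list_maj[OF D dis, of om] r by simp
    moreover have "qfact om k = 0"
    proof -
      obtain k' where "k = Suc k'" using r by (cases k) auto
      moreover have "qnum om k = 0" using qnum_prim_root_eq_0_iff[OF om, of k] r by simp
      ultimately show ?thesis by simp
    qed
    moreover have "qfact om s \<noteq> 0" if "s < k" for s
      using that qnum_prim_root_eq_0_iff[OF om] r by (auto simp: qfact_def dest: dvd_imp_le)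
    ultimately have "(\<Sum>p\<in>shuffles ?x ?y. om ^ list_maj ?D p) = 0" using r by auto
    then show "(\<Sum>p\<in>shuffles ?x ?y. om ^ list_maj ?D p) * (word_sign v \<pi> * f (permute_list \<pi> v)) = 0" by simp
  qed
  finally show ?thesis .
qed

section \<open>Conjugation by the long cycle\<close>

interpretation tensor: vector_space tscale
  by unfold_locales (auto simp: tscale_def algebra_simps fun_eq_iff)

lemma sum_tensor_apply: "(\<Sum>x\<in>A. (f x :: tensor)) w = (\<Sum>x\<in>A. f x w)"
  by (induction A rule: infinite_finite_induct) auto

text \<open>All K (wvec w) lie in V, so their coordinates are taken in a basis of V alone.
  Exchanging the sums turns the trace over words into the trace of K on V, where K is a
  scalar.\<close>

theorem trace_eq_dim:
  fixes K :: "tensor \<Rightarrow> tensor"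
  assumes W: "finite W" and V: "V \<subseteq> {f. \<forall>w. f w \<noteq> 0 \<longrightarrow> w \<in> W}"
    and add: "\<And>f g. K (f + g) = K f + K g" and scale: "\<And>c f. K (tscale c f) = tscale c (K f)"
    and into: "\<And>w. w \<in> W \<Longrightarrow> K (wvec w) \<in> V" and eigen: "\<And>f. f \<in> V \<Longrightarrow> K f = tscale c f"
  shows "c * of_nat (tensor.dim V) = (\<Sum>w\<in>W. K (wvec w) w)"
proof -
  obtain B where B: "B \<subseteq> V" "tensor.independent B" "V \<subseteq> tensor.span B" "card B = tensor.dim V"
    using tensor.basis_exists by blast
  have expand: "f = (\<Sum>w\<in>W. tscale (f w) (wvec w))" if "f \<in> V" for f
  proof
    fix x
    have "(\<Sum>w\<in>W. tscale (f w) (wvec w)) x = (\<Sum>w\<in>W. if w = x then f x else 0)"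
      unfolding sum_tensor_apply by (rule sum.cong) (auto simp: tscale_def wvec_def)
    also have "\<dots> = f x" using V that W by auto
    finally show "f x = (\<Sum>w\<in>W. tscale (f w) (wvec w)) x" ..
  qed
  have "B \<subseteq> tensor.span (wvec ` W)"
  proof
    fix b assume "b \<in> B"
    then have "b \<in> V" using B(1) by blast
    show "b \<in> tensor.span (wvec ` W)"
      by (subst expand[OF \<open>b \<in> V\<close>], rule tensor.span_sum, rule tensor.span_scale, rule tensor.span_base) simp
  qed
  then have fB: "finite B" using tensor.independent_span_bound[OF _ B(2)] W by blast
  have K0: "K 0 = 0" using scale[of 0 0] by (simp add: tscale_def zero_fun_def)
  have Ksum: "K (\<Sum>w\<in>A. g w) = (\<Sum>w\<in>A. K (g w))" if "finite A" for A :: "word set" and g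
    using that
  proof (induction A)
    case empty
    show ?case unfolding sum.empty by (rule K0)
  next
    case (insert x F)
    show ?case unfolding sum.insert[OF insert(1,2)] add insert(3) ..
  qed
  let ?rep = "tensor.representation B"
  have KV: "K (wvec w) \<in> tensor.span B" if "w \<in> W" for w using into[OF that] B(3) by blast
  have "(\<Sum>w\<in>W. K (wvec w) w) = (\<Sum>w\<in>W. \<Sum>b\<in>B. ?rep (K (wvec w)) b * b w)"
  proof (rule sum.cong[OF refl])
    fix w assume w: "w \<in> W"
    have "K (wvec w) = (\<Sum>b\<in>B. tscale (?rep (K (wvec w)) b) b)"
      using tensor.sum_representation_eq[OF B(2) KV[OF w] fB] by simp
    from fun_cong[OF this, of w] show "K (wvec w) w = (\<Sum>b\<in>B. ?rep (K (wvec w)) b * b w)"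
      by (simp add: sum_tensor_apply tscale_def)
  qed
  \<comment> \<open>By linearity of the coordinates, the sum over words reassembles K applied to the
    basis vector b.\<close>
  also have "\<dots> = (\<Sum>b\<in>B. \<Sum>w\<in>W. ?rep (tscale (b w) (K (wvec w))) b)"
    by (subst sum.swap, intro sum.cong refl) (simp add: tensor.representation_scale[OF B(2) KV] mult.commute)
  also have "\<dots> = (\<Sum>b\<in>B. ?rep (\<Sum>w\<in>W. tscale (b w) (K (wvec w))) b)"
    by (rule sum.cong[OF refl], subst tensor.representation_sum[OF B(2)])
       (auto intro: tensor.span_scale KV)
  also have "\<dots> = (\<Sum>b\<in>B. c)"
  proof (rule sum.cong[OF refl])
    fix b assume b: "b \<in> B"
    then have bV: "b \<in> V" using B(1) by blast
    have "(\<Sum>w\<in>W. tscale (b w) (K (wvec w))) = K (\<Sum>w\<in>W. tscale (b w) (wvec w))"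
      by (simp add: Ksum[OF W] scale)
    also have "\<dots> = tscale c b" unfolding expand[OF bV, symmetric] by (rule eigen[OF bV])
    finally have "?rep (\<Sum>w\<in>W. tscale (b w) (K (wvec w))) b = ?rep (tscale c b) b" by simp
    also have "\<dots> = c * ?rep b b"
      using tensor.representation_scale[OF B(2) tensor.span_base[OF b]] by simp
    also have "?rep b b = 1" using tensor.representation_basis[OF B(2) b] by simp
    finally show "?rep (\<Sum>w\<in>W. tscale (b w) (K (wvec w))) b = c" by simp
  qed
  finally show ?thesis using B(4) by (simp add: mult.commute)
qed

section \<open>Cyclic descents under rotation of places and of values\<close>

definition rot :: "nat \<Rightarrow> nat \<Rightarrow> nat \<Rightarrow> nat" where
  "rot k j i = (if i < k then (i + j) mod k else i)"

lemma rot_perms: "rot k j \<in> perms k"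
proof -
  have "inj_on (rot k j) {..<k}"
  proof (rule inj_onI)
    fix x y assume "x \<in> {..<k}" "y \<in> {..<k}" "rot k j x = rot k j y"
    then have "[x + j = y + j] (mod k)" "x < k" "y < k" by (auto simp: rot_def cong_def)
    then have "[x = y] (mod k)" by (simp only: cong_add_rcancel_nat)
    then show "x = y" using \<open>x < k\<close> \<open>y < k\<close> by (simp add: cong_def)
  qed
  moreover have "rot k j ` {..<k} \<subseteq> {..<k}" by (auto simp: rot_def)
  ultimately have "bij_betw (rot k j) {..<k} {..<k}"
    unfolding bij_betw_def by (simp add: endo_inj_surj)
  then have "rot k j permutes {..<k}" by (rule bij_imp_permutes) (simp add: rot_def)
  then show ?thesis by (simp add: perms_def)
qed

lemma rot_Suc: "rot k (Suc j) = rot k 1 \<circ> rot k j"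
  by (auto simp: rot_def fun_eq_iff mod_Suc_eq)

lemma rot_0: "rot k 0 = id"
  by (auto simp: rot_def)

definition cyc_desc :: "nat \<Rightarrow> (nat \<Rightarrow> nat) \<Rightarrow> nat set" where
  "cyc_desc k \<tau> = {i. i < k \<and> \<tau> (rot k 1 i) < \<tau> i}"

lemma finite_cyc_desc: "finite (cyc_desc k \<tau>)"
  by (rule finite_subset[of _ "{..<k}"]) (auto simp: cyc_desc_def)

definition cyc_weight :: "nat \<Rightarrow> complex \<Rightarrow> (nat \<Rightarrow> nat) \<Rightarrow> complex" where
  "cyc_weight k om \<tau> = (\<Prod>i\<in>cyc_desc k \<tau>. om ^ Suc i)"

text \<open>The wrap-around descent at the last place has weight \<open>om\<close>^k = 1, so the
  cyclic descents give the same weight as the ordinary ones.\<close>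

lemma cyc_weight_eq_perm_maj:
  assumes om: "prim_root k om"
  shows "cyc_weight k om \<tau> = om ^ perm_maj k \<tau>"
proof -
  obtain k' where k': "k = Suc k'" using om by (cases k) (auto simp: prim_root_def)
  have omk: "om ^ k = 1" using om by (simp add: prim_root_def)
  have "cyc_weight k om \<tau> = (\<Prod>i<k. if \<tau> (rot k 1 i) < \<tau> i then om ^ Suc i else 1)"
    unfolding cyc_weight_def cyc_desc_def
    by (subst prod.inter_filter[symmetric]) (auto intro: prod.cong)
  also have "\<dots> = (\<Prod>i<k'. if \<tau> (Suc i) < \<tau> i then om ^ Suc i else 1)"
    unfolding k' using omk by (simp add: k' rot_def)
  also have "\<dots> = (\<Prod>i\<in>{1..<k}. om ^ (if \<tau> i < \<tau> (i - 1) then i else 0))"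
    by (rule prod.reindex_bij_witness[of _ "\<lambda>i. i - 1" Suc]) (auto simp: k')
  also have "\<dots> = om ^ perm_maj k \<tau>"
    unfolding perm_maj_def list_maj_def length_plist power_sum by (rule prod.cong) auto
  finally show ?thesis .
qed

lemma rot_bij: "bij_betw (rot k j) {..<k} {..<k}"
  using rot_perms[of k j] by (simp add: perms_def permutes_imp_bij)

lemma cyc_desc_rot_right: "rot k 1 ` cyc_desc k (\<tau> \<circ> rot k 1) = cyc_desc k \<tau>"
proof (intro equalityI subsetI)
  fix x assume "x \<in> rot k 1 ` cyc_desc k (\<tau> \<circ> rot k 1)"
  then show "x \<in> cyc_desc k \<tau>" using perms_less[OF rot_perms] by (auto simp: cyc_desc_def)
next
  fix x assume x: "x \<in> cyc_desc k \<tau>"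
  then have "x < k" by (simp add: cyc_desc_def)
  then obtain y where y: "y < k" "x = rot k 1 y" using rot_bij[of k 1] by (auto simp: bij_betw_def)
  then show "x \<in> rot k 1 ` cyc_desc k (\<tau> \<circ> rot k 1)" using x by (auto simp: cyc_desc_def)
qed

lemma inj_rot: "inj_on (rot k j) A"
  using rot_perms[of k j] permutes_inj unfolding perms_def by (metis inj_on_subset mem_Collect_eq subset_UNIV)

lemma card_cyc_desc_rot_right: "card (cyc_desc k (\<tau> \<circ> rot k 1)) = card (cyc_desc k \<tau>)"
  unfolding cyc_desc_rot_right[of k \<tau>, symmetric] by (rule card_image[OF inj_rot, symmetric])

lemma power_Suc_rot:
  assumes "prim_root k om" "i < k"
  shows "om ^ Suc (rot k 1 i) = om ^ Suc i * om"
proof (cases "Suc i = k")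
  case True
  have "om ^ Suc i = 1" unfolding True using assms by (simp add: prim_root_def)
  then show ?thesis using True by (simp add: rot_def)
next
  case False
  then show ?thesis using assms(2) by (simp add: rot_def)
qed

text \<open>Rotating the places moves every cyclic descent back by one place, at the cost of one
  factor \<open>om\<close> each.\<close>

lemma cyc_weight_rot_right:
  assumes om: "prim_root k om"
  shows "cyc_weight k om \<tau> = cyc_weight k om (\<tau> \<circ> rot k 1) * om ^ card (cyc_desc k \<tau>)"
proof -
  have "cyc_weight k om \<tau> = (\<Prod>i\<in>cyc_desc k (\<tau> \<circ> rot k 1). om ^ Suc (rot k 1 i))"
    unfolding cyc_weight_def cyc_desc_rot_right[of k \<tau>, symmetric] prod.reindex[OF inj_rot] by simp
  also have "\<dots> = (\<Prod>i\<in>cyc_desc k (\<tau> \<circ> rot k 1). om ^ Suc i * om)"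
    by (rule prod.cong[OF refl], rule power_Suc_rot[OF om]) (auto simp: cyc_desc_def)
  also have "\<dots> = cyc_weight k om (\<tau> \<circ> rot k 1) * om ^ card (cyc_desc k \<tau>)"
    unfolding prod.distrib cyc_weight_def by (simp only: card_cyc_desc_rot_right prod_constant)
  finally show ?thesis .
qed

text \<open>Raising all values cyclically keeps comparisons except at the maximum, which becomes 0.
  The descent just after the maximum, at p, moves to the place p' just before it.\<close>

lemma cyc_desc_rot_left:
  assumes k: "k \<ge> 2" and \<tau>: "\<tau> \<in> perms k"
  obtains p p' where "p < k" "p' < k" "rot k 1 p' = p" "\<tau> p = k - 1" "p \<in> cyc_desc k \<tau>" "p' \<notin> cyc_desc k \<tau>"
    "cyc_desc k (rot k 1 \<circ> \<tau>) = insert p' (cyc_desc k \<tau> - {p})"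
proof -
  define p where "p = inv \<tau> (k - 1)"
  have tp: "\<tau> p = k - 1" unfolding p_def by (rule perms_inv_right[OF \<tau>])
  have p: "p < k" using perms_less[OF perms_inv[OF \<tau>], of "k - 1"] k by (simp add: p_def)
  obtain p' where p': "p' < k" "p = rot k 1 p'" using p rot_bij[of k 1] by (auto simp: bij_betw_def)
  have nofix: "rot k 1 i \<noteq> i" if "i < k" for i
    using that k by (cases "Suc i = k") (auto simp: rot_def)
  have inj: "\<tau> i = \<tau> j \<longleftrightarrow> i = j" for i j using perms_inv_left[OF \<tau>] by metis
  have lt: "\<tau> i < k" if "i < k" for i using that perms_less[OF \<tau>] by simp
  have rlt: "rot k 1 i < k" if "i < k" for i using that perms_less[OF rot_perms] by simp
  have small: "\<tau> i < k - 1" if "i < k" "i \<noteq> p" for i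
    using lt[OF that(1)] inj[of i p] that tp by linarith
  have rinj: "rot k 1 i = rot k 1 j \<Longrightarrow> i = j" for i j using inj_rot[of k 1 UNIV] by (auto dest: injD)
  have 1: "p \<in> cyc_desc k \<tau>" using small[of "rot k 1 p"] p nofix[OF p] rlt[OF p] tp by (simp add: cyc_desc_def)
  have pp: "p' \<noteq> p" using nofix[OF p'(1)] p'(2) by metis
  have 2: "p' \<notin> cyc_desc k \<tau>" using small[OF p'(1) pp] tp p'(2) by (auto simp: cyc_desc_def)
  have rs: "rot k 1 (\<tau> i) = Suc (\<tau> i)" if "i < k" "i \<noteq> p" for i
    using small[OF that] by (simp add: rot_def)
  have rp: "rot k 1 (\<tau> p) = 0" unfolding tp using k by (simp add: rot_def)
  have 3: "cyc_desc k (rot k 1 \<circ> \<tau>) = insert p' (cyc_desc k \<tau> - {p})"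
  proof (rule set_eqI)
    fix i
    consider "\<not> i < k" | "i = p" | "i = p'" | "i < k" "i \<noteq> p" "i \<noteq> p'" by blast
    then show "i \<in> cyc_desc k (rot k 1 \<circ> \<tau>) \<longleftrightarrow> i \<in> insert p' (cyc_desc k \<tau> - {p})"
    proof cases
      case 1
      then show ?thesis using p' by (auto simp: cyc_desc_def)
    next
      case 2
      then show ?thesis using rp pp by (auto simp: cyc_desc_def)
    next
      case 3
      have "rot k 1 (\<tau> (rot k 1 p')) = 0" using rp p'(2) by simp
      then show ?thesis using 3 rs[OF p'(1) pp] p'(1) by (simp add: cyc_desc_def)
    next
      case 4
      have "rot k 1 i \<noteq> p" using 4 rinj p'(2) by auto
      then show ?thesis using 4 rs[of i] rs[of "rot k 1 i"] rlt[of i] by (simp add: cyc_desc_def)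
    qed
  qed
  show thesis by (rule that[OF p p'(1) p'(2)[symmetric] tp 1 2 3])
qed

lemma cyc_desc_le_1: "cyc_desc 1 \<tau> = {}"
  by (auto simp: cyc_desc_def rot_def)

lemma card_cyc_desc_rot_left:
  assumes \<tau>: "\<tau> \<in> perms k"
  shows "card (cyc_desc k (rot k 1 \<circ> \<tau>)) = card (cyc_desc k \<tau>)"
proof (cases "k \<ge> 2")
  case True
  obtain p p' where "p \<in> cyc_desc k \<tau>" "p' \<notin> cyc_desc k \<tau>"
    "cyc_desc k (rot k 1 \<circ> \<tau>) = insert p' (cyc_desc k \<tau> - {p})"
    using cyc_desc_rot_left[OF True \<tau>] by metis
  then show ?thesis using finite_cyc_desc[of k \<tau>] card_Suc_Diff1[OF finite_cyc_desc, of p k \<tau>] by simp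
next
  case False
  then consider "k = 0" | "k = 1" by linarith
  then show ?thesis
  proof cases
    case 1
    then show ?thesis by (simp add: cyc_desc_def)
  next
    case 2
    show ?thesis unfolding 2 cyc_desc_le_1 ..
  qed
qed

lemma prim_root_1: "prim_root 1 om \<Longrightarrow> om = 1"
  by (simp add: prim_root_def)

lemma cyc_weight_rot_left:
  assumes om: "prim_root k om" and \<tau>: "\<tau> \<in> perms k"
  shows "cyc_weight k om (rot k 1 \<circ> \<tau>) * om = cyc_weight k om \<tau>"
proof (cases "k \<ge> 2")
  case True
  obtain p p' where p: "p' < k" "rot k 1 p' = p" "p \<in> cyc_desc k \<tau>" "p' \<notin> cyc_desc k \<tau>"
    "cyc_desc k (rot k 1 \<circ> \<tau>) = insert p' (cyc_desc k \<tau> - {p})"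
    using cyc_desc_rot_left[OF True \<tau>] by metis
  have "cyc_weight k om (rot k 1 \<circ> \<tau>) * om = (om ^ Suc p' * om) * (\<Prod>i\<in>cyc_desc k \<tau> - {p}. om ^ Suc i)"
    unfolding cyc_weight_def p(5) using p(4) finite_cyc_desc[of k \<tau>] by (simp add: mult_ac)
  also have "om ^ Suc p' * om = om ^ Suc p"
    unfolding p(2)[symmetric] by (rule power_Suc_rot[OF om p(1), symmetric])
  also have "om ^ Suc p * (\<Prod>i\<in>cyc_desc k \<tau> - {p}. om ^ Suc i) = cyc_weight k om \<tau>"
    unfolding cyc_weight_def by (rule prod.remove[OF finite_cyc_desc p(3), symmetric])
  finally show ?thesis .
next
  case False
  then have "k = 1" using om by (auto simp: prim_root_def)
  then have "om = 1" using om prim_root_1 by simp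
  then show ?thesis by (simp add: cyc_weight_def)
qed

text \<open>Induction from the identity, whose only cyclic descent is the wrap-around. The second
  claim is a power of \<open>om\<close> rather than a cardinality because for k = 1 there are no
  cyclic descents, while \<open>om\<close> = 1.\<close>

lemma cyc_weight_rot:
  assumes om: "prim_root k om"
  shows "cyc_weight k om (rot k j) * om ^ j = 1" and "om ^ card (cyc_desc k (rot k j)) = om"
proof -
  have id: "cyc_desc k id = (if k \<ge> 2 then {k - 1} else {})"
  proof (rule set_eqI)
    fix i
    consider "Suc i < k" | "Suc i = k" | "\<not> i < k" by linarith
    then show "i \<in> cyc_desc k id \<longleftrightarrow> i \<in> (if k \<ge> 2 then {k - 1} else {})"
    proof cases
      case 1
      then show ?thesis by (simp add: cyc_desc_def rot_def)
    next
      case 2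
      then have "rot k 1 i = 0" by (simp add: rot_def)
      then show ?thesis using 2 by (cases i) (auto simp: cyc_desc_def)
    next
      case 3
      then show ?thesis by (auto simp: cyc_desc_def)
    qed
  qed
  have w0: "cyc_weight k om id = 1" "om ^ card (cyc_desc k id) = om"
  proof -
    have "k > 0" "om ^ k = 1" using om by (auto simp: prim_root_def)
    then show "cyc_weight k om id = 1" unfolding cyc_weight_def id by (simp del: power_Suc)
    show "om ^ card (cyc_desc k id) = om"
    proof (cases "k \<ge> 2")
      case False
      then have "k = 1" using om by (auto simp: prim_root_def)
      then have "om = 1" using om prim_root_1 by blast
      then show ?thesis by simp
    qed (simp add: id)
  qed
  show "cyc_weight k om (rot k j) * om ^ j = 1"
  proof (induction j)
    case (Suc j)
    then show ?case
      by (simp only: rot_Suc power_Suc mult.assoc[symmetric] cyc_weight_rot_left[OF om rot_perms])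
  qed (simp only: rot_0 w0 power_0 mult_1_right)
  show "om ^ card (cyc_desc k (rot k j)) = om"
    by (induction j) (simp_all only: rot_0 w0 rot_Suc[of k] card_cyc_desc_rot_left[OF rot_perms])
qed

lemma increasing_bounded_imp_id:
  fixes a :: "nat \<Rightarrow> nat"
  assumes "\<And>i. Suc i < k \<Longrightarrow> a i < a (Suc i)" "\<And>i. i < k \<Longrightarrow> a i < k" "i < k"
  shows "a i = i"
proof -
  have lo: "i \<le> a i" if "i < k" for i
    using that by (induction i) (use assms(1) in \<open>force+\<close>)
  have "a (k - Suc j) \<le> k - Suc j" if "j < k" for j
    using that
  proof (induction j)
    case 0
    then show ?case using assms(2)[of "k - 1"] by simp
  next
    case (Suc j)
    have "Suc (k - Suc (Suc j)) = k - Suc j" using Suc.prems by simp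
    then show ?case using Suc assms(1)[of "k - Suc (Suc j)"] by simp
  qed
  from this[of "k - Suc i"] have "a i \<le> i" using assms(3) by simp
  then show ?thesis using lo[OF assms(3)] by simp
qed

text \<open>For k \<ge> 2 the number of cyclic descents lies strictly between 0 and k, so it is 1
  once it is congruent to 1 modulo k.\<close>

lemma unique_cyc_desc_imp_rot:
  assumes om: "prim_root k om" and \<tau>: "\<tau> \<in> perms k" and c: "om ^ card (cyc_desc k \<tau>) = om"
  obtains j where "j < k" "\<tau> = rot k j"
proof (cases "k \<ge> 2")
  case False
  then have k: "k = 1" using om by (auto simp: prim_root_def)
  have "\<tau> = rot k 0"
  proof
    fix i
    show "\<tau> i = rot k 0 i"
      using \<tau> k permutes_not_in[of \<tau> "{..<k}" i] perms_less[OF \<tau>, of i]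
      by (cases "i < k") (auto simp: rot_def perms_def)
  qed
  then show thesis using that[of 0] k by simp
next
  case True
  have om0: "om \<noteq> 0" using om by (auto simp: prim_root_def power_0_left)
  obtain p p' where p: "p < k" "p' < k" "\<tau> p = k - 1" "p \<in> cyc_desc k \<tau>" "p' \<notin> cyc_desc k \<tau>"
    using cyc_desc_rot_left[OF True \<tau>] by metis
  have "card (cyc_desc k \<tau>) < card {..<k}"
    by (rule psubset_card_mono) (use p in \<open>auto simp: cyc_desc_def\<close>)
  then have le: "card (cyc_desc k \<tau>) < k" by simp
  have pos: "card (cyc_desc k \<tau>) > 0" using p(4) finite_cyc_desc card_gt_0_iff by blast
  have "om ^ (card (cyc_desc k \<tau>) - 1) * om = om" using c pos by (simp flip: power_Suc2)
  then have "om ^ (card (cyc_desc k \<tau>) - 1) = 1" using om0 by simp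
  then have "k dvd card (cyc_desc k \<tau>) - 1" using prim_root_power_eq_1_iff[OF om] by simp
  then have "card (cyc_desc k \<tau>) - 1 = 0" using le by (auto dest: dvd_imp_le)
  then have "card (cyc_desc k \<tau>) = 1" using pos by simp
  then have single: "cyc_desc k \<tau> = {p}" using p(4) by (metis card_1_singletonE singletonD)
  \<comment> \<open>The values read cyclically from the place after the only descent; they increase,
    hence are 0, 1, ..., k - 1.\<close>
  define a where "a i = \<tau> ((p + 1 + i) mod k)" for i
  have id: "a i = i" if "i < k" for i
  proof (rule increasing_bounded_imp_id[OF _ _ that])
    fix i assume i: "Suc i < k"
    have "(p + 1 + i) mod k \<noteq> p"
    proof
      assume "(p + 1 + i) mod k = p"
      then have "[p + Suc i = p + 0] (mod k)" using p(1) by (simp add: cong_def)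
      then have "[Suc i = 0] (mod k)" by (simp only: cong_add_lcancel_nat)
      then show False using i by (simp add: cong_def)
    qed
    then have "(p + 1 + i) mod k \<notin> cyc_desc k \<tau>" using single by simp
    then have "\<not> \<tau> (rot k 1 ((p + 1 + i) mod k)) < \<tau> ((p + 1 + i) mod k)"
      using p(1) by (simp add: cyc_desc_def)
    moreover have "rot k 1 ((p + 1 + i) mod k) = (p + 1 + Suc i) mod k"
      using p(1) by (simp add: rot_def mod_Suc_eq)
    ultimately have "a i \<le> a (Suc i)" by (simp add: a_def)
    moreover have "a i \<noteq> a (Suc i)"
    proof
      assume "a i = a (Suc i)"
      then have "(p + 1 + i) mod k = (p + 1 + Suc i) mod k" unfolding a_def using perms_inv_left[OF \<tau>] by metis
      then have "[(p + 1 + i) + 0 = (p + 1 + i) + 1] (mod k)" by (simp add: cong_def)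
      then have "[0 = 1] (mod k)" by (simp only: cong_add_lcancel_nat)
      then show False using True by (simp add: cong_def)
    qed
    ultimately show "a i < a (Suc i)" by simp
  next
    fix i assume "i < k"
    then show "a i < k" unfolding a_def using perms_less[OF \<tau>] by simp
  qed
  have "\<tau> = rot k (k - (p + 1))"
  proof
    fix x
    show "\<tau> x = rot k (k - (p + 1)) x"
    proof (cases "x < k")
      case True
      define i where "i = (x + (k - (p + 1))) mod k"
      have "(p + 1 + i) mod k = (p + 1 + (x + (k - (p + 1)))) mod k" unfolding i_def by (rule mod_add_right_eq)
      also have "p + 1 + (x + (k - (p + 1))) = x + k" using p(1) by simp
      finally have "a i = \<tau> x" using True by (simp add: a_def)
      moreover have "i < k" using True by (simp add: i_def)
      ultimately show ?thesis using id[of i] True by (simp add: rot_def i_def)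
    next
      case False
      then show ?thesis using \<tau> permutes_not_in[of \<tau> "{..<k}" x] by (simp add: rot_def perms_def)
    qed
  qed
  then show thesis using that[of "k - (p + 1)"] p(1) by simp
qed

text \<open>Conjugation by the long cycle multiplies the Klyachko weight by a power of the root of unity
  determined by the number of cyclic descents, so only rotations contribute to a class function.\<close>
theorem sum_perm_maj_class_function:
  assumes om: "prim_root k om" and cls: "\<And>\<pi>. \<pi> \<in> perms k \<Longrightarrow> \<chi> (rot k 1 \<circ> \<pi> \<circ> inv (rot k 1)) = \<chi> \<pi>"
  shows "(\<Sum>\<tau>\<in>perms k. om ^ perm_maj k \<tau> * \<chi> \<tau>) = (\<Sum>j<k. inverse om ^ j * (\<chi> (rot k j) :: complex))"
proof -
  let ?c = "\<lambda>\<tau>. card (cyc_desc k \<tau>)"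
  define G where "G \<tau> = cyc_weight k om \<tau> * \<chi> \<tau>" for \<tau>
  let ?\<rho> = "rot k 1"
  define cj where "cj \<tau> = ?\<rho> \<circ> \<tau> \<circ> inv ?\<rho>" for \<tau>
  define cj' where "cj' \<tau> = inv ?\<rho> \<circ> \<tau> \<circ> ?\<rho>" for \<tau>
  note r = rot_perms[of k 1]
  have inv: "cj (cj' \<tau>) = \<tau>" "cj' (cj \<tau>) = \<tau>" for \<tau>
    using perms_inv_left[OF r] perms_inv_right[OF r] by (auto simp: cj_def cj'_def fun_eq_iff)
  have mem: "cj \<tau> \<in> perms k" "cj' \<tau> \<in> perms k" if "\<tau> \<in> perms k" for \<tau>
    using that r perms_inv[OF r] perms_compose unfolding cj_def cj'_def by blast+
  have comp: "\<tau> \<circ> inv ?\<rho> \<circ> ?\<rho> = \<tau>" for \<tau>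
    using perms_inv_left[OF r] by (auto simp: fun_eq_iff)
  have mem2: "\<tau> \<circ> inv ?\<rho> \<in> perms k" if "\<tau> \<in> perms k" for \<tau>
    using that perms_inv[OF r] perms_compose by blast
  have c2: "?c (\<tau> \<circ> inv ?\<rho>) = ?c \<tau>" for \<tau>
    using card_cyc_desc_rot_right[of k "\<tau> \<circ> inv ?\<rho>"] unfolding comp by simp
  have c: "?c (cj \<tau>) = ?c \<tau>" if "\<tau> \<in> perms k" for \<tau>
    using card_cyc_desc_rot_left[OF mem2[OF that]] c2[of \<tau>] unfolding cj_def comp_assoc by simp
  have c': "?c (cj' \<tau>) = ?c \<tau>" if "\<tau> \<in> perms k" for \<tau>
    using c[OF mem(2)[OF that]] inv(1)[of \<tau>] by simp
  have G: "G (cj \<tau>) * om = G \<tau> * om ^ ?c \<tau>" if \<tau>: "\<tau> \<in> perms k" for \<tau>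
  proof -
    have "cyc_weight k om (cj \<tau>) * om = cyc_weight k om (\<tau> \<circ> inv ?\<rho>)"
      using cyc_weight_rot_left[OF om mem2[OF \<tau>]] unfolding cj_def comp_assoc .
    also have "\<dots> = cyc_weight k om \<tau> * om ^ ?c \<tau>"
      using cyc_weight_rot_right[OF om, of "\<tau> \<circ> inv ?\<rho>"] unfolding comp c2 .
    finally have "cyc_weight k om (cj \<tau>) * om = cyc_weight k om \<tau> * om ^ ?c \<tau>" .
    moreover have "\<chi> (cj \<tau>) = \<chi> \<tau>" using cls[OF \<tau>] by (simp add: cj_def)
    ultimately show ?thesis by (simp add: G_def mult_ac)
  qed
  \<comment> \<open>Conjugation permutes the permutations with c cyclic descents, so their sum times
    \<open>om\<close> equals the same sum times \<open>om\<close>^c.\<close>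
  have Z: "(\<Sum>\<tau>\<in>{\<tau>\<in>perms k. ?c \<tau> = c}. G \<tau>) = 0" if ne: "om ^ c \<noteq> om" for c
  proof -
    let ?Z = "\<Sum>\<tau>\<in>{\<tau>\<in>perms k. ?c \<tau> = c}. G \<tau>"
    have "?Z = (\<Sum>\<tau>\<in>{\<tau>\<in>perms k. ?c \<tau> = c}. G (cj \<tau>))"
      by (rule sum.reindex_bij_witness[of _ cj cj']) (use inv mem c c' in auto)
    then have "?Z * om = (\<Sum>\<tau>\<in>{\<tau>\<in>perms k. ?c \<tau> = c}. G (cj \<tau>)) * om" by (rule arg_cong)
    also have "\<dots> = (\<Sum>\<tau>\<in>{\<tau>\<in>perms k. ?c \<tau> = c}. G (cj \<tau>) * om)" by (rule sum_distrib_right)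
    also have "\<dots> = (\<Sum>\<tau>\<in>{\<tau>\<in>perms k. ?c \<tau> = c}. G \<tau> * om ^ c)"
      by (rule sum.cong) (use G in auto)
    also have "\<dots> = ?Z * om ^ c" by (rule sum_distrib_right[symmetric])
    finally have "?Z * om = ?Z * om ^ c" .
    then show ?thesis using ne by auto
  qed
  let ?S = "{\<tau>\<in>perms k. om ^ ?c \<tau> \<noteq> om}" and ?R = "{\<tau>\<in>perms k. om ^ ?c \<tau> = om}"
  have S: "(\<Sum>\<tau>\<in>?S. G \<tau>) = 0"
  proof -
    have "(\<Sum>\<tau>\<in>?S. G \<tau>) = (\<Sum>y\<in>?c ` ?S. \<Sum>\<tau>\<in>{\<tau>\<in>?S. ?c \<tau> = y}. G \<tau>)"
      by (rule sum.image_gen) simp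
    also have "\<dots> = 0"
    proof (rule sum.neutral, rule ballI)
      fix y assume "y \<in> ?c ` ?S"
      then have y: "om ^ y \<noteq> om" by auto
      then have "{\<tau>\<in>?S. ?c \<tau> = y} = {\<tau>\<in>perms k. ?c \<tau> = y}" by auto
      then show "(\<Sum>\<tau>\<in>{\<tau>\<in>?S. ?c \<tau> = y}. G \<tau>) = 0" using Z[OF y] by simp
    qed
    finally show ?thesis .
  qed
  have R: "?R = rot k ` {..<k}"
  proof (intro equalityI subsetI)
    fix \<tau> assume "\<tau> \<in> ?R"
    then show "\<tau> \<in> rot k ` {..<k}" using unique_cyc_desc_imp_rot[OF om, of \<tau>] by auto
  next
    fix \<tau> assume "\<tau> \<in> rot k ` {..<k}"
    then show "\<tau> \<in> ?R" using rot_perms cyc_weight_rot(2)[OF om] by auto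
  qed
  have inj: "inj_on (rot k) {..<k}"
  proof (rule inj_onI)
    fix i j assume ij: "i \<in> {..<k}" "j \<in> {..<k}" "rot k i = rot k j"
    have "0 < k" using ij(1) by simp
    then show "i = j" using fun_cong[OF ij(3), of 0] ij(1,2) by (simp add: rot_def)
  qed
  have om0: "om \<noteq> 0" using om by (auto simp: prim_root_def power_0_left)
  have "(\<Sum>\<tau>\<in>perms k. om ^ perm_maj k \<tau> * \<chi> \<tau>) = (\<Sum>\<tau>\<in>?S \<union> ?R. G \<tau>)"
    unfolding G_def cyc_weight_eq_perm_maj[OF om] by (rule sum.cong) auto
  also have "\<dots> = (\<Sum>\<tau>\<in>?S. G \<tau>) + (\<Sum>\<tau>\<in>?R. G \<tau>)" by (rule sum.union_disjoint) auto
  also have "\<dots> = (\<Sum>j<k. G (rot k j))" unfolding S R sum.reindex[OF inj] by simp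
  also have "\<dots> = (\<Sum>j<k. inverse om ^ j * \<chi> (rot k j))"
  proof (rule sum.cong[OF refl])
    fix j
    have "cyc_weight k om (rot k j) = inverse om ^ j"
      using cyc_weight_rot(1)[OF om, of j] om0 by (simp add: power_inverse field_simps)
    then show "G (rot k j) = inverse om ^ j * \<chi> (rot k j)" by (simp add: G_def)
  qed
  finally show ?thesis .
qed

section \<open>The dimension of the weight spaces\<close>

lemma inv_sign_append_sorted:
  assumes "sorted x" "sorted y" "\<And>a b. a \<in> set x \<Longrightarrow> b \<in> set y \<Longrightarrow> b < a"
  shows "inv_sign od (x @ y) = (-1) ^ (length (filter od x) * length (filter od y))"
  using assms(1,3)
proof (induction x)
  case Nil
  then show ?case using inv_sign_sorted[OF assms(2)] by simp
next
  case (Cons a x)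
  have 1: "filter (\<lambda>c. od c \<and> c < a) x = []" using Cons.prems(1) by (auto simp: filter_empty_conv)
  have 2: "filter (\<lambda>c. od c \<and> c < a) y = filter od y"
    by (rule filter_cong) (use Cons.prems(2) in auto)
  have 3: "inv_sign od (x @ y) = (-1) ^ (length (filter od x) * length (filter od y))"
    by (rule Cons.IH) (use Cons.prems in auto)
  show ?case by (simp add: 1 2 3 power_add)
qed

lemma rotate_upt: "j < k \<Longrightarrow> rotate j [0..<k] = [j..<k] @ [0..<j]"
proof -
  assume j: "j < k"
  have "[0..<k] = [0..<j] @ [j..<k]" using upt_add_eq_append[of 0 j "k - j"] j by simp
  then show ?thesis using rotate_append[of "[0..<j]" "[j..<k]"] by simp
qed

lemma plist_rot: "plist k (rot k j) = rotate j [0..<k]"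
  by (rule nth_equalityI) (auto simp: rot_def nth_rotate add.commute)

lemma permute_list_rot: "permute_list (rot (length w) j) w = rotate j w"
  by (rule nth_equalityI) (auto simp: rot_def nth_rotate permute_list_def add.commute)

text \<open>A rotation exchanges two increasing blocks, so its inversions are all the pairs across
  the blocks.\<close>

lemma word_sign_rot:
  assumes "j < length w"
  shows "word_sign w (rot (length w) j) = rotate_sign j w"
proof -
  let ?k = "length w"
  have t: "take j w = word_of w [0..<j]" "drop j w = word_of w [j..<?k]"
    using assms by (auto simp: word_of_def intro!: nth_equalityI)
  have "word_sign w (rot ?k j) = inv_sign (is_odd w) ([j..<?k] @ [0..<j])"
    unfolding word_sign_def plist_rot rotate_upt[OF assms] ..
  also have "\<dots> = (-1) ^ (length (filter (is_odd w) [j..<?k]) * length (filter (is_odd w) [0..<j]))"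
    by (rule inv_sign_append_sorted) auto
  also have "\<dots> = rotate_sign j w"
    unfolding rotate_sign_def t odd_count_word_of by (simp add: mult.commute)
  finally show ?thesis .
qed

lemma word_sign_square: "word_sign v \<sigma> * word_sign v \<sigma> = 1"
  by (simp add: word_sign_def inv_sign_square)

section \<open>The signed permutation representation on a class of words\<close>

locale word_class =
  fixes W :: "word set" and k :: nat
  assumes fin: "finite W" and len: "\<And>w. w \<in> W \<Longrightarrow> length w = k"
    and closed: "\<And>w w'. w \<in> W \<Longrightarrow> mset w' = mset w \<Longrightarrow> w' \<in> W"
begin

lemma permute_closed: "w \<in> W \<Longrightarrow> \<pi> \<in> perms k \<Longrightarrow> permute_list \<pi> w \<in> W"
  using closed len mset_permute_list unfolding perms_def by blast

text \<open>The character of the signed place permutations on the span of W: each acts monomially,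
  so only fixed words enter the trace.\<close>

definition char :: "(nat \<Rightarrow> nat) \<Rightarrow> complex" where
  "char \<pi> = (\<Sum>w\<in>{w\<in>W. permute_list \<pi> w = w}. word_sign w \<pi>)"

lemma permute_compose:
  assumes "w \<in> W" "\<tau> \<in> perms k"
  shows "permute_list (\<sigma> \<circ> \<tau>) w = permute_list \<tau> (permute_list \<sigma> w)"
  by (rule permute_list_compose) (use assms len in \<open>auto simp: perms_def\<close>)

lemma sign_compose:
  assumes "w \<in> W" "\<sigma> \<in> perms k" "\<tau> \<in> perms k"
  shows "word_sign w (\<sigma> \<circ> \<tau>) = word_sign w \<sigma> * word_sign (permute_list \<sigma> w) \<tau>"
  by (rule word_sign_compose) (use assms len in auto)

lemma permute_inv:
  assumes "w \<in> W" "\<pi> \<in> perms k"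
  shows "permute_list (inv \<pi>) (permute_list \<pi> w) = w" "permute_list \<pi> (permute_list (inv \<pi>) w) = w"
    "word_sign w \<pi> * word_sign (permute_list \<pi> w) (inv \<pi>) = 1"
proof -
  have c: "\<pi> \<circ> inv \<pi> = id" "inv \<pi> \<circ> \<pi> = id"
    using perms_inv_left[OF assms(2)] perms_inv_right[OF assms(2)] by (auto simp: fun_eq_iff)
  show "permute_list (inv \<pi>) (permute_list \<pi> w) = w"
    using permute_compose[OF assms(1) perms_inv[OF assms(2)], of \<pi>] by (simp add: c)
  show "permute_list \<pi> (permute_list (inv \<pi>) w) = w"
    using permute_compose[OF assms(1,2), of "inv \<pi>"] by (simp add: c)
  show "word_sign w \<pi> * word_sign (permute_list \<pi> w) (inv \<pi>) = 1"
    using sign_compose[OF assms(1,2) perms_inv[OF assms(2)]] by (simp add: c word_sign_id)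
qed

lemma char_inv: "\<pi> \<in> perms k \<Longrightarrow> char (inv \<pi>) = char \<pi>"
proof -
  assume \<pi>: "\<pi> \<in> perms k"
  have eq: "{w\<in>W. permute_list (inv \<pi>) w = w} = {w\<in>W. permute_list \<pi> w = w}"
    using permute_inv(1,2)[OF _ \<pi>] by (auto; metis)
  have "word_sign w (inv \<pi>) = word_sign w \<pi>" if "w \<in> W" "permute_list \<pi> w = w" for w
  proof -
    have 1: "word_sign w \<pi> * word_sign w (inv \<pi>) = 1" using permute_inv(3)[OF that(1) \<pi>] that(2) by simp
    have "word_sign w (inv \<pi>) = word_sign w \<pi> * word_sign w \<pi> * word_sign w (inv \<pi>)"
      by (simp add: word_sign_square)
    also have "\<dots> = word_sign w \<pi>" using 1 by (simp add: mult.assoc)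
    finally show ?thesis .
  qed
  then show ?thesis unfolding char_def eq by (intro sum.cong) auto
qed

text \<open>Permuting by \<rho> carries the fixed words of the conjugate to those of \<pi>, and by
  the cocycle rule the signs of \<rho> and its inverse cancel.\<close>

lemma char_conj:
  assumes \<rho>: "\<rho> \<in> perms k" and \<pi>: "\<pi> \<in> perms k"
  shows "char (\<rho> \<circ> \<pi> \<circ> inv \<rho>) = char \<pi>"
proof -
  have m: "\<rho> \<circ> \<pi> \<in> perms k" "inv \<rho> \<in> perms k" using assms perms_compose perms_inv by auto
  have pw: "permute_list (\<rho> \<circ> \<pi> \<circ> inv \<rho>) w = permute_list (inv \<rho>) (permute_list \<pi> (permute_list \<rho> w))" if "w \<in> W" for w
    using permute_compose[OF that m(2)] permute_compose[OF that \<pi>] by simp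
  have fixed: "permute_list (\<rho> \<circ> \<pi> \<circ> inv \<rho>) w = w \<longleftrightarrow> permute_list \<pi> (permute_list \<rho> w) = permute_list \<rho> w"
    if w: "w \<in> W" for w
  proof -
    have u: "permute_list \<pi> (permute_list \<rho> w) \<in> W" using w permute_closed assms by blast
    show ?thesis unfolding pw[OF w]
      using permute_inv(2)[OF u \<rho>] permute_inv(1)[OF w \<rho>] by metis
  qed
  show ?thesis unfolding char_def
  proof (rule sum.reindex_bij_witness[of _ "permute_list (inv \<rho>)" "permute_list \<rho>"])
    fix w assume "w \<in> {w \<in> W. permute_list (\<rho> \<circ> \<pi> \<circ> inv \<rho>) w = w}"
    then have w: "w \<in> W" "permute_list \<pi> (permute_list \<rho> w) = permute_list \<rho> w" using fixed by auto
    show "permute_list (inv \<rho>) (permute_list \<rho> w) = w" by (rule permute_inv(1)[OF w(1) \<rho>])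
    show "permute_list \<rho> w \<in> {w \<in> W. permute_list \<pi> w = w}" using w permute_closed \<rho> by auto
    have "word_sign w (\<rho> \<circ> \<pi> \<circ> inv \<rho>) = word_sign w (\<rho> \<circ> \<pi>) * word_sign (permute_list (\<rho> \<circ> \<pi>) w) (inv \<rho>)"
      by (rule sign_compose[OF w(1) m])
    also have "permute_list (\<rho> \<circ> \<pi>) w = permute_list \<rho> w" using permute_compose[OF w(1) \<pi>] w(2) by simp
    also have "word_sign w (\<rho> \<circ> \<pi>) = word_sign w \<rho> * word_sign (permute_list \<rho> w) \<pi>"
      by (rule sign_compose[OF w(1) assms])
    finally have "word_sign w (\<rho> \<circ> \<pi> \<circ> inv \<rho>) = word_sign (permute_list \<rho> w) \<pi> *
        (word_sign w \<rho> * word_sign (permute_list \<rho> w) (inv \<rho>))"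
      by (simp only: mult_ac)
    then show "word_sign (permute_list \<rho> w) \<pi> = word_sign w (\<rho> \<circ> \<pi> \<circ> inv \<rho>)"
      by (simp only: permute_inv(3)[OF w(1) \<rho>] mult_1_right)
  next
    fix w assume "w \<in> {w \<in> W. permute_list \<pi> w = w}"
    then have w: "w \<in> W" "permute_list \<pi> w = w" by auto
    show "permute_list \<rho> (permute_list (inv \<rho>) w) = w" by (rule permute_inv(2)[OF w(1) \<rho>])
    have "permute_list (inv \<rho>) w \<in> W" using w permute_closed m(2) by blast
    then show "permute_list (inv \<rho>) w \<in> {w \<in> W. permute_list (\<rho> \<circ> \<pi> \<circ> inv \<rho>) w = w}"
      using fixed w(2) permute_inv(2)[OF w(1) \<rho>] by simp
  qed
qed

text \<open>Since the character is invariant under inversion, the weight becomes the major index of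
  the permutation itself. Only rotations survive, weighted by powers of \<open>inverse om\<close>;
  the sieving theorem is therefore used with the inverse root.\<close>

lemma trace_klyachko:
  assumes om: "prim_root k om"
  shows "(\<Sum>w\<in>W. klyachko om (wvec w) w) =
    of_nat k * of_nat (card {w\<in>W. list_maj super_desc w mod k = 1 mod k})"
proof -
  have k: "k > 0" using om by (simp add: prim_root_def)
  have "(\<Sum>w\<in>W. klyachko om (wvec w) w) =
     (\<Sum>w\<in>W. \<Sum>\<pi>\<in>perms k. om ^ perm_maj k (inv \<pi>) * (if permute_list \<pi> w = w then word_sign w \<pi> else 0))"
    unfolding klyachko_def by (intro sum.cong) (auto simp: len wvec_def)
  also have "\<dots> = (\<Sum>\<pi>\<in>perms k. om ^ perm_maj k (inv \<pi>) * char \<pi>)"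
    by (subst sum.swap) (simp add: sum_distrib_left[symmetric] char_def sum.inter_filter[OF fin])
  also have "\<dots> = (\<Sum>\<tau>\<in>perms k. om ^ perm_maj k \<tau> * char \<tau>)"
    by (rule sum.reindex_bij_witness[of _ inv inv]) (auto simp: perms_inv perms_inv_inv char_inv)
  also have "\<dots> = (\<Sum>j<k. inverse om ^ j * char (rot k j))"
    by (rule sum_perm_maj_class_function[OF om]) (rule char_conj[OF rot_perms])
  also have "\<dots> = (\<Sum>j<k. inverse om ^ j * (\<Sum>w\<in>{w\<in>W. rotate j w = w}. rotate_sign j w))"
  proof (rule sum.cong[OF refl])
    fix j assume j: "j \<in> {..<k}"
    have "{w\<in>W. permute_list (rot k j) w = w} = {w\<in>W. rotate j w = w}"
      using permute_list_rot len by metis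
    moreover have "word_sign w (rot k j) = rotate_sign j w" if "w \<in> W" for w
      using word_sign_rot[of j w] len[OF that] j by simp
    ultimately show "inverse om ^ j * char (rot k j) = inverse om ^ j * (\<Sum>w\<in>{w\<in>W. rotate j w = w}. rotate_sign j w)"
      unfolding char_def by (intro arg_cong2[where f = "(*)"] sum.cong) auto
  qed
  also have "\<dots> = of_nat k * of_nat (card {w\<in>W. list_maj super_desc w mod k = 1 mod k})"
    by (rule card_maj_eq_1[OF fin len k closed prim_root_inverse[OF om], symmetric])
  finally show ?thesis .
qed

end

lemma ex_prim_root: "k > 0 \<Longrightarrow> \<exists>om. prim_root k om"
proof -
  assume k: "k > 0"
  let ?r = "\<lambda>j. cis (2 * pi * real j / real k)"
  have pow: "?r 1 ^ j = ?r j" for j by (simp add: DeMoivre mult_ac)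
  have inj: "inj_on ?r {..<k}" using bij_betw_roots_unity[OF k] by (simp add: bij_betw_def)
  have "?r 1 ^ k = 1" using k unfolding pow by simp
  moreover have "?r 1 ^ i \<noteq> 1" if "0 < i" "i < k" for i
  proof
    assume "?r 1 ^ i = 1"
    then have "?r i = ?r 0" unfolding pow by simp
    then show False using inj_onD[OF inj, of i 0] that k by simp
  qed
  ultimately show ?thesis using k unfolding prim_root_def by blast
qed

section \<open>Weight spaces of the free Lie superalgebra\<close>

definition super_words :: "nat \<Rightarrow> nat \<Rightarrow> (nat \<Rightarrow> nat) \<Rightarrow> word set" where
  "super_words n m mu = {w. length w = n + m \<and> odd_count w = m \<and> wweight w = mu}"

lemma even_odd_count: "even_count w + odd_count w = length w"
  unfolding even_count_def odd_count_def using sum_length_filter_compl[of snd w] by simp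

lemma counts_cong:
  assumes "mset u = mset v"
  shows "length u = length v" "odd_count u = odd_count v" "even_count u = even_count v" "wweight u = wweight v"
proof -
  have f: "length (filter P u) = length (filter P v)" for P
    using assms by (metis mset_filter size_mset)
  show "length u = length v" "odd_count u = odd_count v" "even_count u = even_count v" "wweight u = wweight v"
    using f by (auto simp: odd_count_def even_count_def wweight_def intro: mset_eq_length[OF assms])
qed

lemma super_words_letters:
  assumes "\<forall>i\<ge>N. mu i = 0" "w \<in> super_words n m mu"
  shows "set w \<subseteq> {..<N} \<times> UNIV"
proof
  fix a assume a: "a \<in> set w"
  have "mu (fst a) = length (filter (\<lambda>b. fst b = fst a) w)" using assms(2) by (auto simp: super_words_def wweight_def)
  moreover have "filter (\<lambda>b. fst b = fst a) w \<noteq> []" using a by (auto simp: filter_empty_conv)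
  ultimately have "mu (fst a) \<noteq> 0" by simp
  then have "fst a < N" using assms(1) by (metis not_le)
  then show "a \<in> {..<N} \<times> UNIV" by (cases a) auto
qed

lemma super_words_class:
  assumes "\<forall>i\<ge>N. mu i = 0"
  shows "word_class (super_words n m mu) (n + m)"
proof
  have "super_words n m mu \<subseteq> words_over ({..<N} \<times> UNIV) (n + m)"
    using super_words_letters[OF assms] by (auto simp: words_over_def super_words_def)
  then show "finite (super_words n m mu)"
    using finite_words_over[of "{..<N} \<times> UNIV" "n + m"] finite_subset by auto
next
  fix w w' assume "w \<in> super_words n m mu" "mset w' = mset w"
  then show "w' \<in> super_words n m mu" using counts_cong[of w' w] by (simp add: super_words_def)
qed (simp add: super_words_def)

lemma shuffle_pairing_eq_0:
  "(\<And>w. length w = length u + length v \<Longrightarrow> f w = 0) \<Longrightarrow> shuffle_pairing f u v = 0"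
  by (induction f u v rule: shuffle_pairing.induct) auto

lemma primitive_add: "primitive f \<Longrightarrow> primitive g \<Longrightarrow> primitive (f + g)"
  using shuffle_pairing_add[of f g] by (simp add: primitive_def plus_fun_def)

lemma primitive_tscale: "primitive f \<Longrightarrow> primitive (tscale c f)"
  using shuffle_pairing_cmult[of c f] by (simp add: primitive_def tscale_def)

lemma primitive_0: "primitive 0"
  using shuffle_pairing_0 by (simp add: primitive_def zero_fun_def)

text \<open>Membership in a span is replaced by linear conditions. One inclusion is the primitivity
  of brackets; for the other, the Dynkin identity expands f in right-normed brackets of words from
  its own support, which have the right bidegree and letters.\<close>

theorem weight_space_Lnm:
  assumes mu: "\<forall>i\<ge>N. mu i = 0" and k: "n + m > 0"
  shows "weight_space (Lnm N n m) mu =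
     {f. primitive f \<and> (\<forall>w. f w \<noteq> 0 \<longrightarrow> w \<in> super_words n m mu)}"
proof (intro equalityI subsetI)
  fix f assume "f \<in> weight_space (Lnm N n m) mu"
  then have fL: "f \<in> Lnm N n m" and fw: "\<And>w. f w \<noteq> 0 \<Longrightarrow> wweight w = mu" by (auto simp: weight_space_def)
  let ?P = "\<lambda>f. primitive f \<and> (\<forall>w. f w \<noteq> 0 \<longrightarrow> length w = n + m \<and> odd_count w = m)"
  have "?P f"
    using fL unfolding Lnm_def
  proof (induction rule: tensor.span_induct)
    case base
    have "?P 0" using primitive_0 by simp
    moreover have "?P (f + g)" if "?P f" "?P g" for f g
      using that primitive_add[of f g] by (auto; metis add.right_neutral add_0)
    moreover have "?P (tscale c f)" if "?P f" for c f
      using that primitive_tscale[of f c] by (auto simp: tscale_def)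
    ultimately show ?case unfolding tensor.subspace_def by blast
  next
    case (step f)
    then obtain t where t: "f = beval t" "even_count (leaves t) = n" "odd_count (leaves t) = m" by auto
    have "length w = n + m \<and> odd_count w = m" if "f w \<noteq> 0" for w
      using counts_cong[OF beval_support[of t w]] that t even_odd_count[of "leaves t"] by simp
    then show ?case using primitive_beval t by blast
  qed
  then show "f \<in> {f. primitive f \<and> (\<forall>w. f w \<noteq> 0 \<longrightarrow> w \<in> super_words n m mu)}"
    using fw by (auto simp: super_words_def)
next
  fix f assume "f \<in> {f. primitive f \<and> (\<forall>w. f w \<noteq> 0 \<longrightarrow> w \<in> super_words n m mu)}"
  then have prim: "primitive f" and sup: "\<And>w. f w \<noteq> 0 \<Longrightarrow> w \<in> super_words n m mu" by auto
  let ?A = "{..<N} \<times> (UNIV :: bool set)" and ?k = "n + m"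
  let ?g = "\<Sum>w\<in>words_over ?A ?k. tscale (f w) (beval (right_comb w))"
  have sw: "w \<in> words_over ?A ?k" if "w \<in> super_words n m mu" for w
    using super_words_letters[OF mu that] that by (simp add: words_over_def super_words_def)
  have "tscale (of_nat ?k) f = ?g"
  proof
    fix x
    have g: "?g x = (\<Sum>w\<in>words_over ?A ?k. f w * beval (right_comb w) x)"
      by (simp add: sum_tensor_apply tscale_def)
    show "tscale (of_nat ?k) f x = ?g x"
    proof (cases "x \<in> words_over ?A ?k")
      case True
      then have x: "set x \<subseteq> ?A" "length x = ?k" "x \<noteq> []" using k by (auto simp: words_over_def)
      show ?thesis unfolding g using dynkin_specht_wever[OF prim _ x(1,3)] x(2) by (simp add: tscale_def)
    next
      case False
      \<comment> \<open>Outside these words both sides vanish, since brackets preserve length and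
        set of letters.\<close>
      have "beval (right_comb w) x = 0" if w: "w \<in> words_over ?A ?k" for w
      proof (rule ccontr)
        assume "beval (right_comb w) x \<noteq> 0"
        moreover have "w \<noteq> []" using w k by (auto simp: words_over_def)
        ultimately have "mset x = mset w" using beval_support[of "right_comb w" x] leaves_right_comb[of w] by simp
        then have "set x = set w" "length x = length w" by (rule mset_eq_setD, rule mset_eq_length)
        then show False using False w by (simp add: words_over_def)
      qed
      then have "?g x = 0" unfolding g by simp
      moreover have "f x = 0" using False sup sw by blast
      ultimately show ?thesis by (simp add: tscale_def)
    qed
  qed
  moreover have "?g \<in> Lnm N n m"
    unfolding Lnm_def
  proof (rule tensor.span_sum)
    fix w assume w: "w \<in> words_over ?A ?k"
    show "tscale (f w) (beval (right_comb w)) \<in> tensor.span (beval ` {t. (\<forall>a\<in>set (leaves t). fst a < N) \<and>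
        even_count (leaves t) = n \<and> odd_count (leaves t) = m})"
    proof (cases "f w = 0")
      case True
      then have "tscale (f w) (beval (right_comb w)) = 0" by (simp add: tscale_def zero_fun_def)
      then show ?thesis by (simp only: tensor.span_zero)
    next
      case False
      have "w \<noteq> []" using w k by (auto simp: words_over_def)
      then have l: "leaves (right_comb w) = w" by (rule leaves_right_comb)
      have "odd_count w = m" "length w = n + m" using sup[OF False] by (auto simp: super_words_def)
      then have "even_count w = n" using even_odd_count[of w] by simp
      moreover have "\<forall>a\<in>set w. fst a < N" using w by (auto simp: words_over_def)
      ultimately show ?thesis using \<open>odd_count w = m\<close> l
        by (intro tensor.span_scale tensor.span_base imageI) simp
    qed
  qed
  ultimately have "tscale (of_nat ?k) f \<in> Lnm N n m" by simp
  then have "tscale (inverse (of_nat ?k)) (tscale (of_nat ?k) f) \<in> Lnm N n m"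
    unfolding Lnm_def by (rule tensor.span_scale)
  moreover have "tscale (inverse (of_nat ?k)) (tscale (of_nat ?k) f) = f"
    using k by (simp add: tscale_def fun_eq_iff flip: of_nat_add)
  ultimately have "f \<in> Lnm N n m" by simp
  then show "f \<in> weight_space (Lnm N n m) mu" using sup by (auto simp: weight_space_def super_words_def)
qed

theorem ch_eq_card:
  assumes mu: "\<forall>i\<ge>N. mu i = 0" and k: "n + m > 0"
  shows "ch N n m mu = card {w \<in> super_words n m mu. list_maj super_desc w mod (n + m) = 1 mod (n + m)}"
proof -
  let ?W = "super_words n m mu" and ?k = "n + m"
  interpret word_class ?W ?k by (rule super_words_class[OF mu])
  obtain om where om: "prim_root ?k om" using ex_prim_root[OF k] by blast
  let ?V = "weight_space (Lnm N n m) mu"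
  have V: "?V = {f. primitive f \<and> (\<forall>w. f w \<noteq> 0 \<longrightarrow> w \<in> ?W)}" by (rule weight_space_Lnm[OF mu k])
  have "of_nat ?k * of_nat (tensor.dim ?V) = (\<Sum>w\<in>?W. klyachko om (wvec w) w)"
  proof (rule trace_eq_dim[OF fin])
    show "?V \<subseteq> {f. \<forall>w. f w \<noteq> 0 \<longrightarrow> w \<in> ?W}" unfolding V by auto
    show "klyachko om (f + g) = klyachko om f + klyachko om g" for f g
      by (rule ext) (simp add: klyachko_def distrib_left sum.distrib)
    show "klyachko om (tscale c f) = tscale c (klyachko om f)" for c f
      by (rule ext) (simp add: klyachko_def tscale_def sum_distrib_left mult_ac)
    show "klyachko om (wvec w) \<in> ?V" if w: "w \<in> ?W" for w
    proof -
      have sup: "v \<in> ?W" if nz: "klyachko om (wvec w) v \<noteq> 0" for v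
      proof -
        obtain \<pi> where \<pi>: "\<pi> \<in> perms (length v)" "wvec w (permute_list \<pi> v) \<noteq> 0"
          using nz unfolding klyachko_def by (metis (no_types, lifting) mult_zero_right sum.neutral)
        then have "permute_list \<pi> v = w" by (simp add: wvec_def split: if_splits)
        then have "mset v = mset w" using \<pi>(1) by (auto simp: perms_def)
        then show ?thesis using closed w by blast
      qed
      have "shuffle_pairing (klyachko om (wvec w)) u v = 0" if uv: "u \<noteq> []" "v \<noteq> []" for u v
      \<comment> \<open>The q-binomial argument covers total length k; in other lengths the image
        has no support.\<close>
      proof (cases "length u + length v = ?k")
        case True
        then show ?thesis by (rule klyachko_image_primitive[OF om uv])
      next
        case False
        show ?thesis
          by (rule shuffle_pairing_eq_0) (use sup len False in metis)
      qed
      moreover have "klyachko om (wvec w) [] = 0"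
        using sup[of "[]"] len[of "[]"] k by auto
      ultimately show ?thesis unfolding V primitive_def using sup by blast
    qed
    show "klyachko om f = tscale (of_nat ?k) f" if f: "f \<in> ?V" for f
    proof
      fix v
      have prim: "primitive f" and sup: "\<And>w. f w \<noteq> 0 \<Longrightarrow> w \<in> ?W" using f V by auto
      show "klyachko om f v = tscale (of_nat ?k) f v"
      proof (cases "length v = ?k")
        case True
        then show ?thesis using klyachko_primitive[of v om f] om prim by (simp add: tscale_def)
      next
        case False
        then have z: "f w = 0" if "length w = length v" for w using that sup len by metis
        then show ?thesis by (simp add: klyachko_def tscale_def)
      qed
    qed
  qed
  also have "\<dots> = of_nat ?k * of_nat (card {w \<in> ?W. list_maj super_desc w mod ?k = 1 mod ?k})"
    by (rule trace_klyachko[OF om])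
  finally have "of_nat ?k * of_nat (tensor.dim ?V) =
      (of_nat ?k * of_nat (card {w \<in> ?W. list_maj super_desc w mod ?k = 1 mod ?k}) :: complex)" .
  then have "of_nat (?k * tensor.dim ?V) =
      (of_nat (?k * card {w \<in> ?W. list_maj super_desc w mod ?k = 1 mod ?k}) :: complex)"
    by (simp only: of_nat_mult)
  then have "?k * tensor.dim ?V = ?k * card {w \<in> ?W. list_maj super_desc w mod ?k = 1 mod ?k}"
    by (simp only: of_nat_eq_iff)
  then have "tensor.dim ?V = card {w \<in> ?W. list_maj super_desc w mod ?k = 1 mod ?k} \<or> ?k = 0"
    unfolding mult_cancel1 .
  then show ?thesis
  proof (elim disjE)
    assume "?k = 0"
    then show ?thesis using k by simp
  qed (simp only: ch_def)
qed

section \<open>Horizontal strips and the local rule\<close>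

text \<open>Partitions are handled as weakly decreasing functions with finite support.\<close>
definition shapes :: "(nat \<Rightarrow> nat) set" where
  "shapes = {f. (\<forall>i. f (Suc i) \<le> f i) \<and> finite {i. f i \<noteq> 0}}"

definition shape_size :: "(nat \<Rightarrow> nat) \<Rightarrow> nat" where
  "shape_size f = (\<Sum>i\<in>{i. f i \<noteq> 0}. f i)"

definition shapes_of :: "nat \<Rightarrow> (nat \<Rightarrow> nat) set" where
  "shapes_of s = {f \<in> shapes. shape_size f = s}"

text \<open>\<open>strip f g\<close>: the skew shape g/f is a horizontal strip.\<close>
definition strip :: "(nat \<Rightarrow> nat) \<Rightarrow> (nat \<Rightarrow> nat) \<Rightarrow> bool" where
  "strip f g \<longleftrightarrow> (\<forall>i. f i \<le> g i \<and> g (Suc i) \<le> f i)"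

lemma shape_size_eq:
  assumes fin: "finite A" and z: "\<And>i. i \<notin> A \<Longrightarrow> f i = 0"
  shows "shape_size f = (\<Sum>i\<in>A. f i)"
  unfolding shape_size_def
proof (rule sum.mono_neutral_left[OF fin])
  show "{i. f i \<noteq> 0} \<subseteq> A"
  proof
    fix i assume "i \<in> {i. f i \<noteq> 0}"
    then show "i \<in> A" using z[of i] by (cases "i \<in> A") simp_all
  qed
qed simp

lemma shapes_bound:
  assumes "f \<in> shapes"
  obtains n where "\<And>i. i \<ge> n \<Longrightarrow> f i = 0"
proof -
  have "finite {i. f i \<noteq> 0}" using assms by (simp add: shapes_def)
  then obtain n where "{i. f i \<noteq> 0} \<subseteq> {..<n}" by (meson finite_nat_iff_bounded)
  then show thesis using that[of n] by (metis (mono_tags, lifting) lessThan_iff mem_Collect_eq not_le subsetD)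
qed

lemma shapes_antimono: "f \<in> shapes \<Longrightarrow> i \<le> j \<Longrightarrow> f j \<le> f i"
  by (rule lift_Suc_antimono_le[of f]) (auto simp: shapes_def)

lemma strip_shapes_left:
  assumes "g \<in> shapes" "strip f g"
  shows "f \<in> shapes"
proof -
  have "finite {i. f i \<noteq> 0}"
  proof (rule finite_subset)
    show "{i. f i \<noteq> 0} \<subseteq> {i. g i \<noteq> 0}"
    proof
      fix i assume "i \<in> {i. f i \<noteq> 0}"
      moreover have "f i \<le> g i" using assms(2) by (simp add: strip_def)
      ultimately show "i \<in> {i. g i \<noteq> 0}" by simp
    qed
    show "finite {i. g i \<noteq> 0}" using assms(1) by (simp add: shapes_def)
  qed
  moreover have "f (Suc i) \<le> f i" for i using assms(2) unfolding strip_def by (meson order_trans)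
  ultimately show ?thesis by (simp add: shapes_def)
qed

lemma strip_shapes_right:
  assumes "f \<in> shapes" "strip f g"
  shows "g \<in> shapes"
proof -
  obtain n where n: "\<And>i. i \<ge> n \<Longrightarrow> f i = 0" using shapes_bound[OF assms(1)] by blast
  have "g i = 0" if "i \<ge> Suc n" for i
    using that n[of "i - 1"] assms(2) unfolding strip_def
    by (metis Suc_le_D Suc_le_mono diff_Suc_1 le_zero_eq)
  have "{i. g i \<noteq> 0} \<subseteq> {..<Suc n}"
  proof
    fix i assume "i \<in> {i. g i \<noteq> 0}"
    then have "\<not> Suc n \<le> i" using \<open>\<And>i. Suc n \<le> i \<Longrightarrow> g i = 0\<close>[of i] by auto
    then show "i \<in> {..<Suc n}" by simp
  qed
  then have "finite {i. g i \<noteq> 0}" using finite_subset by blast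
  moreover have "g (Suc i) \<le> g i" for i using assms(2) unfolding strip_def by (meson order_trans)
  ultimately show ?thesis by (simp add: shapes_def)
qed

lemma strip_size: "g \<in> shapes \<Longrightarrow> strip f g \<Longrightarrow> shape_size f \<le> shape_size g"
proof -
  assume a: "g \<in> shapes" "strip f g"
  obtain n where n: "\<And>i. i \<ge> n \<Longrightarrow> g i = 0" using shapes_bound[OF a(1)] by blast
  have le: "f i \<le> g i" for i using a(2) by (simp add: strip_def)
  have fz: "f i = 0" if "i \<ge> n" for i using n[OF that] le[of i] by simp
  show ?thesis
    using shape_size_eq[of "{..<n}" f] shape_size_eq[of "{..<n}" g] n fz le by (simp add: sum_mono)
qed

lemma shape_size_0: "f \<in> shapes \<Longrightarrow> shape_size f = 0 \<longleftrightarrow> f = (\<lambda>_. 0)"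
proof -
  assume "f \<in> shapes"
  then have fin: "finite {i. f i \<noteq> 0}" by (simp add: shapes_def)
  have "shape_size f = 0 \<longleftrightarrow> (\<forall>i\<in>{i. f i \<noteq> 0}. f i = 0)"
    unfolding shape_size_def by (rule sum_eq_0_iff[OF fin])
  then show ?thesis by (simp add: fun_eq_iff)
qed

lemma shapes_of_vanish:
  assumes "f \<in> shapes_of s" "i \<ge> s"
  shows "f i = 0"
proof (rule ccontr)
  assume nz: "f i \<noteq> 0"
  have f: "f \<in> shapes" "shape_size f = s" using assms(1) by (auto simp: shapes_of_def)
  obtain n where n: "\<And>i. i \<ge> n \<Longrightarrow> f i = 0" using shapes_bound[OF f(1)] by blast
  have "1 \<le> f j" if "j \<in> {..i}" for j using shapes_antimono[OF f(1), of j i] that nz by simp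
  then have "(\<Sum>j\<in>{..i}. 1) \<le> (\<Sum>j\<in>{..i}. f j)" by (rule sum_mono)
  also have "\<dots> \<le> (\<Sum>j\<in>{..<n}. f j)"
  proof (rule sum_mono2)
    have "i < n" using n[of i] nz by (meson not_le)
    then show "{..i} \<subseteq> {..<n}" by auto
  qed auto
  also have "\<dots> = s" using shape_size_eq[of "{..<n}" f] n f(2) by simp
  finally show False using assms(2) by simp
qed

lemma shape_entry_le: "f \<in> shapes \<Longrightarrow> f i \<le> shape_size f"
proof (cases "f i = 0")
  case False
  assume "f \<in> shapes"
  then have "finite {i. f i \<noteq> 0}" by (simp add: shapes_def)
  then show ?thesis unfolding shape_size_def using False by (intro member_le_sum) auto
qed simp

lemma finite_bounded_functions: "finite {f :: nat \<Rightarrow> nat. (\<forall>i. f i \<le> b) \<and> (\<forall>i\<ge>n. f i = 0)}"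
proof -
  have "finite {f. \<forall>x. (x \<in> {..<n} \<longrightarrow> f x \<in> {..b}) \<and> (x \<notin> {..<n} \<longrightarrow> f x = (0::nat))}"
    by (rule finite_set_of_finite_funs) auto
  then show ?thesis by (rule rev_finite_subset) auto
qed

lemma finite_shapes_of: "finite (shapes_of s)"
proof (rule finite_subset[OF _ finite_bounded_functions[of s s]], rule subsetI)
  fix f assume f: "f \<in> shapes_of s"
  then have "\<forall>i. f i \<le> s" using shape_entry_le[of f] by (auto simp: shapes_of_def)
  then show "f \<in> {f. (\<forall>i. f i \<le> s) \<and> (\<forall>i\<ge>s. f i = 0)}"
    using shapes_of_vanish[OF f] by simp
qed

lemma finite_strip_below:
  assumes "g \<in> shapes"
  shows "finite {f. strip f g \<and> P f}"
proof -
  obtain n where n: "\<And>i. i \<ge> n \<Longrightarrow> g i = 0" using shapes_bound[OF assms] by blast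
  have "{f. strip f g \<and> P f} \<subseteq> {f. (\<forall>i. f i \<le> shape_size g) \<and> (\<forall>i\<ge>n. f i = 0)}"
  proof
    fix f assume "f \<in> {f. strip f g \<and> P f}"
    then have le: "f i \<le> g i" for i by (simp add: strip_def)
    have "f i = 0" if "i \<ge> n" for i using le[of i] n[OF that] by simp
    moreover have "f i \<le> shape_size g" for i using le[of i] shape_entry_le[OF assms, of i] by simp
    ultimately show "f \<in> {f. (\<forall>i. f i \<le> shape_size g) \<and> (\<forall>i\<ge>n. f i = 0)}" by simp
  qed
  then show ?thesis using finite_bounded_functions finite_subset by blast
qed

text \<open>The local rule of Fomin growth diagrams: reflecting every inner row in the interval that the
  neighbouring shapes allow exchanges upper and lower corners, while the surplus of the first row
  becomes an additional integer.\<close>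
definition reflect :: "(nat \<Rightarrow> nat) \<Rightarrow> (nat \<Rightarrow> nat) \<Rightarrow> (nat \<Rightarrow> nat) \<Rightarrow> nat \<Rightarrow> nat" where
  "reflect f g h i = max (f (Suc i)) (g (Suc i)) + min (f i) (g i) - h (Suc i)"

text \<open>Row i of the lower shape corresponds to row i + 1 of the upper one. Row 0 of the upper
  shape has no partner and carries the integer j.\<close>

definition unreflect :: "(nat \<Rightarrow> nat) \<Rightarrow> (nat \<Rightarrow> nat) \<Rightarrow> nat \<Rightarrow> (nat \<Rightarrow> nat) \<Rightarrow> nat \<Rightarrow> nat" where
  "unreflect f g j e i = (case i of 0 \<Rightarrow> max (f 0) (g 0) + j
     | Suc i \<Rightarrow> max (f (Suc i)) (g (Suc i)) + min (f i) (g i) - e i)"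

text \<open>Summed over the rows, maxima and minima recombine to f + g; the index shift leaves
  exactly the surplus of the first row.\<close>

lemma reflect_size:
  assumes f: "f \<in> shapes" and g: "g \<in> shapes" and h: "strip f h" "strip g h"
  shows "shape_size (reflect f g h) + shape_size h = shape_size f + shape_size g + (h 0 - max (f 0) (g 0))"
proof -
  obtain n1 where n1: "\<And>i. i \<ge> n1 \<Longrightarrow> f i = 0" using shapes_bound[OF f] by blast
  obtain n2 where n2: "\<And>i. i \<ge> n2 \<Longrightarrow> g i = 0" using shapes_bound[OF g] by blast
  obtain n3 where n3: "\<And>i. i \<ge> n3 \<Longrightarrow> h i = 0" using shapes_bound[OF strip_shapes_right[OF f h(1)]] by blast
  define n where "n = max n1 (max n2 n3)"
  have z: "f i = 0" "g i = 0" "h i = 0" if "i \<ge> n" for i using that n1 n2 n3 by (auto simp: n_def)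
  have sz: "shape_size f = (\<Sum>i<n. f i)" "shape_size g = (\<Sum>i<n. g i)" "shape_size h = (\<Sum>i<n. h i)"
    by (rule shape_size_eq; use z in \<open>simp add: not_less\<close>)+
  have szr: "shape_size (reflect f g h) = (\<Sum>i<n. reflect f g h i)"
    by (rule shape_size_eq) (use z in \<open>simp_all add: not_less reflect_def\<close>)
  have le: "h (Suc i) \<le> min (f i) (g i)" for i using h by (simp add: strip_def)
  have shift: "(\<Sum>i<n. a (Suc i)) + a 0 = (\<Sum>i<n. a i)" if "a n = 0" for a :: "nat \<Rightarrow> nat"
    using sum.lessThan_Suc_shift[of a n] that by simp
  have "(\<Sum>i<n. reflect f g h i) + (\<Sum>i<n. h (Suc i)) = (\<Sum>i<n. reflect f g h i + h (Suc i))"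
    by (rule sum.distrib[symmetric])
  also have "\<dots> = (\<Sum>i<n. max (f (Suc i)) (g (Suc i)) + min (f i) (g i))"
    by (rule sum.cong[OF refl]) (use le in \<open>simp add: reflect_def trans_le_add2\<close>)
  finally have 1: "(\<Sum>i<n. reflect f g h i) + (\<Sum>i<n. h (Suc i)) =
      (\<Sum>i<n. max (f (Suc i)) (g (Suc i))) + (\<Sum>i<n. min (f i) (g i))"
    by (simp add: sum.distrib)
  have 2: "(\<Sum>i<n. h (Suc i)) + h 0 = (\<Sum>i<n. h i)" by (rule shift) (simp add: z)
  have 3: "(\<Sum>i<n. max (f (Suc i)) (g (Suc i))) + max (f 0) (g 0) = (\<Sum>i<n. max (f i) (g i))"
    by (rule shift[of "\<lambda>i. max (f i) (g i)"]) (simp add: z)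
  have 4: "(\<Sum>i<n. max (f i) (g i)) + (\<Sum>i<n. min (f i) (g i)) = (\<Sum>i<n. f i) + (\<Sum>i<n. g i)"
    unfolding sum.distrib[symmetric] by (rule sum.cong) (auto simp: max_def min_def)
  have "max (f 0) (g 0) \<le> h 0" using h by (simp add: strip_def)
  then show ?thesis unfolding sz szr using 1 2 3 4 by linarith
qed

lemma strip_reflect:
  assumes "strip f h" "strip g h"
  shows "strip (reflect f g h) f" "strip (reflect f g h) g"
proof -
  have b: "max (f (Suc i)) (g (Suc i)) \<le> h (Suc i)" "h (Suc i) \<le> min (f i) (g i)" for i
    using assms by (auto simp: strip_def)
  have "reflect f g h i \<le> min (f i) (g i)" "max (f (Suc i)) (g (Suc i)) \<le> reflect f g h i" for i
    unfolding reflect_def using b[of i] by linarith+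
  then show "strip (reflect f g h) f" "strip (reflect f g h) g"
    unfolding strip_def by (meson max.bounded_iff min.bounded_iff)+
qed

lemma strip_unreflect:
  assumes "strip e f" "strip e g"
  shows "strip f (unreflect f g j e)" "strip g (unreflect f g j e)"
proof -
  have b: "max (f (Suc i)) (g (Suc i)) \<le> e i" "e i \<le> min (f i) (g i)" for i
    using assms by (auto simp: strip_def)
  have s: "unreflect f g j e (Suc i) \<le> min (f i) (g i)" "max (f (Suc i)) (g (Suc i)) \<le> unreflect f g j e (Suc i)" for i
    unfolding unreflect_def using b[of i] by auto
  have z: "max (f 0) (g 0) \<le> unreflect f g j e 0" by (simp add: unreflect_def)
  have "max (f i) (g i) \<le> unreflect f g j e i" for i using s(2) z by (cases i) auto
  then show "strip f (unreflect f g j e)" "strip g (unreflect f g j e)"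
    unfolding strip_def using s(1) by (meson max.bounded_iff min.bounded_iff)+
qed

lemma unreflect_reflect:
  assumes "strip f h" "strip g h"
  shows "unreflect f g (h 0 - max (f 0) (g 0)) (reflect f g h) = h"
proof
  fix i
  have b: "max (f i) (g i) \<le> h i" "h (Suc i) \<le> min (f i) (g i)" for i
    using assms by (auto simp: strip_def)
  show "unreflect f g (h 0 - max (f 0) (g 0)) (reflect f g h) i = h i"
  proof (cases i)
    case 0
    then show ?thesis using b(1)[of 0] by (simp add: unreflect_def)
  next
    case (Suc l)
    have "h (Suc l) \<le> max (f (Suc l)) (g (Suc l)) + min (f l) (g l)" using b(2)[of l] by linarith
    then show ?thesis using Suc by (simp add: unreflect_def reflect_def)
  qed
qed

lemma reflect_unreflect:
  assumes "strip e f" "strip e g"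
  shows "reflect f g (unreflect f g j e) = e"
proof
  fix i
  have b: "max (f (Suc i)) (g (Suc i)) \<le> e i" "e i \<le> min (f i) (g i)" for i
    using assms by (auto simp: strip_def)
  show "reflect f g (unreflect f g j e) i = e i"
  proof -
    have "e i \<le> max (f (Suc i)) (g (Suc i)) + min (f i) (g i)" using b(2)[of i] by linarith
    then show ?thesis by (simp add: unreflect_def reflect_def)
  qed
qed

text \<open>The commutation relation between adding and removing horizontal strips. The index j is
  the surplus of the first row and is missing from both strips on the lower side.\<close>

theorem local_rule:
  assumes f: "f \<in> shapes" and g: "g \<in> shapes"
  shows "card {h. strip f h \<and> strip g h \<and> shape_size h = shape_size f + a \<and> shape_size h = shape_size g + b} =
    (\<Sum>j\<le>min a b. card {e. strip e f \<and> strip e g \<and> shape_size e + (b - j) = shape_size f \<and> shape_size e + (a - j) = shape_size g})"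
proof -
  let ?U = "{h. strip f h \<and> strip g h \<and> shape_size h = shape_size f + a \<and> shape_size h = shape_size g + b}"
  let ?L = "\<lambda>j. {e. strip e f \<and> strip e g \<and> shape_size e + (b - j) = shape_size f \<and> shape_size e + (a - j) = shape_size g}"
  have "bij_betw (\<lambda>h. (h 0 - max (f 0) (g 0), reflect f g h)) ?U (Sigma {..min a b} ?L)"
  proof (rule bij_betw_byWitness[where f' = "\<lambda>(j, e). unreflect f g j e"])
    show "\<forall>h\<in>?U. (case (h 0 - max (f 0) (g 0), reflect f g h) of (j, e) \<Rightarrow> unreflect f g j e) = h"
      using unreflect_reflect by auto
    show "\<forall>x\<in>Sigma {..min a b} ?L. ((case x of (j, e) \<Rightarrow> unreflect f g j e) 0 - max (f 0) (g 0),
        reflect f g (case x of (j, e) \<Rightarrow> unreflect f g j e)) = x"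
      using reflect_unreflect by (auto simp: unreflect_def)
    show "(\<lambda>h. (h 0 - max (f 0) (g 0), reflect f g h)) ` ?U \<subseteq> Sigma {..min a b} ?L"
    proof
      fix x assume "x \<in> (\<lambda>h. (h 0 - max (f 0) (g 0), reflect f g h)) ` ?U"
      then obtain h where h: "strip f h" "strip g h" "shape_size h = shape_size f + a" "shape_size h = shape_size g + b"
        and x: "x = (h 0 - max (f 0) (g 0), reflect f g h)" by auto
      note r = strip_reflect[OF h(1,2)]
      have "shape_size (reflect f g h) \<le> shape_size f" "shape_size (reflect f g h) \<le> shape_size g"
        using strip_size[OF f r(1)] strip_size[OF g r(2)] by auto
      then show "x \<in> Sigma {..min a b} ?L"
        using reflect_size[OF f g h(1,2)] h(3,4) r unfolding x by auto
    qed
    show "(\<lambda>(j, e). unreflect f g j e) ` Sigma {..min a b} ?L \<subseteq> ?U"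
    proof
      fix h assume "h \<in> (\<lambda>(j, e). unreflect f g j e) ` Sigma {..min a b} ?L"
      then obtain j e where e: "j \<le> a" "j \<le> b" "strip e f" "strip e g" "shape_size e + (b - j) = shape_size f"
          "shape_size e + (a - j) = shape_size g" and h: "h = unreflect f g j e" by auto
      note r = strip_unreflect[OF e(3,4), of j]
      have "h 0 - max (f 0) (g 0) = j" by (simp add: h unreflect_def)
      then have "shape_size e + shape_size h = shape_size f + shape_size g + j"
        using reflect_size[OF f g r] reflect_unreflect[OF e(3,4), of j] h by simp
      then show "h \<in> ?U" using e r h by auto
    qed
  qed
  then have "card ?U = card (Sigma {..min a b} ?L)" by (rule bij_betw_same_card)
  also have "\<dots> = (\<Sum>j\<le>min a b. card (?L j))"
    using finite_strip_below[OF f] by (intro card_SigmaI) auto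
  finally show ?thesis .
qed

text \<open>Gelfand--Tsetlin patterns, recorded as chains of horizontal strips.\<close>
fun gt_count :: "nat \<Rightarrow> (nat \<Rightarrow> nat) \<Rightarrow> (nat \<Rightarrow> nat) \<Rightarrow> nat" where
  "gt_count 0 mu f = (if f = (\<lambda>_. 0) then 1 else 0)"
| "gt_count (Suc N) mu f = (\<Sum>e\<in>{e. strip e f \<and> shape_size e + mu N = shape_size f}. gt_count N mu e)"

lemma gt_count_cong: "(\<And>i. i < N \<Longrightarrow> mu i = mu' i) \<Longrightarrow> gt_count N mu f = gt_count N mu' f"
  by (induction N arbitrary: f) (auto intro!: sum.cong)

definition submultisets :: "nat \<Rightarrow> nat \<Rightarrow> nat multiset \<Rightarrow> nat multiset set" where
  "submultisets N a M = {A. A \<subseteq># M \<and> size A = a \<and> set_mset A \<subseteq> {..<N}}"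

lemma finite_submultisets: "finite (submultisets N a M)"
proof -
  have "submultisets N a M \<subseteq> mset ` {xs. set xs \<subseteq> set_mset M \<and> length xs = a}"
  proof
    fix A assume "A \<in> submultisets N a M"
    then have A: "A \<subseteq># M" "size A = a" by (auto simp: submultisets_def)
    obtain xs where "mset xs = A" using ex_mset by blast
    then show "A \<in> mset ` {xs. set xs \<subseteq> set_mset M \<and> length xs = a}"
      using A set_mset_mono[OF A(1)] by auto
  qed
  moreover have "finite (mset ` {xs. set xs \<subseteq> set_mset M \<and> length xs = a})"
    by (rule finite_imageI, rule finite_lists_length_eq) simp
  ultimately show ?thesis by (rule finite_subset)
qed

lemma sum_submultisets_Suc:
  fixes F :: "nat multiset \<Rightarrow> nat"
  shows "(\<Sum>A\<in>submultisets (Suc N) a M. F A) =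
     (\<Sum>j\<le>min a (count M N). \<Sum>A\<in>submultisets N (a - j) M. F (A + replicate_mset j N))"
proof -
  have "(\<Sum>j\<le>min a (count M N). \<Sum>A\<in>submultisets N (a - j) M. F (A + replicate_mset j N)) =
     (\<Sum>(j, A)\<in>Sigma {..min a (count M N)} (\<lambda>j. submultisets N (a - j) M). F (A + replicate_mset j N))"
    by (rule sum.Sigma) (auto simp: finite_submultisets)
  also have "\<dots> = (\<Sum>A\<in>submultisets (Suc N) a M. F A)"
  proof (rule sum.reindex_bij_witness[of _ "\<lambda>A. (count A N, filter_mset (\<lambda>i. i \<noteq> N) A)" "\<lambda>(j, A). A + replicate_mset j N"])
    fix x assume "x \<in> Sigma {..min a (count M N)} (\<lambda>j. submultisets N (a - j) M)"
    then obtain j A where x: "x = (j, A)" "j \<le> a" "j \<le> count M N" "A \<subseteq># M" "size A = a - j" "set_mset A \<subseteq> {..<N}"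
      by (auto simp: submultisets_def)
    have NA: "count A N = 0" using x(6) by (auto simp: count_eq_zero_iff)
    have "filter_mset (\<lambda>i. i \<noteq> N) (A + replicate_mset j N) = A"
      by (rule multiset_eqI) (auto simp: NA)
    then show "(count (case x of (j, A) \<Rightarrow> A + replicate_mset j N) N,
        filter_mset (\<lambda>i. i \<noteq> N) (case x of (j, A) \<Rightarrow> A + replicate_mset j N)) = x"
      using x NA by simp
    have "A + replicate_mset j N \<subseteq># M"
      unfolding subseteq_mset_def
    proof
      fix i show "count (A + replicate_mset j N) i \<le> count M i"
        using x(3) NA mset_subset_eq_count[OF x(4), of i] by auto
    qed
    then show "(case x of (j, A) \<Rightarrow> A + replicate_mset j N) \<in> submultisets (Suc N) a M"
      using x by (auto simp: submultisets_def less_Suc_eq)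
    show "F (case x of (j, A) \<Rightarrow> A + replicate_mset j N) = (case x of (j, A) \<Rightarrow> F (A + replicate_mset j N))"
      using x by simp
  next
    fix A assume A: "A \<in> submultisets (Suc N) a M"
    let ?B = "filter_mset (\<lambda>i. i \<noteq> N) A"
    have dec: "A = ?B + replicate_mset (count A N) N" by (rule multiset_eqI) simp
    then show "(case (count A N, ?B) of (j, A) \<Rightarrow> A + replicate_mset j N) = A" by simp
    have "size A = size ?B + count A N" using arg_cong[OF dec, of size] by simp
    moreover have "count A N \<le> count M N" "?B \<subseteq># M"
      using A by (auto simp: submultisets_def mset_subset_eq_count intro: subset_mset.order_trans[OF multiset_filter_subset])
    moreover have "set_mset ?B \<subseteq> {..<N}" using A by (auto simp: submultisets_def less_Suc_eq)
    ultimately show "(count A N, ?B) \<in> Sigma {..min a (count M N)} (\<lambda>j. submultisets N (a - j) M)"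
      using A by (auto simp: submultisets_def)
  qed
  finally show ?thesis ..
qed

lemma sum_if_const: "finite H \<Longrightarrow> (\<Sum>h\<in>H. if P h then c else 0) = card {h\<in>H. P h} * (c :: nat)"
  by (simp add: sum.inter_filter[symmetric])

text \<open>Moving a removal operator through the strips that build the shape.\<close>
theorem sum_strips_above:
  assumes "e \<in> shapes"
  shows "(\<Sum>h\<in>{h. strip e h \<and> shape_size h = shape_size e + a}. gt_count N (count M) h) =
     (\<Sum>A\<in>submultisets N a M. gt_count N (count (M - A)) e)"
  using assms
proof (induction N arbitrary: a e)
  case 0
  let ?H = "{h. strip e h \<and> shape_size h = shape_size e + a}"
  have sub: "submultisets 0 a M = (if a = 0 then {{#}} else {})" by (auto simp: submultisets_def)
  have fin: "finite ?H"
    by (rule finite_subset[OF _ finite_shapes_of[of "shape_size e + a"]])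
       (use strip_shapes_right[OF 0] in \<open>auto simp: shapes_of_def\<close>)
  have z: "(\<lambda>_. 0) \<in> shapes" "shape_size (\<lambda>_. 0) = 0" by (auto simp: shapes_def shape_size_def)
  have int: "?H \<inter> {\<lambda>_. 0} = (if a = 0 \<and> e = (\<lambda>_. 0) then {\<lambda>_. 0} else {})"
    using shape_size_0[OF 0] z by (auto simp: strip_def)
  have "(\<Sum>h\<in>?H. gt_count 0 (count M) h) = (\<Sum>h\<in>?H \<inter> {\<lambda>_. 0}. 1)"
    unfolding sum.inter_restrict[OF fin] by (rule sum.cong) auto
  also have "\<dots> = (if a = 0 \<and> e = (\<lambda>_. 0) then 1 else 0)" unfolding int by simp
  also have "\<dots> = (\<Sum>A\<in>submultisets 0 a M. gt_count 0 (count (M - A)) e)" unfolding sub by simp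
  finally show ?case .
next
  case (Suc N)
  let ?b = "count M N"
  let ?H = "{h. strip e h \<and> shape_size h = shape_size e + a}"
  let ?F = "\<lambda>h. {f. strip f h \<and> shape_size f + ?b = shape_size h}"
  \<comment> \<open>All intermediate shapes f have this size, so the sums range over one finite set
    and can be exchanged.\<close>
  let ?s = "shape_size e + a - ?b"
  have finH: "finite ?H"
    by (rule finite_subset[OF _ finite_shapes_of[of "shape_size e + a"]])
       (use strip_shapes_right[OF Suc.prems] in \<open>auto simp: shapes_of_def\<close>)
  have Hsh: "h \<in> shapes" if "h \<in> ?H" for h using strip_shapes_right[OF Suc.prems] that by auto
  have finF: "finite (?F h)" if "h \<in> ?H" for h by (rule finite_strip_below[OF Hsh[OF that]])
  let ?P = "shapes_of ?s"
  have Fsub: "?F h \<subseteq> ?P" if "h \<in> ?H" for h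
    using strip_shapes_left[OF Hsh[OF that]] that by (auto simp: shapes_of_def)
  have "(\<Sum>h\<in>?H. gt_count (Suc N) (count M) h) = (\<Sum>h\<in>?H. \<Sum>f\<in>?P. if f \<in> ?F h then gt_count N (count M) f else 0)"
  proof (rule sum.cong[OF refl])
    fix h assume h: "h \<in> ?H"
    have "(\<Sum>f\<in>?P. if f \<in> ?F h then gt_count N (count M) f else 0) = (\<Sum>f\<in>?P \<inter> ?F h. gt_count N (count M) f)"
      by (rule sum.inter_restrict[OF finite_shapes_of, symmetric])
    also have "?P \<inter> ?F h = ?F h" using Fsub[OF h] by blast
    finally show "gt_count (Suc N) (count M) h = (\<Sum>f\<in>?P. if f \<in> ?F h then gt_count N (count M) f else 0)" by simp
  qed
  also have "\<dots> = (\<Sum>f\<in>?P. \<Sum>h\<in>?H. if f \<in> ?F h then gt_count N (count M) f else 0)" by (rule sum.swap)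
  also have "\<dots> = (\<Sum>f\<in>?P. \<Sum>j\<le>min a ?b.
      card {x. strip x e \<and> strip x f \<and> shape_size x + (?b - j) = shape_size e \<and> shape_size x + (a - j) = shape_size f}
       * gt_count N (count M) f)"
  proof (rule sum.cong[OF refl])
    fix f assume "f \<in> ?P"
    then have f: "f \<in> shapes" by (simp add: shapes_of_def)
    have "(\<Sum>h\<in>?H. if f \<in> ?F h then gt_count N (count M) f else 0) = card {h\<in>?H. f \<in> ?F h} * gt_count N (count M) f"
      by (rule sum_if_const[OF finH])
    also have "{h\<in>?H. f \<in> ?F h} = {h. strip e h \<and> strip f h \<and> shape_size h = shape_size e + a \<and> shape_size h = shape_size f + ?b}"
      by auto
    also have "card \<dots> = (\<Sum>j\<le>min a ?b.
      card {x. strip x e \<and> strip x f \<and> shape_size x + (?b - j) = shape_size e \<and> shape_size x + (a - j) = shape_size f})"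
      by (rule local_rule[OF Suc.prems f])
    finally show "(\<Sum>h\<in>?H. if f \<in> ?F h then gt_count N (count M) f else 0) = (\<Sum>j\<le>min a ?b.
      card {x. strip x e \<and> strip x f \<and> shape_size x + (?b - j) = shape_size e \<and> shape_size x + (a - j) = shape_size f}
       * gt_count N (count M) f)" by (simp add: sum_distrib_right)
  qed
  also have "\<dots> = (\<Sum>j\<le>min a ?b. \<Sum>f\<in>?P.
      card {x. strip x e \<and> strip x f \<and> shape_size x + (?b - j) = shape_size e \<and> shape_size x + (a - j) = shape_size f}
       * gt_count N (count M) f)" by (rule sum.swap)
  \<comment> \<open>The lower corner x comes first now: a strip is removed from e, and only then is
    one added. The inner sum over f has the form of the induction hypothesis.\<close>
  also have "\<dots> = (\<Sum>j\<le>min a ?b. \<Sum>x\<in>{x. strip x e \<and> shape_size x + (?b - j) = shape_size e}.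
      \<Sum>f\<in>{f. strip x f \<and> shape_size f = shape_size x + (a - j)}. gt_count N (count M) f)"
  proof (rule sum.cong[OF refl])
    fix j assume j: "j \<in> {..min a ?b}"
    let ?X = "{x. strip x e \<and> shape_size x + (?b - j) = shape_size e}"
    have finX: "finite ?X" by (rule finite_strip_below[OF Suc.prems])
    have "(\<Sum>f\<in>?P. card {x. strip x e \<and> strip x f \<and> shape_size x + (?b - j) = shape_size e \<and> shape_size x + (a - j) = shape_size f}
       * gt_count N (count M) f) =
      (\<Sum>f\<in>?P. \<Sum>x\<in>?X. if strip x f \<and> shape_size f = shape_size x + (a - j) then gt_count N (count M) f else 0)"
    proof (rule sum.cong[OF refl])
      fix f assume "f \<in> ?P"
      have "{x. strip x e \<and> strip x f \<and> shape_size x + (?b - j) = shape_size e \<and> shape_size x + (a - j) = shape_size f} =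
          {x\<in>?X. strip x f \<and> shape_size f = shape_size x + (a - j)}" by auto
      then show "card {x. strip x e \<and> strip x f \<and> shape_size x + (?b - j) = shape_size e \<and> shape_size x + (a - j) = shape_size f}
       * gt_count N (count M) f = (\<Sum>x\<in>?X. if strip x f \<and> shape_size f = shape_size x + (a - j) then gt_count N (count M) f else 0)"
        by (simp only: sum_if_const[OF finX])
    qed
    also have "\<dots> = (\<Sum>x\<in>?X. \<Sum>f\<in>?P. if strip x f \<and> shape_size f = shape_size x + (a - j) then gt_count N (count M) f else 0)"
      by (rule sum.swap)
    also have "\<dots> = (\<Sum>x\<in>?X. \<Sum>f\<in>{f. strip x f \<and> shape_size f = shape_size x + (a - j)}. gt_count N (count M) f)"
    proof (rule sum.cong[OF refl])
      fix x assume x: "x \<in> ?X"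
      then have xs: "x \<in> shapes" using strip_shapes_left[OF Suc.prems] by auto
      have "{f\<in>?P. strip x f \<and> shape_size f = shape_size x + (a - j)} = {f. strip x f \<and> shape_size f = shape_size x + (a - j)}"
        using strip_shapes_right[OF xs] x j by (auto simp: shapes_of_def)
      then show "(\<Sum>f\<in>?P. if strip x f \<and> shape_size f = shape_size x + (a - j) then gt_count N (count M) f else 0) =
         (\<Sum>f\<in>{f. strip x f \<and> shape_size f = shape_size x + (a - j)}. gt_count N (count M) f)"
        by (simp add: sum.inter_filter[OF finite_shapes_of, symmetric])
    qed
    finally show "(\<Sum>f\<in>?P. card {x. strip x e \<and> strip x f \<and> shape_size x + (?b - j) = shape_size e \<and> shape_size x + (a - j) = shape_size f}
       * gt_count N (count M) f) = (\<Sum>x\<in>?X. \<Sum>f\<in>{f. strip x f \<and> shape_size f = shape_size x + (a - j)}. gt_count N (count M) f)" .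
  qed
  also have "\<dots> = (\<Sum>j\<le>min a ?b. \<Sum>x\<in>{x. strip x e \<and> shape_size x + (?b - j) = shape_size e}.
      \<Sum>A\<in>submultisets N (a - j) M. gt_count N (count (M - A)) x)"
    by (intro sum.cong refl Suc.IH) (use strip_shapes_left[OF Suc.prems] in auto)
  \<comment> \<open>The j boxes lost in the local rule become j copies of the letter N in the chosen
    sub-multiset, which is why the last strip shrinks to \<open>?b - j\<close>.\<close>
  also have "\<dots> = (\<Sum>j\<le>min a ?b. \<Sum>A\<in>submultisets N (a - j) M.
      gt_count (Suc N) (count (M - (A + replicate_mset j N))) e)"
  proof (rule sum.cong[OF refl])
    fix j assume "j \<in> {..min a ?b}"
    have "gt_count (Suc N) (count (M - (A + replicate_mset j N))) e =
       (\<Sum>x\<in>{x. strip x e \<and> shape_size x + (?b - j) = shape_size e}. gt_count N (count (M - A)) x)"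
      if A: "A \<in> submultisets N (a - j) M" for A
    proof -
      have "count A N = 0" using A by (auto simp: submultisets_def count_eq_zero_iff)
      then have "count (M - (A + replicate_mset j N)) N = ?b - j" by simp
      moreover have "gt_count N (count (M - (A + replicate_mset j N))) x = gt_count N (count (M - A)) x" for x
        by (rule gt_count_cong) simp
      ultimately show ?thesis by simp
    qed
    then have "(\<Sum>A\<in>submultisets N (a - j) M. gt_count (Suc N) (count (M - (A + replicate_mset j N))) e) =
      (\<Sum>A\<in>submultisets N (a - j) M. \<Sum>x\<in>{x. strip x e \<and> shape_size x + (?b - j) = shape_size e}. gt_count N (count (M - A)) x)"
      by (intro sum.cong) auto
    then show "(\<Sum>x\<in>{x. strip x e \<and> shape_size x + (?b - j) = shape_size e}. \<Sum>A\<in>submultisets N (a - j) M. gt_count N (count (M - A)) x) =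
        (\<Sum>A\<in>submultisets N (a - j) M. gt_count (Suc N) (count (M - (A + replicate_mset j N))) e)"
      by (simp only: sum.swap[of _ "submultisets N (a - j) M"])
  qed
  also have "\<dots> = (\<Sum>A\<in>submultisets (Suc N) a M. gt_count (Suc N) (count (M - A)) e)"
    by (rule sum_submultisets_Suc[symmetric])
  finally show ?case .
qed

section \<open>The Cauchy identity by descents\<close>

text \<open>A Kostka number again, now indexed by a composition with its last part first. It will
  count standard tableaux by blocks, whereas \<open>gt_count\<close> counts semistandard ones by
  weight.\<close>

fun strip_count :: "nat list \<Rightarrow> (nat \<Rightarrow> nat) \<Rightarrow> nat" where
  "strip_count [] f = (if f = (\<lambda>_. 0) then 1 else 0)"
| "strip_count (r # al) f = (\<Sum>e\<in>{e. strip e f \<and> shape_size e + r = shape_size f}. strip_count al e)"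

text \<open>The block ends of a composition, which is listed with its last block first.\<close>
fun block_ends :: "nat list \<Rightarrow> nat set" where
  "block_ends [] = {}"
| "block_ends (r # al) = insert (sum_list al) (block_ends al)"

lemma block_ends_le: "i \<in> block_ends al \<Longrightarrow> i \<le> sum_list al"
  by (induction al) auto

definition word_desc :: "nat list \<Rightarrow> nat set" where
  "word_desc w = {i \<in> {1..<length w}. w ! i < w ! (i - 1)}"

definition block_words :: "nat list \<Rightarrow> nat multiset \<Rightarrow> nat list set" where
  "block_words al M = {w. mset w = M \<and> word_desc w \<subseteq> block_ends al}"

lemma finite_block_words: "finite (block_words al M)"
proof -
  have "finite {w. mset w = M}" using finite_permutations_of_multiset[of M] by (simp add: permutations_of_multiset_def)
  then show ?thesis by (rule rev_finite_subset) (auto simp: block_words_def)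
qed

text \<open>A descent at the junction is always permitted, so the two parts do not constrain each
  other. Inside b none is permitted, because E contains nothing beyond the junction.\<close>

lemma word_desc_append:
  assumes "E \<subseteq> {..length w}"
  shows "word_desc (w @ b) \<subseteq> insert (length w) E \<longleftrightarrow> word_desc w \<subseteq> E \<and> sorted b"
proof
  assume L: "word_desc (w @ b) \<subseteq> insert (length w) E"
  have "word_desc w \<subseteq> E"
  proof
    fix i assume "i \<in> word_desc w"
    then have "i \<in> word_desc (w @ b)" "i \<noteq> length w" by (auto simp: word_desc_def nth_append)
    then show "i \<in> E" using L by blast
  qed
  moreover have "sorted b"
    unfolding sorted_iff_nth_Suc
  proof (intro allI impI)
    fix i assume i: "Suc i < length b"
    have "length w + Suc i \<notin> insert (length w) E" using assms by auto
    then have "length w + Suc i \<notin> word_desc (w @ b)" using L by blast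
    then show "b ! i \<le> b ! Suc i" using i by (simp add: word_desc_def nth_append)
  qed
  ultimately show "word_desc w \<subseteq> E \<and> sorted b" ..
next
  assume R: "word_desc w \<subseteq> E \<and> sorted b"
  show "word_desc (w @ b) \<subseteq> insert (length w) E"
  proof
    fix i assume i: "i \<in> word_desc (w @ b)"
    consider "i < length w" | "i = length w" | j where "i = length w + Suc j"
      by (metis less_iff_Suc_add linorder_neqE_nat add_Suc_right)
    then show "i \<in> insert (length w) E"
    proof cases
      case 1
      then have "i \<in> word_desc w" using i by (auto simp: word_desc_def nth_append split: if_splits)
      then show ?thesis using R by blast
    next
      case 3
      then have "b ! Suc j < b ! j" "Suc j < length b" using i by (auto simp: word_desc_def nth_append)
      then have False using R unfolding sorted_iff_nth_Suc by (meson not_le)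
      then show ?thesis ..
    qed simp
  qed
qed

text \<open>The last block is increasing and hence determined by its multiset of letters.\<close>

lemma card_block_words_Cons:
  assumes sz: "size M = sum_list al + r"
  shows "card (block_words (r # al) M) = (\<Sum>A\<in>{A. A \<subseteq># M \<and> size A = r}. card (block_words al (M - A)))"
proof -
  let ?s = "sum_list al"
  let ?J = "{A. A \<subseteq># M \<and> size A = r}"
  have finJ: "finite ?J"
  proof -
    obtain N where N: "set_mset M \<subseteq> {..<N}" using finite_nat_iff_bounded[of "set_mset M"] by auto
    have "?J \<subseteq> submultisets N r M" using N set_mset_mono unfolding submultisets_def by blast
    then show ?thesis using finite_submultisets finite_subset by blast
  qed
  have sub: "block_ends al \<subseteq> {..?s}" using block_ends_le by auto
  have "bij_betw (\<lambda>(A, w). w @ sorted_list_of_multiset A) (Sigma ?J (\<lambda>A. block_words al (M - A))) (block_words (r # al) M)"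
  proof (rule bij_betw_byWitness[where f' = "\<lambda>w. (mset (drop ?s w), take ?s w)"])
    have len: "length w = ?s" if "A \<subseteq># M" "size A = r" "mset w = M - A" for A w
    proof -
      have "length w = size (M - A)" using that(3) by (metis size_mset)
      then show ?thesis using that sz by (simp add: size_Diff_submset)
    qed
    show "\<forall>x\<in>Sigma ?J (\<lambda>A. block_words al (M - A)).
        (mset (drop ?s (case x of (A, w) \<Rightarrow> w @ sorted_list_of_multiset A)),
         take ?s (case x of (A, w) \<Rightarrow> w @ sorted_list_of_multiset A)) = x"
      using len by (auto simp: block_words_def)
    show "(\<lambda>(A, w). w @ sorted_list_of_multiset A) ` Sigma ?J (\<lambda>A. block_words al (M - A)) \<subseteq> block_words (r # al) M"
    proof
      fix v assume "v \<in> (\<lambda>(A, w). w @ sorted_list_of_multiset A) ` Sigma ?J (\<lambda>A. block_words al (M - A))"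
      then obtain A w where A: "A \<subseteq># M" "size A = r" and w: "mset w = M - A" "word_desc w \<subseteq> block_ends al"
        and v: "v = w @ sorted_list_of_multiset A" by (auto simp: block_words_def)
      have lw: "length w = ?s" by (rule len[OF A w(1)])
      have "word_desc v \<subseteq> insert (length w) (block_ends al)"
        unfolding v using word_desc_append[of "block_ends al" w] sub lw w(2) by simp
      moreover have "mset v = M" using v w(1) A by simp
      ultimately show "v \<in> block_words (r # al) M" using lw by (simp add: block_words_def)
    qed
    have key: "length w = ?s + r \<and> take ?s w @ drop ?s w = w \<and> sorted (drop ?s w) \<and> word_desc (take ?s w) \<subseteq> block_ends al"
      if "w \<in> block_words (r # al) M" for w
    proof -
      have m: "mset w = M" "word_desc w \<subseteq> insert ?s (block_ends al)" using that by (auto simp: block_words_def)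
      have l: "length w = ?s + r" using m(1) sz by (metis size_mset)
      have lt: "length (take ?s w) = ?s" using l by simp
      have "word_desc (take ?s w @ drop ?s w) \<subseteq> insert (length (take ?s w)) (block_ends al)" using m(2) lt by simp
      then have "word_desc (take ?s w) \<subseteq> block_ends al \<and> sorted (drop ?s w)"
        by (subst (asm) word_desc_append) (use sub lt in auto)
      then show ?thesis using l by simp
    qed
    show "\<forall>w\<in>block_words (r # al) M. (case (mset (drop ?s w), take ?s w) of (A, w) \<Rightarrow> w @ sorted_list_of_multiset A) = w"
    proof
      fix w assume "w \<in> block_words (r # al) M"
      then show "(case (mset (drop ?s w), take ?s w) of (A, w) \<Rightarrow> w @ sorted_list_of_multiset A) = w"
        using key[of w] by (simp add: sorted_sort_id)
    qed
    show "(\<lambda>w. (mset (drop ?s w), take ?s w)) ` block_words (r # al) M \<subseteq> Sigma ?J (\<lambda>A. block_words al (M - A))"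
    proof
      fix x assume "x \<in> (\<lambda>w. (mset (drop ?s w), take ?s w)) ` block_words (r # al) M"
      then obtain w where w: "w \<in> block_words (r # al) M" "x = (mset (drop ?s w), take ?s w)" by auto
      have "mset (take ?s w) + mset (drop ?s w) = M" using w(1) by (simp add: block_words_def flip: mset_append)
      then have "mset (drop ?s w) \<subseteq># M" "M - mset (drop ?s w) = mset (take ?s w)"
        by (metis mset_subset_eq_add_right, metis add_diff_cancel_right')
      then show "x \<in> Sigma ?J (\<lambda>A. block_words al (M - A))"
        using key[OF w(1)] w(2) by (auto simp: block_words_def)
    qed
  qed
  then have "card (block_words (r # al) M) = card (Sigma ?J (\<lambda>A. block_words al (M - A)))"
    using bij_betw_same_card by fastforce
  also have "\<dots> = (\<Sum>A\<in>?J. card (block_words al (M - A)))"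
    using finJ finite_block_words by (intro card_SigmaI) auto
  finally show ?thesis .
qed

lemma zero_shape: "(\<lambda>_. 0) \<in> shapes" "shape_size (\<lambda>_. 0) = 0"
  by (auto simp: shapes_def shape_size_def)

lemma shapes_of_0: "shapes_of 0 = {\<lambda>_. 0}"
proof -
  have "f \<in> shapes_of 0 \<longleftrightarrow> f = (\<lambda>_. 0)" for f
    using shape_size_0[of f] zero_shape unfolding shapes_of_def by auto
  then show ?thesis by blast
qed

lemma gt_count_zero: "gt_count N (\<lambda>_. 0) (\<lambda>_. 0) = 1"
proof (induction N)
  case (Suc N)
  have "{e. strip e (\<lambda>_. 0) \<and> shape_size e + 0 = shape_size (\<lambda>_. 0)} = {\<lambda>_. 0}"
    using zero_shape by (auto simp: strip_def)
  then show ?case using Suc by simp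
qed simp

text \<open>The Cauchy identity, refined by descent sets, replaces the Robinson--Schensted--Knuth
  correspondence.\<close>
theorem sum_strip_count_gt_count:
  assumes "set_mset M \<subseteq> {..<N}" "size M = sum_list al"
  shows "(\<Sum>f\<in>shapes_of (sum_list al). strip_count al f * gt_count N (count M) f) = card (block_words al M)"
  using assms
proof (induction al arbitrary: M)
  case Nil
  then have "M = {#}" by simp
  have "block_words [] {#} = {[]}" by (auto simp: block_words_def word_desc_def)
  then show ?case using \<open>M = {#}\<close> gt_count_zero[of N] by (simp add: shapes_of_0)
next
  case (Cons r al)
  let ?s = "sum_list al"
  let ?G = "gt_count N (count M)"
  let ?B = "\<lambda>f. {e. strip e f \<and> shape_size e + r = shape_size f}"
  let ?A = "\<lambda>e. {f. strip e f \<and> shape_size f = shape_size e + r}"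
  have "(\<Sum>f\<in>shapes_of (sum_list (r # al)). strip_count (r # al) f * ?G f) =
     (\<Sum>f\<in>shapes_of (r + ?s). \<Sum>e\<in>?B f. strip_count al e * ?G f)"
    by (simp add: sum_distrib_right)
  also have "\<dots> = (\<Sum>(f, e)\<in>Sigma (shapes_of (r + ?s)) ?B. strip_count al e * ?G f)"
    by (rule sum.Sigma) (use finite_shapes_of finite_strip_below in \<open>auto simp: shapes_of_def\<close>)
  also have "\<dots> = (\<Sum>(e, f)\<in>Sigma (shapes_of ?s) ?A. strip_count al e * ?G f)"
    by (rule sum.reindex_bij_witness[of _ "\<lambda>(a, b). (b, a)" "\<lambda>(a, b). (b, a)"])
       (auto simp: shapes_of_def intro: strip_shapes_left strip_shapes_right)
  also have "\<dots> = (\<Sum>e\<in>shapes_of ?s. \<Sum>f\<in>?A e. strip_count al e * ?G f)"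
  proof (rule sum.Sigma[symmetric])
    show "\<forall>e\<in>shapes_of ?s. finite (?A e)"
    proof
      fix e assume "e \<in> shapes_of ?s"
      then have "?A e \<subseteq> shapes_of (shape_size e + r)"
        using strip_shapes_right by (auto simp: shapes_of_def)
      then show "finite (?A e)" using finite_shapes_of finite_subset by blast
    qed
  qed (rule finite_shapes_of)
  \<comment> \<open>The strips above e are traded for multisets of r letters of M; these become the
    last block of the word.\<close>
  also have "\<dots> = (\<Sum>e\<in>shapes_of ?s. \<Sum>A\<in>submultisets N r M. strip_count al e * gt_count N (count (M - A)) e)"
  proof (rule sum.cong[OF refl])
    fix e assume "e \<in> shapes_of ?s"
    then have "e \<in> shapes" by (simp add: shapes_of_def)
    from sum_strips_above[OF this, where a = r and N = N and M = M]
    show "(\<Sum>f\<in>?A e. strip_count al e * ?G f) = (\<Sum>A\<in>submultisets N r M. strip_count al e * gt_count N (count (M - A)) e)"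
      by (simp only: sum_distrib_left[symmetric])
  qed
  also have "\<dots> = (\<Sum>A\<in>submultisets N r M. \<Sum>e\<in>shapes_of ?s. strip_count al e * gt_count N (count (M - A)) e)"
    by (rule sum.swap)
  also have "\<dots> = (\<Sum>A\<in>submultisets N r M. card (block_words al (M - A)))"
  proof (rule sum.cong[OF refl])
    fix A assume A: "A \<in> submultisets N r M"
    have "set_mset (M - A) \<subseteq> {..<N}" using Cons.prems(1) by (meson in_diffD subset_iff)
    moreover have "size (M - A) = ?s" using A Cons.prems(2) by (simp add: submultisets_def size_Diff_submset)
    ultimately show "(\<Sum>e\<in>shapes_of ?s. strip_count al e * gt_count N (count (M - A)) e) = card (block_words al (M - A))"
      by (rule Cons.IH)
  qed
  also have "submultisets N r M = {A. A \<subseteq># M \<and> size A = r}"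
    using Cons.prems(1) set_mset_mono unfolding submultisets_def by blast
  also have "(\<Sum>A\<in>{A. A \<subseteq># M \<and> size A = r}. card (block_words al (M - A))) = card (block_words (r # al) M)"
    by (rule card_block_words_Cons[symmetric]) (use Cons.prems(2) in simp)
  finally show ?case .
qed

section \<open>Semistandard tableaux as chains of horizontal strips\<close>

definition shape_cells :: "(nat \<Rightarrow> nat) \<Rightarrow> (nat \<times> nat) set" where
  "shape_cells f = {(i, j). j < f i}"

lemma shape_cells_Sigma:
  assumes "\<And>i. i \<ge> n \<Longrightarrow> f i = 0"
  shows "shape_cells f = Sigma {..<n} (\<lambda>i. {..<f i})"
proof -
  have "i < n" if "j < f i" for i j using that assms[of i] by (metis not_le not_less_zero)
  then show ?thesis by (auto simp: shape_cells_def)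
qed

lemma finite_shape_cells: "f \<in> shapes \<Longrightarrow> finite (shape_cells f)"
  using shapes_bound[of f] shape_cells_Sigma[of _ f] by (metis finite_SigmaI finite_lessThan)

lemma card_shape_cells: "f \<in> shapes \<Longrightarrow> card (shape_cells f) = shape_size f"
proof -
  assume "f \<in> shapes"
  then obtain n where n: "\<And>i. i \<ge> n \<Longrightarrow> f i = 0" using shapes_bound by blast
  have S: "shape_cells f = Sigma {..<n} (\<lambda>i. {..<f i})" by (rule shape_cells_Sigma) (rule n)
  have "card (shape_cells f) = (\<Sum>i<n. f i)"
    unfolding S by (subst card_SigmaI) auto
  also have "\<dots> = shape_size f" by (rule shape_size_eq[symmetric]) (use n in auto)
  finally show ?thesis .
qed

lemma shape_cells_mono: "(\<And>i. e i \<le> f i) \<Longrightarrow> shape_cells e \<subseteq> shape_cells f"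
  unfolding shape_cells_def by (auto intro: less_le_trans)

text \<open>Row lengths of the part with entries below N; when the rows increase weakly, the cells
  counted form an initial segment of each row.\<close>

definition low_shape :: "(nat \<Rightarrow> nat) \<Rightarrow> nat \<Rightarrow> (nat \<times> nat \<Rightarrow> nat) \<Rightarrow> nat \<Rightarrow> nat" where
  "low_shape f N T i = card {j. j < f i \<and> T (i, j) < N}"

lemma down_closed_card:
  fixes S :: "nat set"
  assumes "finite S" "\<And>i j. j \<in> S \<Longrightarrow> i \<le> j \<Longrightarrow> i \<in> S"
  shows "S = {..<card S}"
proof -
  have "card S \<le> j \<Longrightarrow> j \<notin> S" for j
  proof
    assume j: "card S \<le> j" "j \<in> S"
    then have "{..j} \<subseteq> S" using assms(2) by auto
    from card_mono[OF assms(1) this] show False using j by simp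
  qed
  then have "S \<subseteq> {..<card S}" by (auto simp: not_le[symmetric])
  then show ?thesis by (rule card_subset_eq[rotated]) simp_all
qed

lemma row_mono_le:
  fixes T :: "nat \<times> nat \<Rightarrow> nat"
  assumes "\<And>i j. Suc j < f i \<Longrightarrow> T (i, j) \<le> T (i, Suc j)" and "j \<le> j'" "j' < f i"
  shows "T (i, j) \<le> T (i, j')"
  using assms(2,3)
proof (induction j' rule: dec_induct)
  case (step n)
  then show ?case using assms(1)[of n i] by (meson Suc_lessD order_trans)
qed simp

lemma low_shape_iff:
  assumes "\<And>i j. Suc j < f i \<Longrightarrow> T (i, j) \<le> T (i, Suc j)"
  shows "j < low_shape f N T i \<longleftrightarrow> j < f i \<and> T (i, j) < N"
proof -
  let ?S = "{j. j < f i \<and> T (i, j) < N}"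
  have "?S = {..<card ?S}"
  proof (rule down_closed_card)
    fix a b assume "b \<in> ?S" "a \<le> b"
    then show "a \<in> ?S" using row_mono_le[of f T a b i, OF assms] by auto
  qed simp
  then have "j \<in> ?S \<longleftrightarrow> j \<in> {..<card ?S}" by simp
  then show ?thesis by (simp add: low_shape_def)
qed

definition restrict_tab :: "(nat \<Rightarrow> nat) \<Rightarrow> (nat \<times> nat \<Rightarrow> nat) \<Rightarrow> nat \<times> nat \<Rightarrow> nat" where
  "restrict_tab e T = (\<lambda>c. if c \<in> shape_cells e then T c else 0)"

definition ssyt :: "nat \<Rightarrow> (nat \<Rightarrow> nat) \<Rightarrow> (nat \<Rightarrow> nat) \<Rightarrow> (nat \<times> nat \<Rightarrow> nat) set" where
  "ssyt N f mu = {T. (\<forall>c. c \<notin> shape_cells f \<longrightarrow> T c = 0) \<and> (\<forall>c\<in>shape_cells f. T c < N) \<and>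
     (\<forall>i j. Suc j < f i \<longrightarrow> T (i, j) \<le> T (i, Suc j)) \<and> (\<forall>i j. j < f (Suc i) \<longrightarrow> T (i, j) < T (Suc i, j)) \<and>
     (\<forall>i. card {c \<in> shape_cells f. T c = i} = mu i)}"

lemma finite_ssyt: "f \<in> shapes \<Longrightarrow> finite (ssyt N f mu)"
proof -
  assume "f \<in> shapes"
  then have "finite {T. \<forall>x. (x \<in> shape_cells f \<longrightarrow> T x \<in> {..<N}) \<and> (x \<notin> shape_cells f \<longrightarrow> T x = (0::nat))}"
    by (intro finite_set_of_finite_funs finite_shape_cells) auto
  then show ?thesis by (rule rev_finite_subset) (auto simp: ssyt_def)
qed

definition fill_strip :: "nat \<Rightarrow> (nat \<Rightarrow> nat) \<Rightarrow> (nat \<Rightarrow> nat) \<Rightarrow> (nat \<times> nat \<Rightarrow> nat) \<Rightarrow> nat \<times> nat \<Rightarrow> nat" where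
  "fill_strip N f e T = (\<lambda>c. if c \<in> shape_cells e then T c else if c \<in> shape_cells f then N else 0)"

text \<open>The cells with the largest entry N form a horizontal strip, and any tableau on the
  smaller shape extends uniquely by filling such a strip with N.\<close>

theorem card_ssyt:
  assumes "f \<in> shapes" "\<And>i. i \<ge> N \<Longrightarrow> mu i = 0"
  shows "card (ssyt N f mu) = gt_count N mu f"
  using assms
proof (induction N arbitrary: f mu)
  case 0
  show ?case
  proof (cases "f = (\<lambda>_. 0)")
    case True
    have "ssyt 0 f mu = {\<lambda>_. 0}" using 0(2) by (auto simp: ssyt_def True shape_cells_def)
    then show ?thesis using True by simp
  next
    case False
    then obtain i where "0 < f i" by (auto simp: fun_eq_iff)
    then have "(i, 0) \<in> shape_cells f" by (simp add: shape_cells_def)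
    then have "ssyt 0 f mu = {}" by (auto simp: ssyt_def)
    then show ?thesis using False by simp
  qed
next
  case (Suc N)
  let ?I = "{e. strip e f \<and> shape_size e + mu N = shape_size f}"
  \<comment> \<open>After the strip is removed the entry N no longer occurs, and \<open>ssyt\<close>
    prescribes the content at every value.\<close>
  let ?nu = "mu(N := 0)"
  note fs = Suc.prems(1)
  have "bij_betw (\<lambda>T. (low_shape f N T, restrict_tab (low_shape f N T) T)) (ssyt (Suc N) f mu)
      (Sigma ?I (\<lambda>e. ssyt N e ?nu))"
  proof (rule bij_betw_byWitness[where f' = "\<lambda>(e, T). fill_strip N f e T"])
    have key: "fill_strip N f (low_shape f N T) (restrict_tab (low_shape f N T) T) = T"
        "low_shape f N T \<in> ?I" "restrict_tab (low_shape f N T) T \<in> ssyt N (low_shape f N T) ?nu"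
      if T: "T \<in> ssyt (Suc N) f mu" for T
    proof -
      let ?e = "low_shape f N T"
      have out: "T c = 0" if "c \<notin> shape_cells f" for c using T that unfolding ssyt_def by blast
      have lt: "T c < Suc N" if "c \<in> shape_cells f" for c using T that unfolding ssyt_def by blast
      have row: "T (i, j) \<le> T (i, Suc j)" if "Suc j < f i" for i j using T that by (simp add: ssyt_def)
      have col: "T (i, j) < T (Suc i, j)" if "j < f (Suc i)" for i j using T that by (simp add: ssyt_def)
      have cont: "card {c \<in> shape_cells f. T c = i} = mu i" for i using T by (simp add: ssyt_def)
      have iff: "j < ?e i \<longleftrightarrow> j < f i \<and> T (i, j) < N" for i j by (rule low_shape_iff[OF row])
      have ecell: "c \<in> shape_cells ?e \<longleftrightarrow> c \<in> shape_cells f \<and> T c < N" for c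
        by (cases c) (simp add: shape_cells_def iff)
      show "fill_strip N f ?e (restrict_tab ?e T) = T"
      proof
        fix c
        show "fill_strip N f ?e (restrict_tab ?e T) c = T c"
          using ecell[of c] out[of c] lt[of c] by (auto simp: fill_strip_def restrict_tab_def)
      qed
      have ef: "?e i \<le> f i" for i using iff[of "f i" i] by (metis not_le less_irrefl)
      \<comment> \<open>Columns are strict, so a cell lying above another cell of f has an entry
        below N.\<close>
      have fe: "f (Suc i) \<le> ?e i" for i
      proof (rule ccontr)
        assume "\<not> f (Suc i) \<le> ?e i"
        then have j: "?e i < f (Suc i)" by simp
        have "(Suc i, ?e i) \<in> shape_cells f" using j by (simp add: shape_cells_def)
        then have "T (i, ?e i) < N" using col[OF j] lt by fastforce
        moreover have "?e i < f i" using j shapes_antimono[OF fs, of i "Suc i"] by simp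
        ultimately show False using iff[of "?e i" i] by simp
      qed
      have st: "strip ?e f" using ef fe by (simp add: strip_def)
      have es: "?e \<in> shapes" by (rule strip_shapes_left[OF fs st])
      have "shape_cells f = shape_cells ?e \<union> {c \<in> shape_cells f. T c = N}" using ecell lt by (auto simp: less_Suc_eq)
      moreover have "shape_cells ?e \<inter> {c \<in> shape_cells f. T c = N} = {}" using ecell by auto
      ultimately have "card (shape_cells f) = card (shape_cells ?e) + card {c \<in> shape_cells f. T c = N}"
        using finite_shape_cells[OF fs] finite_shape_cells[OF es] by (metis card_Un_disjoint finite_Un)
      then have "shape_size ?e + mu N = shape_size f" using card_shape_cells[OF fs] card_shape_cells[OF es] cont by simp
      then show "?e \<in> ?I" using st by simp
      have c2: "card {c \<in> shape_cells ?e. restrict_tab ?e T c = i} = ?nu i" for i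
      proof (cases "i < N")
        case True
        have "{c \<in> shape_cells ?e. restrict_tab ?e T c = i} = {c \<in> shape_cells f. T c = i}"
          using ecell True by (auto simp: restrict_tab_def)
        then show ?thesis using cont True by simp
      next
        case False
        have "{c \<in> shape_cells ?e. restrict_tab ?e T c = i} = {}"
          using ecell False by (auto simp: restrict_tab_def)
        moreover have "?nu i = 0" using False Suc.prems(2)[of i] by (cases "i = N") auto
        ultimately show ?thesis by (simp only: card.empty)
      qed
      have in1: "(i, j) \<in> shape_cells ?e" if "Suc j < ?e i" for i j using that by (simp add: shape_cells_def)
      have in2: "(i, Suc j) \<in> shape_cells ?e" if "Suc j < ?e i" for i j using that by (simp add: shape_cells_def)
      have in3: "(Suc i, j) \<in> shape_cells ?e" if "j < ?e (Suc i)" for i j using that by (simp add: shape_cells_def)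
      have in4: "(i, j) \<in> shape_cells ?e" if "j < ?e (Suc i)" for i j
        using that shapes_antimono[OF es, of i "Suc i"] by (simp add: shape_cells_def)
      have r: "restrict_tab ?e T (i, j) \<le> restrict_tab ?e T (i, Suc j)" if "Suc j < ?e i" for i j
        using in1[OF that] in2[OF that] row[of j i] that ef[of i] by (simp add: restrict_tab_def)
      have cc: "restrict_tab ?e T (i, j) < restrict_tab ?e T (Suc i, j)" if "j < ?e (Suc i)" for i j
        using in3[OF that] in4[OF that] col[of j i] that ef[of "Suc i"] by (simp add: restrict_tab_def)
      have l: "restrict_tab ?e T c < N" if "c \<in> shape_cells ?e" for c
        using that ecell by (simp add: restrict_tab_def)
      show "restrict_tab ?e T \<in> ssyt N ?e ?nu"
        unfolding ssyt_def using c2 r cc l by (simp add: restrict_tab_def)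
    qed
    show "\<forall>T\<in>ssyt (Suc N) f mu. (case (low_shape f N T, restrict_tab (low_shape f N T) T) of (e, T) \<Rightarrow> fill_strip N f e T) = T"
      using key(1) by simp
    show "(\<lambda>T. (low_shape f N T, restrict_tab (low_shape f N T) T)) ` ssyt (Suc N) f mu \<subseteq> Sigma ?I (\<lambda>e. ssyt N e ?nu)"
      using key(2,3) by blast
    have fill: "fill_strip N f e T \<in> ssyt (Suc N) f mu" "low_shape f N (fill_strip N f e T) = e"
        "restrict_tab e (fill_strip N f e T) = T"
      if e: "strip e f" "shape_size e + mu N = shape_size f" and T: "T \<in> ssyt N e ?nu" for e T
    proof -
      let ?T = "fill_strip N f e T"
      have es: "e \<in> shapes" by (rule strip_shapes_left[OF fs e(1)])
      have ef: "e i \<le> f i" "f (Suc i) \<le> e i" for i using e(1) by (auto simp: strip_def)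
      have sub: "shape_cells e \<subseteq> shape_cells f" by (rule shape_cells_mono) (rule ef)
      have lt: "T c < N" if "c \<in> shape_cells e" for c using T that unfolding ssyt_def by blast
      have out: "T c = 0" if "c \<notin> shape_cells e" for c using T that unfolding ssyt_def by blast
      have v: "?T (i, j) = (if j < e i then T (i, j) else if j < f i then N else 0)" for i j
        by (simp add: fill_strip_def shape_cells_def)
      have row: "?T (i, j) \<le> ?T (i, Suc j)" if "Suc j < f i" for i j
      proof -
        have "T (i, j) \<le> T (i, Suc j)" if "Suc j < e i" using T that by (simp add: ssyt_def)
        moreover have "T (i, j) \<le> N" if "j < e i" using lt[of "(i, j)"] that by (simp add: shape_cells_def)
        ultimately show ?thesis using that by (simp add: v)
      qed
      have col: "?T (i, j) < ?T (Suc i, j)" if "j < f (Suc i)" for i j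
      proof -
        have je: "j < e i" using that ef(2)[of i] by simp
        have "T (i, j) < T (Suc i, j)" if "j < e (Suc i)" using T that by (simp add: ssyt_def)
        moreover have "T (i, j) < N" using lt[of "(i, j)"] je by (simp add: shape_cells_def)
        ultimately show ?thesis using that je by (simp add: v)
      qed
      have cont: "card {c \<in> shape_cells f. ?T c = i} = mu i" for i
      proof -
        consider "i < N" | "i = N" | "i > N" by linarith
        then show ?thesis
        proof cases
          case 1
          have "{c \<in> shape_cells f. ?T c = i} = {c \<in> shape_cells e. T c = i}"
            using 1 sub by (auto simp: fill_strip_def split: if_splits)
          moreover have "card {c \<in> shape_cells e. T c = i} = ?nu i" using T by (simp add: ssyt_def)
          ultimately show ?thesis using 1 by simp
        next
          case 2
          have "{c \<in> shape_cells f. ?T c = i} = shape_cells f - shape_cells e"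
            using 2 lt by (auto simp: fill_strip_def split: if_splits)
          then have "card {c \<in> shape_cells f. ?T c = i} = shape_size f - shape_size e"
            using card_Diff_subset[OF finite_shape_cells[OF es] sub] card_shape_cells[OF es] card_shape_cells[OF fs] by simp
          then show ?thesis using e(2) 2 by simp
        next
          case 3
          have "{c \<in> shape_cells f. ?T c = i} = {}"
            using 3 lt by (fastforce simp: fill_strip_def split: if_splits)
          then show ?thesis using 3 Suc.prems(2)[of i] by (simp only: card.empty)
        qed
      qed
      have ltN: "?T c < Suc N" if "c \<in> shape_cells f" for c
        using lt[of c] by (auto simp: fill_strip_def less_Suc_eq)
      have outf: "?T c = 0" if "c \<notin> shape_cells f" for c
        using that sub by (auto simp: fill_strip_def)
      show "?T \<in> ssyt (Suc N) f mu" unfolding ssyt_def using row col cont ltN outf by simp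
      show "low_shape f N ?T = e"
      proof
        fix i
        have "j < low_shape f N ?T i \<longleftrightarrow> j < e i" for j
        proof -
          have "j < low_shape f N ?T i \<longleftrightarrow> j < f i \<and> ?T (i, j) < N" by (rule low_shape_iff[OF row])
          then show ?thesis using ef(1)[of i] lt[of "(i, j)"] by (auto simp: v shape_cells_def)
        qed
        then show "low_shape f N ?T i = e i" by (metis linorder_neqE_nat less_irrefl)
      qed
      show "restrict_tab e ?T = T"
        using out by (auto simp: restrict_tab_def fill_strip_def fun_eq_iff)
    qed
    show "\<forall>x\<in>Sigma ?I (\<lambda>e. ssyt N e ?nu). (low_shape f N (case x of (e, T) \<Rightarrow> fill_strip N f e T),
        restrict_tab (low_shape f N (case x of (e, T) \<Rightarrow> fill_strip N f e T)) (case x of (e, T) \<Rightarrow> fill_strip N f e T)) = x"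
    proof
      fix x assume "x \<in> Sigma ?I (\<lambda>e. ssyt N e ?nu)"
      then obtain e T where x: "x = (e, T)" "strip e f" "shape_size e + mu N = shape_size f" "T \<in> ssyt N e ?nu" by auto
      show "(low_shape f N (case x of (e, T) \<Rightarrow> fill_strip N f e T),
        restrict_tab (low_shape f N (case x of (e, T) \<Rightarrow> fill_strip N f e T)) (case x of (e, T) \<Rightarrow> fill_strip N f e T)) = x"
        using fill(2,3)[OF x(2-4)] x(1) by simp
    qed
    show "(\<lambda>(e, T). fill_strip N f e T) ` Sigma ?I (\<lambda>e. ssyt N e ?nu) \<subseteq> ssyt (Suc N) f mu"
      using fill(1) by auto
  qed
  then have "card (ssyt (Suc N) f mu) = card (Sigma ?I (\<lambda>e. ssyt N e ?nu))" by (rule bij_betw_same_card)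
  also have "\<dots> = (\<Sum>e\<in>?I. card (ssyt N e ?nu))"
    by (rule card_SigmaI) (use finite_strip_below[OF fs] finite_ssyt strip_shapes_left[OF fs] in auto)
  also have "\<dots> = (\<Sum>e\<in>?I. gt_count N mu e)"
  proof (rule sum.cong[OF refl])
    fix e assume "e \<in> ?I"
    then have es: "e \<in> shapes" using strip_shapes_left[OF fs] by simp
    have "card (ssyt N e ?nu) = gt_count N ?nu e"
      by (rule Suc.IH[OF es]) (use Suc.prems(2) in \<open>auto simp: le_Suc_eq\<close>)
    also have "\<dots> = gt_count N mu e" by (rule gt_count_cong) simp
    finally show "card (ssyt N e ?nu) = gt_count N mu e" .
  qed
  finally show ?case by simp
qed

section \<open>Standard tableaux and their descents\<close>

definition syt :: "(nat \<Rightarrow> nat) \<Rightarrow> (nat \<times> nat \<Rightarrow> nat) set" where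
  "syt f = {T. (\<forall>c. c \<notin> shape_cells f \<longrightarrow> T c = 0) \<and> bij_betw T (shape_cells f) {1..shape_size f} \<and>
     (\<forall>i j. Suc j < f i \<longrightarrow> T (i, j) < T (i, Suc j)) \<and> (\<forall>i j. j < f (Suc i) \<longrightarrow> T (i, j) < T (Suc i, j))}"

definition entry_row :: "(nat \<Rightarrow> nat) \<Rightarrow> (nat \<times> nat \<Rightarrow> nat) \<Rightarrow> nat \<Rightarrow> nat" where
  "entry_row f T x = fst (THE c. c \<in> shape_cells f \<and> T c = x)"

definition tab_desc :: "(nat \<Rightarrow> nat) \<Rightarrow> (nat \<times> nat \<Rightarrow> nat) \<Rightarrow> nat set" where
  "tab_desc f T = {i \<in> {1..<shape_size f}. entry_row f T i < entry_row f T (i + 1)}"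

lemma sytD:
  assumes "T \<in> syt f"
  shows "\<And>c. c \<notin> shape_cells f \<Longrightarrow> T c = 0" "bij_betw T (shape_cells f) {1..shape_size f}"
    "\<And>i j. Suc j < f i \<Longrightarrow> T (i, j) < T (i, Suc j)" "\<And>i j. j < f (Suc i) \<Longrightarrow> T (i, j) < T (Suc i, j)"
  using assms unfolding syt_def by blast+

lemma finite_syt: "f \<in> shapes \<Longrightarrow> finite (syt f)"
proof -
  assume f: "f \<in> shapes"
  have "finite {T. \<forall>x. (x \<in> shape_cells f \<longrightarrow> T x \<in> {..shape_size f}) \<and> (x \<notin> shape_cells f \<longrightarrow> T x = (0::nat))}"
    by (rule finite_set_of_finite_funs) (simp_all add: finite_shape_cells[OF f])
  moreover have "syt f \<subseteq> {T. \<forall>x. (x \<in> shape_cells f \<longrightarrow> T x \<in> {..shape_size f}) \<and> (x \<notin> shape_cells f \<longrightarrow> T x = (0::nat))}"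
  proof
    fix T assume T: "T \<in> syt f"
    have "T x \<in> {..shape_size f}" if "x \<in> shape_cells f" for x
      using bij_betwE[OF sytD(2)[OF T]] that by fastforce
    then show "T \<in> {T. \<forall>x. (x \<in> shape_cells f \<longrightarrow> T x \<in> {..shape_size f}) \<and> (x \<notin> shape_cells f \<longrightarrow> T x = (0::nat))}"
      using sytD(1)[OF T] by blast
  qed
  ultimately show ?thesis by (rule rev_finite_subset)
qed

lemma entry_row_eq:
  assumes "inj_on T (shape_cells f)" "c \<in> shape_cells f"
  shows "entry_row f T (T c) = fst c"
proof -
  have "(THE c'. c' \<in> shape_cells f \<and> T c' = T c) = c"
    by (rule the_equality) (use assms in \<open>auto dest: inj_onD\<close>)
  then show ?thesis by (simp add: entry_row_def)
qed

text \<open>The order in which the cells of a horizontal strip are filled by a run without descents: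
  lower rows first, and from left to right within a row.\<close>
definition fills_before :: "nat \<times> nat \<Rightarrow> nat \<times> nat \<Rightarrow> bool" where
  "fills_before c d \<longleftrightarrow> fst d < fst c \<or> fst c = fst d \<and> snd c < snd d"

lemma fills_before_order:
  "\<not> fills_before c c" "fills_before a b \<Longrightarrow> fills_before b c \<Longrightarrow> fills_before a c"
  "a \<noteq> b \<Longrightarrow> fills_before a b \<or> fills_before b a"
  by (auto simp: fills_before_def prod_eq_iff)

definition fill_rank :: "(nat \<times> nat) set \<Rightarrow> nat \<times> nat \<Rightarrow> nat" where
  "fill_rank K c = card {d \<in> K. fills_before d c}"

lemma fill_rank_less:
  assumes "finite K" "c \<in> K" "fills_before c d"
  shows "fill_rank K c < fill_rank K d"
  unfolding fill_rank_def
proof (rule psubset_card_mono)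
  have "{x \<in> K. fills_before x c} \<subseteq> {x \<in> K. fills_before x d}" using assms(3) fills_before_order(2) by blast
  moreover have "c \<in> {x \<in> K. fills_before x d} - {x \<in> K. fills_before x c}"
    using assms fills_before_order(1) by simp
  ultimately show "{x \<in> K. fills_before x c} \<subset> {x \<in> K. fills_before x d}" by blast
qed (use assms in simp)

lemma bij_fill_rank:
  assumes "finite K"
  shows "bij_betw (fill_rank K) K {..<card K}"
proof -
  have inj: "inj_on (fill_rank K) K"
  proof (rule inj_onI)
    fix a b assume ab: "a \<in> K" "b \<in> K" "fill_rank K a = fill_rank K b"
    show "a = b"
    proof (rule ccontr)
      assume "a \<noteq> b"
      then show False
        using fills_before_order(3)[of a b] fill_rank_less[OF assms ab(1), of b] fill_rank_less[OF assms ab(2), of a] ab(3)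
        by auto
    qed
  qed
  have "fill_rank K a < card K" if "a \<in> K" for a
    unfolding fill_rank_def
    by (rule psubset_card_mono[OF assms]) (use that fills_before_order(1) in blast)
  then have "fill_rank K ` K \<subseteq> {..<card K}" by auto
  moreover have "card (fill_rank K ` K) = card {..<card K}" using card_image[OF inj] by simp
  ultimately have "fill_rank K ` K = {..<card K}" by (intro card_subset_eq) auto
  then show ?thesis using inj by (simp add: bij_betw_def)
qed

text \<open>An order-preserving bijection from a finite total order onto an interval is determined
  by the ranks.\<close>

lemma fill_rank_unique:
  assumes K: "finite K" and t: "bij_betw t K {s + 1..s + card K}"
    and mono: "\<And>c d. c \<in> K \<Longrightarrow> d \<in> K \<Longrightarrow> fills_before c d \<Longrightarrow> t c < t d" and c: "c \<in> K"
  shows "t c = s + 1 + fill_rank K c"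
proof -
  have tc: "t c \<in> {s + 1..s + card K}" using t c by (auto simp: bij_betw_def)
  have eq: "{d \<in> K. fills_before d c} = {d \<in> K. t d < t c}"
  proof (intro equalityI subsetI)
    fix d assume d: "d \<in> {d \<in> K. t d < t c}"
    then have "d \<noteq> c" by auto
    moreover have "\<not> fills_before c d" using mono[OF c, of d] d by auto
    ultimately show "d \<in> {d \<in> K. fills_before d c}" using fills_before_order(3)[of c d] d by auto
  qed (use mono c in auto)
  have "fill_rank K c = card {d \<in> K. t d < t c}" unfolding fill_rank_def eq ..
  also have "\<dots> = card (t ` {d \<in> K. t d < t c})"
    by (rule card_image[symmetric]) (use t in \<open>auto simp: bij_betw_def inj_on_def\<close>)
  also have "t ` {d \<in> K. t d < t c} = {s + 1..<t c}"
  proof (intro equalityI subsetI)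
    fix x assume x: "x \<in> {s + 1..<t c}"
    then have "x \<in> t ` K" using t tc by (auto simp: bij_betw_def)
    then show "x \<in> t ` {d \<in> K. t d < t c}" using x by auto
  next
    fix x assume "x \<in> t ` {d \<in> K. t d < t c}"
    then show "x \<in> {s + 1..<t c}" using bij_betwE[OF t] by auto
  qed
  finally have "fill_rank K c = t c - (s + 1)" by simp
  then show ?thesis using tc by simp
qed

definition extend_tab :: "nat \<Rightarrow> (nat \<Rightarrow> nat) \<Rightarrow> (nat \<Rightarrow> nat) \<Rightarrow> (nat \<times> nat \<Rightarrow> nat) \<Rightarrow> nat \<times> nat \<Rightarrow> nat" where
  "extend_tab s f e T = (\<lambda>c. if c \<in> shape_cells e then T c
     else if c \<in> shape_cells f then s + 1 + fill_rank (shape_cells f - shape_cells e) c else 0)"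

text \<open>Without descents the entries beyond s move weakly upwards, so they are filled in the
  order \<open>fills_before\<close>. Two of them in one column would have the lower filled first,
  against the columns; so they form a horizontal strip, with a forced filling.\<close>

lemma syt_split:
  assumes f: "f \<in> shapes" and sz: "shape_size f = s + r" and T: "T \<in> syt f"
    and nodesc: "\<And>i. s < i \<Longrightarrow> i < s + r \<Longrightarrow> i \<notin> tab_desc f T"
  defines "e \<equiv> low_shape f (Suc s) T"
  shows "strip e f" "shape_size e = s" "restrict_tab e T \<in> syt e" "extend_tab s f e (restrict_tab e T) = T"
    "tab_desc e (restrict_tab e T) = tab_desc f T \<inter> {1..<s}"
proof -
  note D = sytD[OF T]
  have inj: "inj_on T (shape_cells f)" using D(2) by (simp add: bij_betw_def)
  have iff: "j < e i \<longleftrightarrow> j < f i \<and> T (i, j) < Suc s" for i j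
    unfolding e_def by (rule low_shape_iff) (use D(3) in \<open>auto intro: less_imp_le\<close>)
  have ecell: "c \<in> shape_cells e \<longleftrightarrow> c \<in> shape_cells f \<and> T c \<le> s" for c
    by (cases c) (simp add: shape_cells_def iff less_Suc_eq_le)
  define K where "K = shape_cells f - shape_cells e"
  have K: "c \<in> K \<longleftrightarrow> c \<in> shape_cells f \<and> s < T c" for c unfolding K_def using ecell by auto
  have row_strict: "T (i, j) < T (i, j')" if "j < j'" "j' < f i" for i j j'
  proof -
    have "T (i, Suc j) \<le> T (i, j')"
      by (rule row_mono_le[of f T]) (use D(3) that in \<open>auto intro: less_imp_le\<close>)
    moreover have "T (i, j) < T (i, Suc j)" using D(3) that by simp
    ultimately show ?thesis by simp
  qed
  have rows: "entry_row f T y \<le> entry_row f T x" if "s < x" "x \<le> y" "y \<le> s + r" for x y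
    using that(2,3)
  proof (induction y rule: dec_induct)
    case (step n)
    then have "n \<notin> tab_desc f T" using nodesc[of n] that(1) by simp
    then have "entry_row f T (Suc n) \<le> entry_row f T n" using step that(1) by (simp add: tab_desc_def sz)
    then show ?case using step by simp
  qed simp
  have Tle: "T c \<le> s + r" "1 \<le> T c" if "c \<in> shape_cells f" for c using bij_betwE[OF D(2)] that sz by auto
  have mono: "T c < T d" if cd: "c \<in> K" "d \<in> K" "fills_before c d" for c d
  proof (rule ccontr)
    assume "\<not> T c < T d"
    then have "T d \<le> T c" by simp
    have cf: "c \<in> shape_cells f" "d \<in> shape_cells f" using cd K by auto
    have "fst c \<le> fst d"
      using rows[of "T d" "T c"] \<open>T d \<le> T c\<close> cd K Tle entry_row_eq[OF inj] cf by simp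
    then have same: "fst c = fst d" "snd c < snd d" using cd(3) by (auto simp: fills_before_def)
    then have "T (fst d, snd c) < T (fst d, snd d)" using row_strict cf(2) by (auto simp: shape_cells_def)
    then show False using same \<open>T d \<le> T c\<close> by (metis not_le prod.collapse)
  qed
  have ef: "e i \<le> f i" for i using iff[of "f i" i] by (metis not_le less_irrefl)
  have fe: "f (Suc i) \<le> e i" for i
  proof (rule ccontr)
    assume "\<not> f (Suc i) \<le> e i"
    then have j: "e i < f (Suc i)" by simp
    then have ji: "e i < f i" using shapes_antimono[OF f, of i "Suc i"] by simp
    have "s < T (i, e i)" using iff[of "e i" i] ji by simp
    moreover have lt: "T (i, e i) < T (Suc i, e i)" using D(4)[OF j] .
    ultimately have "(i, e i) \<in> K" "(Suc i, e i) \<in> K" using K j ji by (auto simp: shape_cells_def)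
    then have "T (Suc i, e i) < T (i, e i)" using mono by (simp add: fills_before_def)
    then show False using lt by simp
  qed
  show st: "strip e f" using ef fe by (simp add: strip_def)
  have es: "e \<in> shapes" by (rule strip_shapes_left[OF f st])
  have sub: "shape_cells e \<subseteq> shape_cells f" using ecell by blast
  have img: "T ` shape_cells e = {1..s}"
  proof (intro equalityI subsetI)
    fix x assume x: "x \<in> {1..s}"
    then have "x \<in> T ` shape_cells f" using D(2) sz by (auto simp: bij_betw_def)
    then show "x \<in> T ` shape_cells e" using x ecell by auto
  next
    fix x assume "x \<in> T ` shape_cells e"
    then show "x \<in> {1..s}" using ecell Tle by auto
  qed
  have injE: "inj_on T (shape_cells e)" using inj sub by (rule inj_on_subset)
  have bijE: "bij_betw T (shape_cells e) {1..s}" using injE img by (simp add: bij_betw_def)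
  have "card (shape_cells e) = s" using bij_betw_same_card[OF bijE] by simp
  then show sze: "shape_size e = s" using card_shape_cells[OF es] by simp
  have bijK: "bij_betw T K {s + 1..s + card K}"
  proof -
    have "card K = r" using card_Diff_subset[OF finite_shape_cells[OF es] sub] card_shape_cells[OF es]
        card_shape_cells[OF f] sze sz by (simp add: K_def)
    moreover have "T ` K = {s + 1..s + r}"
    proof (intro equalityI subsetI)
      fix x assume x: "x \<in> {s + 1..s + r}"
      then have "x \<in> T ` shape_cells f" using D(2) sz by (auto simp: bij_betw_def)
      then show "x \<in> T ` K" using x K by auto
    next
      fix x assume "x \<in> T ` K"
      then show "x \<in> {s + 1..s + r}" using K Tle by auto
    qed
    moreover have "inj_on T K" by (rule inj_on_subset[OF inj]) (auto simp: K_def)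
    ultimately show ?thesis by (simp add: bij_betw_def)
  qed
  have finK: "finite K" using finite_shape_cells[OF f] by (simp add: K_def)
  have rank: "T c = s + 1 + fill_rank K c" if "c \<in> K" for c
    by (rule fill_rank_unique[OF finK bijK mono that])
  show "extend_tab s f e (restrict_tab e T) = T"
  proof
    fix c
    show "extend_tab s f e (restrict_tab e T) c = T c"
    proof (cases "c \<in> shape_cells f")
      case True
      then show ?thesis using rank[of c]
        by (cases "c \<in> shape_cells e") (simp_all add: extend_tab_def restrict_tab_def K_def)
    next
      case False
      then have "c \<notin> shape_cells e" using sub by blast
      then show ?thesis using False D(1) by (simp add: extend_tab_def)
    qed
  qed
  have bijR: "bij_betw (restrict_tab e T) (shape_cells e) {1..shape_size e}"
    unfolding sze using bijE by (rule bij_betw_cong[THEN iffD1, rotated]) (simp add: restrict_tab_def)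
  have "restrict_tab e T (i, j) < restrict_tab e T (i, Suc j)" if "Suc j < e i" for i j
    using that D(3)[of j i] ef[of i] by (simp add: restrict_tab_def shape_cells_def)
  moreover have "restrict_tab e T (i, j) < restrict_tab e T (Suc i, j)" if "j < e (Suc i)" for i j
    using that D(4)[of j i] ef[of "Suc i"] shapes_antimono[OF es, of i "Suc i"] by (simp add: restrict_tab_def shape_cells_def)
  ultimately show "restrict_tab e T \<in> syt e"
    unfolding syt_def using bijR by (simp add: restrict_tab_def)
  have er: "entry_row e (restrict_tab e T) x = entry_row f T x" if x: "x \<in> {1..s}" for x
  proof -
    obtain c where c: "c \<in> shape_cells e" "T c = x" using img x by (metis imageE)
    have "restrict_tab e T c = x" using c by (simp add: restrict_tab_def)
    moreover have "inj_on (restrict_tab e T) (shape_cells e)" using bijR by (simp add: bij_betw_def)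
    ultimately have "entry_row e (restrict_tab e T) x = fst c" using entry_row_eq c(1) by metis
    moreover have "entry_row f T x = fst c" using entry_row_eq[OF inj] c sub by blast
    ultimately show ?thesis by simp
  qed
  show "tab_desc e (restrict_tab e T) = tab_desc f T \<inter> {1..<s}"
    unfolding tab_desc_def sze sz using er by auto
qed

text \<open>Filling a strip in the order \<open>fills_before\<close> yields a standard tableau
  because above each of its cells lies a cell of e, with a smaller entry.\<close>

lemma syt_extend:
  assumes f: "f \<in> shapes" and e: "strip e f" and se: "shape_size e = s" and sf: "shape_size f = s + r" and T: "T \<in> syt e"
  defines "U \<equiv> extend_tab s f e T"
  shows "U \<in> syt f" "low_shape f (Suc s) U = e" "restrict_tab e U = T" "\<And>i. s < i \<Longrightarrow> i < s + r \<Longrightarrow> i \<notin> tab_desc f U"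
proof -
  note D = sytD[OF T]
  have es: "e \<in> shapes" by (rule strip_shapes_left[OF f e])
  have ef: "e i \<le> f i" "f (Suc i) \<le> e i" for i using e by (auto simp: strip_def)
  have sub: "shape_cells e \<subseteq> shape_cells f" by (rule shape_cells_mono) (rule ef)
  define K where "K = shape_cells f - shape_cells e"
  have finK: "finite K" using finite_shape_cells[OF f] by (simp add: K_def)
  have cK: "card K = r"
    using card_Diff_subset[OF finite_shape_cells[OF es] sub] card_shape_cells[OF es] card_shape_cells[OF f] se sf
    by (simp add: K_def)
  have Ue: "U c = T c" if "c \<in> shape_cells e" for c using that by (simp add: U_def extend_tab_def)
  have UK: "U c = s + 1 + fill_rank K c" if "c \<in> K" for c using that by (simp add: U_def extend_tab_def K_def)
  have Uo: "U c = 0" if "c \<notin> shape_cells f" for c using that sub by (auto simp: U_def extend_tab_def)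
  have Tb: "T c \<le> s" "1 \<le> T c" if "c \<in> shape_cells e" for c using bij_betwE[OF D(2)] that se by auto
  have b1: "bij_betw U (shape_cells e) {1..s}"
    using D(2) unfolding se by (rule bij_betw_cong[THEN iffD1, rotated]) (simp add: Ue)
  have b2: "bij_betw U K {s + 1..s + r}"
  proof -
    have "bij_betw (\<lambda>x. s + 1 + x) {..<r} {s + 1..s + r}"
      by (rule bij_betw_byWitness[where f' = "\<lambda>x. x - (s + 1)"]) auto
    then have "bij_betw ((\<lambda>x. s + 1 + x) \<circ> fill_rank K) K {s + 1..s + r}"
      using bij_fill_rank[OF finK] unfolding cK by (rule bij_betw_trans[rotated])
    then show ?thesis by (rule bij_betw_cong[THEN iffD1, rotated]) (simp add: UK)
  qed
  have "bij_betw U (shape_cells e \<union> K) ({1..s} \<union> {s + 1..s + r})"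
    by (rule bij_betw_combine[OF b1 b2]) auto
  moreover have "shape_cells e \<union> K = shape_cells f" using sub by (auto simp: K_def)
  moreover have "{1..s} \<union> {s + 1..s + r} = {1..s + r}" by auto
  ultimately have bij: "bij_betw U (shape_cells f) {1..shape_size f}" unfolding sf by metis
  have inj: "inj_on U (shape_cells f)" using bij by (simp add: bij_betw_def)
  have row: "U (i, j) < U (i, Suc j)" if "Suc j < f i" for i j
  proof -
    consider "Suc j < e i" | "Suc j = e i" | "e i < Suc j" by linarith
    then show ?thesis
    proof cases
      case 1
      then show ?thesis using D(3)[OF 1] by (simp add: Ue shape_cells_def)
    next
      case 2
      then have "(i, j) \<in> shape_cells e" "(i, Suc j) \<in> K" using that by (auto simp: shape_cells_def K_def)
      then show ?thesis using Ue UK Tb(1) by (metis add.assoc le_imp_less_Suc plus_1_eq_Suc trans_less_add1 add.commute)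
    next
      case 3
      then have "(i, j) \<in> K" "(i, Suc j) \<in> K" using that by (auto simp: shape_cells_def K_def)
      then show ?thesis using UK fill_rank_less[OF finK, of "(i, j)" "(i, Suc j)"] by (simp add: fills_before_def)
    qed
  qed
  have col: "U (i, j) < U (Suc i, j)" if "j < f (Suc i)" for i j
  proof -
    have ie: "(i, j) \<in> shape_cells e" using that ef(2)[of i] by (simp add: shape_cells_def)
    show ?thesis
    proof (cases "j < e (Suc i)")
      case True
      then show ?thesis using D(4)[OF True] ie by (simp add: Ue shape_cells_def)
    next
      case False
      then have "(Suc i, j) \<in> K" using that by (simp add: K_def shape_cells_def)
      then have "s < U (Suc i, j)" using UK by simp
      then show ?thesis using Ue[OF ie] Tb(1)[OF ie] by simp
    qed
  qed
  show "U \<in> syt f" unfolding syt_def using Uo bij row col by blast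
  have small: "U c < Suc s \<longleftrightarrow> c \<in> shape_cells e" if "c \<in> shape_cells f" for c
  proof (cases "c \<in> shape_cells e")
    case True
    then show ?thesis using Ue Tb(1) by (simp add: less_Suc_eq_le)
  next
    case False
    then have "c \<in> K" using that by (simp add: K_def)
    then show ?thesis using UK False by simp
  qed
  show "low_shape f (Suc s) U = e"
  proof
    fix i
    have "j < low_shape f (Suc s) U i \<longleftrightarrow> j < e i" for j
    proof -
      have "j < low_shape f (Suc s) U i \<longleftrightarrow> j < f i \<and> U (i, j) < Suc s"
        by (rule low_shape_iff) (use row in \<open>auto intro: less_imp_le\<close>)
      also have "\<dots> \<longleftrightarrow> j < e i" using small[of "(i, j)"] ef(1)[of i] by (auto simp: shape_cells_def)
      finally show ?thesis .
    qed
    then show "low_shape f (Suc s) U i = e i" by (metis linorder_neqE_nat less_irrefl)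
  qed
  show "restrict_tab e U = T" using D(1) Ue by (auto simp: restrict_tab_def fun_eq_iff)
  show "i \<notin> tab_desc f U" if i: "s < i" "i < s + r" for i
  proof
    assume d: "i \<in> tab_desc f U"
    have "i \<in> U ` K" "Suc i \<in> U ` K" using b2 i by (auto simp: bij_betw_def)
    then obtain c d' where c: "c \<in> K" "U c = i" and d': "d' \<in> K" "U d' = Suc i" by (metis imageE)
    have "entry_row f U i = fst c" "entry_row f U (Suc i) = fst d'"
      using entry_row_eq[OF inj, of c] entry_row_eq[OF inj, of d'] c d' by (simp_all add: K_def)
    then have "fills_before d' c" using d by (simp add: tab_desc_def fills_before_def)
    then have "fill_rank K d' < fill_rank K c" by (rule fill_rank_less[OF finK d'(1)])
    then show False using UK[OF c(1)] UK[OF d'(1)] c(2) d'(2) by simp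
  qed
qed

text \<open>Each block is a run without descents and thus amounts to the choice of a horizontal
  strip.\<close>

theorem card_syt_block_ends:
  assumes "f \<in> shapes" "shape_size f = sum_list al"
  shows "card {T \<in> syt f. tab_desc f T \<subseteq> block_ends al} = strip_count al f"
  using assms
proof (induction al arbitrary: f)
  case Nil
  then have f: "f = (\<lambda>_. 0)" using shape_size_0 by simp
  have "syt f = {\<lambda>_. 0}" by (auto simp: f syt_def shape_cells_def zero_shape bij_betw_def)
  moreover have "tab_desc f T = {}" for T by (simp add: tab_desc_def f zero_shape)
  ultimately have "{T \<in> syt f. tab_desc f T \<subseteq> block_ends []} = {\<lambda>_. 0}" by auto
  then show ?case using f by simp
next
  case (Cons r al)
  let ?s = "sum_list al"
  let ?I = "{e. strip e f \<and> shape_size e + r = shape_size f}"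
  let ?X = "{T \<in> syt f. tab_desc f T \<subseteq> block_ends (r # al)}"
  let ?Y = "\<lambda>e. {T \<in> syt e. tab_desc e T \<subseteq> block_ends al}"
  note fs = Cons.prems(1)
  have sz: "shape_size f = ?s + r" using Cons.prems(2) by simp
  have nodesc: "i \<notin> tab_desc f T" if "T \<in> ?X" "?s < i" "i < ?s + r" for T i
    using that block_ends_le[of i al] by auto
  have "bij_betw (\<lambda>T. (low_shape f (Suc ?s) T, restrict_tab (low_shape f (Suc ?s) T) T)) ?X (Sigma ?I ?Y)"
  proof (rule bij_betw_byWitness[where f' = "\<lambda>(e, T). extend_tab ?s f e T"])
    show "\<forall>T\<in>?X. (case (low_shape f (Suc ?s) T, restrict_tab (low_shape f (Suc ?s) T) T) of (e, T) \<Rightarrow> extend_tab ?s f e T) = T"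
    proof
      fix T assume T: "T \<in> ?X"
      then have "T \<in> syt f" by simp
      from syt_split(4)[OF fs sz this nodesc[OF T]]
      show "(case (low_shape f (Suc ?s) T, restrict_tab (low_shape f (Suc ?s) T) T) of (e, T) \<Rightarrow> extend_tab ?s f e T) = T"
        by simp
    qed
    show "(\<lambda>T. (low_shape f (Suc ?s) T, restrict_tab (low_shape f (Suc ?s) T) T)) ` ?X \<subseteq> Sigma ?I ?Y"
    proof (rule image_subsetI)
      fix T assume T: "T \<in> ?X"
      then have Ts: "T \<in> syt f" by simp
      note sp = syt_split[OF fs sz Ts nodesc[OF T]]
      have "tab_desc f T \<inter> {1..<?s} \<subseteq> block_ends al" using T by auto
      then show "(low_shape f (Suc ?s) T, restrict_tab (low_shape f (Suc ?s) T) T) \<in> Sigma ?I ?Y"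
        using sp sz by simp
    qed
    show "\<forall>x\<in>Sigma ?I ?Y. (low_shape f (Suc ?s) (case x of (e, T) \<Rightarrow> extend_tab ?s f e T),
       restrict_tab (low_shape f (Suc ?s) (case x of (e, T) \<Rightarrow> extend_tab ?s f e T)) (case x of (e, T) \<Rightarrow> extend_tab ?s f e T)) = x"
    proof
      fix x assume "x \<in> Sigma ?I ?Y"
      then obtain e T where x: "x = (e, T)" "strip e f" "shape_size e = ?s" "T \<in> syt e" using sz by auto
      show "(low_shape f (Suc ?s) (case x of (e, T) \<Rightarrow> extend_tab ?s f e T),
       restrict_tab (low_shape f (Suc ?s) (case x of (e, T) \<Rightarrow> extend_tab ?s f e T)) (case x of (e, T) \<Rightarrow> extend_tab ?s f e T)) = x"
        using syt_extend(2,3)[OF fs x(2,3) sz x(4)] x(1) by simp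
    qed
    show "(\<lambda>(e, T). extend_tab ?s f e T) ` Sigma ?I ?Y \<subseteq> ?X"
    proof (rule image_subsetI)
      fix x assume "x \<in> Sigma ?I ?Y"
      then obtain e T where x: "x = (e, T)" "strip e f" "shape_size e = ?s" "T \<in> syt e" "tab_desc e T \<subseteq> block_ends al"
        using sz by auto
      let ?U = "extend_tab ?s f e T"
      note ex = syt_extend[OF fs x(2,3) sz x(4)]
      have "tab_desc e T = tab_desc f ?U \<inter> {1..<?s}"
        using syt_split(5)[OF fs sz ex(1) ex(4)] unfolding ex(2) ex(3) by simp
      then have below: "tab_desc f ?U \<inter> {1..<?s} \<subseteq> block_ends al" using x(5) by simp
      have "tab_desc f ?U \<subseteq> insert ?s (block_ends al)"
      proof
        fix i assume i: "i \<in> tab_desc f ?U"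
        then have b: "1 \<le> i" "i < ?s + r" by (simp_all add: tab_desc_def sz)
        have "\<not> ?s < i" using ex(4)[of i] i b by blast
        then show "i \<in> insert ?s (block_ends al)" using below i b by (cases "i = ?s") auto
      qed
      then show "(case x of (e, T) \<Rightarrow> extend_tab ?s f e T) \<in> ?X" using ex(1) x(1) by simp
    qed
  qed
  then have "card ?X = card (Sigma ?I ?Y)" by (rule bij_betw_same_card)
  also have "\<dots> = (\<Sum>e\<in>?I. card (?Y e))"
    by (rule card_SigmaI) (use finite_strip_below[OF fs] finite_syt strip_shapes_left[OF fs] in auto)
  also have "\<dots> = (\<Sum>e\<in>?I. strip_count al e)"
  proof (rule sum.cong[OF refl])
    fix e assume "e \<in> ?I"
    then show "card (?Y e) = strip_count al e"
      using strip_shapes_left[OF fs] sz by (intro Cons.IH) auto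
  qed
  finally show ?case by simp
qed

text \<open>The last block starts after the largest descent. Intersecting with the interior discards
  the end 0, which \<open>block_ends\<close> contains for every nonempty list.\<close>

lemma ex_block_ends:
  assumes "D \<subseteq> {1..<k}"
  shows "\<exists>al. sum_list al = k \<and> block_ends al \<inter> {1..<k} = D"
  using assms
proof (induction k arbitrary: D rule: less_induct)
  case (less k)
  show ?case
  proof (cases "D = {}")
    case True
    then show ?thesis by (intro exI[of _ "[k]"]) simp
  next
    case False
    have fin: "finite D" using less.prems finite_subset by blast
    define d where "d = Max D"
    have d: "d \<in> D" "\<And>i. i \<in> D \<Longrightarrow> i \<le> d" using fin False by (auto simp: d_def)
    then have dk: "d < k" "1 \<le> d" using less.prems by auto
    have "D - {d} \<subseteq> {1..<d}"
    proof
      fix i assume i: "i \<in> D - {d}"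
      then have "i \<le> d" "i \<noteq> d" "1 \<le> i" using d(2)[of i] less.prems by auto
      then show "i \<in> {1..<d}" by simp
    qed
    from less.IH[OF dk(1) this] obtain al where al: "sum_list al = d" "block_ends al \<inter> {1..<d} = D - {d}" by blast
    have "block_ends ((k - d) # al) \<inter> {1..<k} = D"
    proof (intro equalityI subsetI)
      fix i assume i: "i \<in> block_ends ((k - d) # al) \<inter> {1..<k}"
      show "i \<in> D"
      proof (cases "i = d")
        case False
        then have "i \<in> block_ends al" using i al(1) by simp
        then have "i < d" using block_ends_le[of i al] al(1) False by simp
        then have "i \<in> block_ends al \<inter> {1..<d}" using i \<open>i \<in> block_ends al\<close> by simp
        then show ?thesis unfolding al(2) by simp
      qed (use d in simp)
    next
      fix i assume i: "i \<in> D"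
      then have ik: "i \<in> {1..<k}" using less.prems by blast
      show "i \<in> block_ends ((k - d) # al) \<inter> {1..<k}"
      proof (cases "i = d")
        case True
        then show ?thesis using ik al(1) by simp
      next
        case False
        then have "i \<in> D - {d}" using i by simp
        then have "i \<in> block_ends al" unfolding al(2)[symmetric] by simp
        then show ?thesis using ik by simp
      qed
    qed
    then show ?thesis using al(1) dk by (intro exI[of _ "(k - d) # al"]) simp
  qed
qed

text \<open>Subset inversion by strong induction instead of alternating signs, so that it can be
  carried out in the natural numbers.\<close>

lemma moebius_subsets:
  fixes F H :: "nat set \<Rightarrow> nat"
  assumes eq: "\<And>D. D \<subseteq> A \<Longrightarrow> (\<Sum>E\<in>Pow D. F E) = (\<Sum>E\<in>Pow D. H E)" and A: "finite A" and D: "D \<subseteq> A"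
  shows "F D = H D"
proof -
  have "finite D" using A D finite_subset by blast
  then show ?thesis using D
  proof (induction D rule: finite_psubset_induct)
    case (psubset D)
    have "(\<Sum>E\<in>Pow D. G E) = G D + (\<Sum>E\<in>Pow D - {D}. G E)" for G :: "nat set \<Rightarrow> nat"
      by (rule sum.remove) (use psubset.hyps in auto)
    moreover have "(\<Sum>E\<in>Pow D - {D}. F E) = (\<Sum>E\<in>Pow D - {D}. H E)"
      by (rule sum.cong[OF refl], rule psubset.IH) (use psubset.prems in auto)
    ultimately show ?case using eq[OF psubset.prems] by simp
  qed
qed

text \<open>Counting by descents contained in D is the Cauchy identity for a composition with block
  ends D; inversion over the subsets gives the count for exact descent sets.\<close>

theorem sum_card_syt_gt_count:
  assumes M: "set_mset M \<subseteq> {..<N}" "size M = k" and D: "D \<subseteq> {1..<k}"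
  shows "(\<Sum>f\<in>shapes_of k. card {T \<in> syt f. tab_desc f T = D} * gt_count N (count M) f) =
     card {w. mset w = M \<and> word_desc w = D}"
proof (rule moebius_subsets[where A = "{1..<k}" and D = D])
  fix D assume "D \<subseteq> {1..<k}"
  then obtain al where al: "sum_list al = k" "block_ends al \<inter> {1..<k} = D" using ex_block_ends by blast
  have fD: "finite (Pow D)" using al(2) by auto
  have split: "(\<Sum>E\<in>Pow D. card {x \<in> X. h x = E}) = card {x \<in> X. h x \<subseteq> D}" if "finite X" for X :: "'b set" and h
  proof -
    have "{x \<in> X. h x \<subseteq> D} = (\<Union>E\<in>Pow D. {x \<in> X. h x = E})" by auto
    moreover have "card (\<Union>E\<in>Pow D. {x \<in> X. h x = E}) = (\<Sum>E\<in>Pow D. card {x \<in> X. h x = E})"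
      by (rule card_UN_disjoint[OF fD]) (use that in auto)
    ultimately show ?thesis by simp
  qed
  have td: "tab_desc f T \<subseteq> D \<longleftrightarrow> tab_desc f T \<subseteq> block_ends al" if "f \<in> shapes_of k" for f T
    using that al(2) by (auto simp: tab_desc_def shapes_of_def)
  have wd: "word_desc w \<subseteq> D \<longleftrightarrow> word_desc w \<subseteq> block_ends al" if "mset w = M" for w
  proof -
    have "length w = k" using that M(2) by auto
    then show ?thesis using al(2) by (auto simp: word_desc_def)
  qed
  have "(\<Sum>E\<in>Pow D. \<Sum>f\<in>shapes_of k. card {T \<in> syt f. tab_desc f T = E} * gt_count N (count M) f) =
     (\<Sum>f\<in>shapes_of k. (\<Sum>E\<in>Pow D. card {T \<in> syt f. tab_desc f T = E}) * gt_count N (count M) f)"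
    by (subst sum.swap) (simp add: sum_distrib_right)
  also have "\<dots> = (\<Sum>f\<in>shapes_of k. strip_count al f * gt_count N (count M) f)"
  proof (rule sum.cong[OF refl])
    fix f assume f: "f \<in> shapes_of k"
    then have fs: "f \<in> shapes" "shape_size f = sum_list al" using al(1) by (auto simp: shapes_of_def)
    have "(\<Sum>E\<in>Pow D. card {T \<in> syt f. tab_desc f T = E}) = card {T \<in> syt f. tab_desc f T \<subseteq> block_ends al}"
      unfolding split[OF finite_syt[OF fs(1)]] using td[OF f] by simp
    then show "(\<Sum>E\<in>Pow D. card {T \<in> syt f. tab_desc f T = E}) * gt_count N (count M) f = strip_count al f * gt_count N (count M) f"
      using card_syt_block_ends[OF fs] by simp
  qed
  also have "\<dots> = card (block_words al M)"
    using sum_strip_count_gt_count[OF M(1), of al] al(1) M(2) by simp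
  also have "block_words al M = {w \<in> {w. mset w = M}. word_desc w \<subseteq> D}" using wd by (auto simp: block_words_def)
  also have "card \<dots> = (\<Sum>E\<in>Pow D. card {w \<in> {w. mset w = M}. word_desc w = E})"
    by (rule split[symmetric]) (use finite_permutations_of_multiset[of M] in \<open>simp add: permutations_of_multiset_def\<close>)
  finally show "(\<Sum>E\<in>Pow D. \<Sum>f\<in>shapes_of k. card {T \<in> syt f. tab_desc f T = E} * gt_count N (count M) f) =
      (\<Sum>E\<in>Pow D. card {w. mset w = M \<and> word_desc w = E})" by simp
qed (use D in auto)

section \<open>Schur coefficients\<close>

definition row_fun :: "nat list \<Rightarrow> nat \<Rightarrow> nat" where
  "row_fun la i = (if i < length la then la ! i else 0)"

lemma cells_row_fun: "cells la = shape_cells (row_fun la)"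
  by (auto simp: cells_def shape_cells_def row_fun_def split: if_splits)

lemma row_fun_size: "shape_size (row_fun la) = sum_list la"
proof -
  have "shape_size (row_fun la) = (\<Sum>i<length la. row_fun la i)"
    by (rule shape_size_eq) (simp_all add: row_fun_def)
  also have "\<dots> = sum_list la" by (simp add: row_fun_def sum_list_sum_nth atLeast0LessThan)
  finally show ?thesis .
qed

lemma row_fun_shapes:
  assumes "is_partition la"
  shows "row_fun la \<in> shapes"
proof -
  have "row_fun la (Suc i) \<le> row_fun la i" for i
  proof (cases "Suc i < length la")
    case True
    then have "la ! i \<ge> la ! Suc i"
      using assms sorted_wrt_nth_less[of "(\<ge>)" la i "Suc i"] by (simp add: is_partition_def)
    then show ?thesis using True by (simp add: row_fun_def)
  qed (simp add: row_fun_def)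
  moreover have "finite {i. row_fun la i \<noteq> 0}"
    by (rule finite_subset[of _ "{..<length la}"]) (auto simp: row_fun_def split: if_splits)
  ultimately show ?thesis by (simp add: shapes_def)
qed

lemma row_fun_pos: "is_partition la \<Longrightarrow> i < length la \<Longrightarrow> 0 < row_fun la i"
  by (simp add: is_partition_def row_fun_def)

lemma row_fun_length_le:
  assumes "is_partition lb" "row_fun la = row_fun lb"
  shows "length lb \<le> length la"
proof (rule ccontr)
  assume "\<not> length lb \<le> length la"
  then have "0 < row_fun lb (length la)" using row_fun_pos[OF assms(1)] by simp
  then show False unfolding assms(2)[symmetric] by (simp add: row_fun_def)
qed

lemma bij_row_fun: "bij_betw row_fun (partitions s) (shapes_of s)"
proof (rule bij_betw_imageI)
  show "inj_on row_fun (partitions s)"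
  proof (rule inj_onI)
    fix la lb assume l: "la \<in> partitions s" "lb \<in> partitions s" "row_fun la = row_fun lb"
    then have p: "is_partition la" "is_partition lb" by (auto simp: partitions_def)
    have len: "length la = length lb"
      using row_fun_length_le[OF p(2) l(3)] row_fun_length_le[OF p(1) l(3)[symmetric]] by simp
    show "la = lb"
    proof (rule nth_equalityI[OF len])
      fix i assume "i < length la"
      then show "la ! i = lb ! i" using fun_cong[OF l(3), of i] len by (simp add: row_fun_def)
    qed
  qed
  show "row_fun ` partitions s = shapes_of s"
  proof (intro equalityI subsetI)
    fix f assume "f \<in> row_fun ` partitions s"
    then show "f \<in> shapes_of s"
      using row_fun_shapes row_fun_size by (auto simp: partitions_def shapes_of_def)
  next
    fix f assume "f \<in> shapes_of s"
    then have f: "f \<in> shapes" "shape_size f = s" by (auto simp: shapes_of_def)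
    let ?S = "{i. f i \<noteq> 0}"
    have S: "?S = {..<card ?S}"
    proof (rule down_closed_card)
      show "finite ?S" using f(1) by (simp add: shapes_def)
      fix i j assume "j \<in> ?S" "i \<le> j"
      then show "i \<in> ?S" using shapes_antimono[OF f(1), of i j] by simp
    qed
    define n where "n = card ?S"
    have n: "f i \<noteq> 0 \<longleftrightarrow> i < n" for i using S unfolding n_def by (metis (mono_tags, lifting) lessThan_iff mem_Collect_eq)
    define la where "la = map f [0..<n]"
    have rf: "row_fun la = f" using n by (auto simp: row_fun_def la_def fun_eq_iff)
    have "sorted_wrt (\<ge>) la"
      unfolding la_def sorted_wrt_map sorted_wrt_iff_nth_less using shapes_antimono[OF f(1)] by simp
    moreover have "\<forall>x\<in>set la. 0 < x" using n by (auto simp: la_def)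
    ultimately have "is_partition la" by (simp add: is_partition_def)
    moreover have "sum_list la = s" using row_fun_size[of la] f(2) rf by simp
    ultimately show "f \<in> row_fun ` partitions s" using rf by (auto simp: partitions_def)
  qed
qed

lemma finite_partitions: "finite (partitions s)"
  using bij_betw_finite[OF bij_row_fun] finite_shapes_of by blast

lemma kostka_eq_gt_count:
  assumes "nu \<in> partitions s" "\<And>i. i \<ge> N \<Longrightarrow> mu i = 0"
  shows "kostka N nu mu = gt_count N mu (row_fun nu)"
proof -
  have "row_fun nu \<in> shapes" using assms(1) row_fun_shapes by (simp add: partitions_def)
  moreover have "{T \<in> SSYT N nu. Defs.content nu T = mu} = ssyt N (row_fun nu) mu"
    unfolding SSYT_def ssyt_def Defs.content_def cells_row_fun fun_eq_iff
    by (auto simp: shape_cells_def)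
  ultimately show ?thesis unfolding kostka_def using card_ssyt assms(2) by simp
qed

lemma SYT_eq_syt: "SYT nu = syt (row_fun nu)"
  unfolding SYT_def syt_def cells_row_fun row_fun_size by (auto simp: shape_cells_def)

lemma row_of_eq: "row_of nu T e = entry_row (row_fun nu) T e"
  by (simp add: row_of_def entry_row_def cells_row_fun)

text \<open>The common interface of tableaux and words: a super descent set depends only on the
  ordinary descent set D and on the set X of negative entries or odd positions.\<close>

definition super_des :: "nat \<Rightarrow> nat set \<Rightarrow> nat set \<Rightarrow> nat set" where
  "super_des k D X = {i \<in> {1..<k}. i + 1 \<notin> X \<and> i \<in> D \<or> i \<in> X \<and> i \<notin> D}"

definition maj_one :: "nat \<Rightarrow> nat set \<Rightarrow> nat set \<Rightarrow> bool" where
  "maj_one k D X \<longleftrightarrow> \<Sum> (super_des k D X) mod k = 1 mod k"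

definition neg_sets :: "nat \<Rightarrow> nat \<Rightarrow> nat set set" where
  "neg_sets k m = {X. X \<subseteq> {1..k} \<and> card X = m}"

lemma finite_neg_sets: "finite (neg_sets k m)"
  by (rule finite_subset[of _ "Pow {1..k}"]) (auto simp: neg_sets_def)

lemma Des_eq:
  assumes "nu \<in> partitions k"
  shows "Des nu T S = super_des k (tab_desc (row_fun nu) T) (T ` S)"
proof -
  have "sum_list nu = k" using assms by (simp add: partitions_def)
  then show ?thesis
    unfolding Des_def super_des_def tab_desc_def row_fun_size row_of_eq Neg_def by auto
qed

definition signed_count :: "nat \<Rightarrow> nat \<Rightarrow> nat list \<Rightarrow> nat" where
  "signed_count k m nu = card {(T, S) \<in> SYT_pm nu. maj nu T S mod k = 1 mod k \<and> neg T S = m}"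

text \<open>The bijection T converts marked cells into sets X of entries and back. For fixed X the
  condition sees only the descent set of T, by which the tableaux are grouped.\<close>

lemma signed_count_eq:
  assumes nu: "nu \<in> partitions k"
  defines "f \<equiv> row_fun nu"
  shows "signed_count k m nu =
    (\<Sum>X\<in>neg_sets k m. \<Sum>D\<in>{D\<in>Pow {1..<k}. maj_one k D X}. card {T \<in> syt f. tab_desc f T = D})"
proof -
  have f: "f \<in> shapes" "shape_size f = k"
    using nu row_fun_shapes row_fun_size by (auto simp: partitions_def f_def)
  let ?A = "{(T, S) \<in> SYT_pm nu. maj nu T S mod k = 1 mod k \<and> neg T S = m}"
  let ?B = "Sigma (neg_sets k m) (\<lambda>X. {T \<in> syt f. maj_one k (tab_desc f T) X})"
  have bij: "bij_betw T (shape_cells f) {1..k}" if "T \<in> syt f" for T using sytD(2)[OF that] f(2) by simp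
  have "bij_betw (\<lambda>(T, S). (T ` S, T)) ?A ?B"
  proof (rule bij_betw_byWitness[where f' = "\<lambda>(X, T). (T, {c \<in> shape_cells f. T c \<in> X})"])
    have A: "T \<in> syt f \<and> S \<subseteq> shape_cells f \<and> maj_one k (tab_desc f T) (T ` S) \<and> card (T ` S) = m"
      if "(T, S) \<in> ?A" for T S
      using that Des_eq[OF nu, of T S]
      by (simp add: SYT_pm_def SYT_eq_syt cells_row_fun maj_def maj_one_def neg_def Neg_def f_def)
    have A': "(T, S) \<in> ?A" if "T \<in> syt f" "S \<subseteq> shape_cells f" "maj_one k (tab_desc f T) (T ` S)" "card (T ` S) = m" for T S
      using that Des_eq[OF nu, of T S]
      by (simp add: SYT_pm_def SYT_eq_syt cells_row_fun maj_def maj_one_def neg_def Neg_def f_def)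
    show "\<forall>a\<in>?A. (case case a of (T, S) \<Rightarrow> (T ` S, T) of (X, T) \<Rightarrow> (T, {c \<in> shape_cells f. T c \<in> X})) = a"
    proof
      fix a assume a: "a \<in> ?A"
      obtain T S where TS: "a = (T, S)" by (cases a)
      note AA = A[OF a[unfolded TS]]
      have "inj_on T (shape_cells f)" using bij AA by (auto simp: bij_betw_def)
      then have "{c \<in> shape_cells f. T c \<in> T ` S} = S" using AA by (auto dest: inj_onD)
      then show "(case case a of (T, S) \<Rightarrow> (T ` S, T) of (X, T) \<Rightarrow> (T, {c \<in> shape_cells f. T c \<in> X})) = a"
        by (simp add: TS)
    qed
    have im: "T ` {c \<in> shape_cells f. T c \<in> X} = X" if "X \<in> neg_sets k m" "T \<in> syt f" for X T
    proof -
      have "T ` shape_cells f = {1..k}" using bij[OF that(2)] by (simp add: bij_betw_def)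
      moreover have "X \<subseteq> {1..k}" using that(1) by (simp add: neg_sets_def)
      ultimately have sub: "X \<subseteq> T ` shape_cells f" by simp
      show ?thesis
      proof (intro equalityI subsetI)
        fix y assume y: "y \<in> X"
        then obtain c where "c \<in> shape_cells f" "y = T c" using sub by (meson imageE subsetD)
        then show "y \<in> T ` {c \<in> shape_cells f. T c \<in> X}" using y by simp
      qed auto
    qed
    show "\<forall>b\<in>?B. (case case b of (X, T) \<Rightarrow> (T, {c \<in> shape_cells f. T c \<in> X}) of (T, S) \<Rightarrow> (T ` S, T)) = b"
      using im by auto
    show "(\<lambda>(T, S). (T ` S, T)) ` ?A \<subseteq> ?B"
    proof (rule image_subsetI)
      fix a assume a: "a \<in> ?A"
      obtain T S where TS: "a = (T, S)" by (cases a)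
      note AA = A[OF a[unfolded TS]]
      have "T ` S \<subseteq> {1..k}" using bij AA by (auto simp: bij_betw_def)
      then show "(case a of (T, S) \<Rightarrow> (T ` S, T)) \<in> ?B" using AA by (simp add: TS neg_sets_def)
    qed
    show "(\<lambda>(X, T). (T, {c \<in> shape_cells f. T c \<in> X})) ` ?B \<subseteq> ?A"
    proof (rule image_subsetI)
      fix b assume b: "b \<in> ?B"
      then obtain X T where XT: "b = (X, T)" "X \<in> neg_sets k m" "T \<in> syt f" "maj_one k (tab_desc f T) X" by auto
      have "(T, {c \<in> shape_cells f. T c \<in> X}) \<in> ?A"
        by (rule A') (use XT im[OF XT(2,3)] in \<open>auto simp: neg_sets_def\<close>)
      then show "(case b of (X, T) \<Rightarrow> (T, {c \<in> shape_cells f. T c \<in> X})) \<in> ?A" by (simp only: XT(1) case_prod_conv)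
    qed
  qed
  then have "signed_count k m nu = card ?B" unfolding signed_count_def by (rule bij_betw_same_card)
  also have "\<dots> = (\<Sum>X\<in>neg_sets k m. card {T \<in> syt f. maj_one k (tab_desc f T) X})"
    by (rule card_SigmaI) (use finite_neg_sets finite_syt[OF f(1)] in auto)
  also have "\<dots> = (\<Sum>X\<in>neg_sets k m. \<Sum>D\<in>{D\<in>Pow {1..<k}. maj_one k D X}. card {T \<in> syt f. tab_desc f T = D})"
  proof (rule sum.cong[OF refl])
    fix X
    have "tab_desc f T \<in> Pow {1..<k}" for T using f(2) by (auto simp: tab_desc_def)
    then have "{T \<in> syt f. maj_one k (tab_desc f T) X} =
        (\<Union>D\<in>{D\<in>Pow {1..<k}. maj_one k D X}. {T \<in> syt f. tab_desc f T = D})" by auto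
    moreover have "card (\<Union>D\<in>{D\<in>Pow {1..<k}. maj_one k D X}. {T \<in> syt f. tab_desc f T = D}) =
        (\<Sum>D\<in>{D\<in>Pow {1..<k}. maj_one k D X}. card {T \<in> syt f. tab_desc f T = D})"
      by (rule card_UN_disjoint) (use finite_syt[OF f(1)] in auto)
    ultimately show "card {T \<in> syt f. maj_one k (tab_desc f T) X} =
        (\<Sum>D\<in>{D\<in>Pow {1..<k}. maj_one k D X}. card {T \<in> syt f. tab_desc f T = D})" by simp
  qed
  finally show ?thesis .
qed

lemma list_maj_super_desc:
  assumes "length v = k"
  shows "list_maj super_desc v = \<Sum> (super_des k (word_desc (map fst v)) {i \<in> {1..k}. snd (v ! (i - 1))})"
proof -
  have "list_maj super_desc v = (\<Sum>i\<in>{i \<in> {1..<k}. super_desc (v ! (i - 1)) (v ! i)}. i)"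
    unfolding list_maj_def assms by (rule sum.inter_filter[symmetric]) simp
  also have "{i \<in> {1..<k}. super_desc (v ! (i - 1)) (v ! i)} =
      super_des k (word_desc (map fst v)) {i \<in> {1..k}. snd (v ! (i - 1))}"
    unfolding super_des_def word_desc_def super_desc_def using assms by (auto simp: not_less)
  finally show ?thesis .
qed

lemma card_odd_positions: "card {i \<in> {1..length v}. snd (v ! (i - 1))} = odd_count v"
proof -
  have "{i \<in> {1..length v}. snd (v ! (i - 1))} = Suc ` {i. i < length v \<and> snd (v ! i)}"
  proof (intro equalityI subsetI)
    fix i assume "i \<in> {i \<in> {1..length v}. snd (v ! (i - 1))}"
    then show "i \<in> Suc ` {i. i < length v \<and> snd (v ! i)}" by (intro image_eqI[of _ _ "i - 1"]) auto
  qed auto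
  then show ?thesis by (simp add: card_image odd_count_def length_filter_conv_card)
qed

lemma wweight_eq_count: "wweight v = count (mset (map fst v))"
proof
  fix i
  show "wweight v i = count (mset (map fst v)) i"
    unfolding wweight_def by (induction v) auto
qed

text \<open>A super word is its underlying word together with its set of odd positions, chosen
  independently.\<close>

lemma card_super_words:
  assumes mu: "mu = count M" and k: "n + m = k"
  shows "card {v \<in> super_words n m mu. list_maj super_desc v mod k = 1 mod k} =
    (\<Sum>X\<in>neg_sets k m. card {w. mset w = M \<and> length w = k \<and> maj_one k (word_desc w) X})"
proof -
  let ?A = "{v \<in> super_words n m mu. list_maj super_desc v mod k = 1 mod k}"
  let ?W = "\<lambda>X. {w. mset w = M \<and> length w = k \<and> maj_one k (word_desc w) X}"
  let ?h = "\<lambda>v::word. ({i \<in> {1..k}. snd (v ! (i - 1))}, map fst v)"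
  let ?h' = "\<lambda>(X, w). map (\<lambda>i. (w ! i, Suc i \<in> X)) [0..<k]"
  have A: "v \<in> ?A \<longleftrightarrow> length v = k \<and> ?h v \<in> Sigma (neg_sets k m) ?W" for v
  proof (cases "length v = k")
    case True
    then show ?thesis
      unfolding super_words_def neg_sets_def maj_one_def wweight_eq_count mu
      using card_odd_positions[of v] list_maj_super_desc[OF True] k by (auto simp: multiset_eq_iff fun_eq_iff)
  next
    case False
    then show ?thesis using k by (simp add: super_words_def)
  qed
  have "bij_betw ?h ?A (Sigma (neg_sets k m) ?W)"
  proof (rule bij_betw_byWitness[where f' = ?h'])
    show "\<forall>v\<in>?A. ?h' (?h v) = v"
    proof
      fix v assume "v \<in> ?A"
      then have "length v = k" using A by blast
      then show "?h' (?h v) = v" by (intro nth_equalityI) auto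
    qed
    have inv: "?h (?h' x) = x" if xS: "x \<in> Sigma (neg_sets k m) ?W" for x
    proof -
      obtain X w where x: "x = (X, w)" by (cases x)
      then have Xw: "X \<subseteq> {1..k}" "length w = k" using xS by (simp_all add: neg_sets_def)
      have "snd (?h' x ! (i - 1)) \<longleftrightarrow> i \<in> X" if "i \<in> {1..k}" for i
      proof -
        obtain j where "i = Suc j" "j < k" using \<open>i \<in> {1..k}\<close> by (cases i) auto
        then show ?thesis using x by simp
      qed
      then have "{i \<in> {1..k}. snd (?h' x ! (i - 1))} = X" using Xw(1) by blast
      moreover have "map ((!) w) [0..<k] = w" using map_nth[of w] unfolding Xw(2) .
      then have "map fst (?h' x) = w" unfolding x by (simp add: o_def)
      ultimately show ?thesis using x(1) by simp
    qed
    then show "\<forall>x\<in>Sigma (neg_sets k m) ?W. ?h (?h' x) = x" by blast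
    show "?h ` ?A \<subseteq> Sigma (neg_sets k m) ?W" using A by blast
    show "?h' ` Sigma (neg_sets k m) ?W \<subseteq> ?A"
    proof (rule image_subsetI)
      fix x assume x: "x \<in> Sigma (neg_sets k m) ?W"
      have "length (?h' x) = k" by (cases x) simp
      moreover have "?h (?h' x) \<in> Sigma (neg_sets k m) ?W" unfolding inv[OF x] by (rule x)
      ultimately show "?h' x \<in> ?A" unfolding A by blast
    qed
  qed
  then have "card ?A = card (Sigma (neg_sets k m) ?W)" by (rule bij_betw_same_card)
  also have "\<dots> = (\<Sum>X\<in>neg_sets k m. card (?W X))"
  proof (rule card_SigmaI[OF finite_neg_sets], rule ballI)
    fix X
    have "finite {w. mset w = M}" using finite_permutations_of_multiset[of M] by (simp add: permutations_of_multiset_def)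
    then show "finite (?W X)" by (rule rev_finite_subset) auto
  qed
  finally show ?thesis .
qed

text \<open>Each strip adds at most one new row, so after j strips the boxes lie in the first j
  rows; counting them gives the dominance inequalities.\<close>

lemma gt_count_nonzero:
  assumes "gt_count N mu f \<noteq> 0"
  shows "shape_size f = (\<Sum>i<N. mu i)" "\<And>i. i \<ge> N \<Longrightarrow> f i = 0"
    "\<And>j. j \<le> N \<Longrightarrow> (\<Sum>i<j. mu i) \<le> (\<Sum>i<j. f i)"
proof -
  have "shape_size f = (\<Sum>i<N. mu i) \<and> (\<forall>i\<ge>N. f i = 0) \<and> (\<forall>j\<le>N. (\<Sum>i<j. mu i) \<le> (\<Sum>i<j. f i))"
    using assms
  proof (induction N arbitrary: f)
    case 0
    then show ?case by (simp add: shape_size_def split: if_splits)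
  next
    case (Suc N)
    obtain e where e: "strip e f" "shape_size e + mu N = shape_size f" "gt_count N mu e \<noteq> 0"
    proof (rule ccontr)
      assume "\<not> thesis"
      then have "\<forall>e\<in>{e. strip e f \<and> shape_size e + mu N = shape_size f}. gt_count N mu e = 0" using that by blast
      then show False using Suc.prems by (simp add: sum.neutral)
    qed
    note IH = Suc.IH[OF e(3)]
    have z: "f i = 0" if iN: "i \<ge> Suc N" for i
    proof -
      obtain j where j: "i = Suc j" "j \<ge> N" using iN by (cases i) auto
      have "f (Suc j) \<le> e j" using e(1) by (simp add: strip_def)
      then show ?thesis using IH j by simp
    qed
    have tot: "shape_size f = (\<Sum>i<Suc N. mu i)" using IH e(2) by simp
    have "(\<Sum>i<j. mu i) \<le> (\<Sum>i<j. f i)" if "j \<le> Suc N" for j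
    proof (cases "j = Suc N")
      case True
      have "shape_size f = (\<Sum>i<Suc N. f i)" by (rule shape_size_eq) (use z in \<open>simp_all add: not_less\<close>)
      then show ?thesis using tot True by simp
    next
      case False
      then have "(\<Sum>i<j. mu i) \<le> (\<Sum>i<j. e i)" using IH that by simp
      also have "\<dots> \<le> (\<Sum>i<j. f i)" by (rule sum_mono) (use e(1) in \<open>simp add: strip_def\<close>)
      finally show ?thesis .
    qed
    then show ?case using tot z by blast
  qed
  then show "shape_size f = (\<Sum>i<N. mu i)" "\<And>i. i \<ge> N \<Longrightarrow> f i = 0"
    "\<And>j. j \<le> N \<Longrightarrow> (\<Sum>i<j. mu i) \<le> (\<Sum>i<j. f i)" by blast+
qed

text \<open>The chain of truncations to the first rows, that is, the tableau whose row i is filled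
  with i.\<close>

lemma gt_count_diagonal:
  assumes f: "f \<in> shapes"
  shows "gt_count N f (\<lambda>i. if i < N then f i else 0) \<noteq> 0"
proof (induction N)
  case (Suc N)
  let ?t = "\<lambda>N i. if i < N then f i else 0"
  have sz: "shape_size (?t N) = (\<Sum>i<N. f i)" for N
  proof -
    have "shape_size (?t N) = (\<Sum>i<N. ?t N i)" by (rule shape_size_eq) auto
    then show ?thesis by simp
  qed
  have sh: "?t (Suc N) \<in> shapes"
  proof -
    have "finite {i. ?t (Suc N) i \<noteq> 0}" by (rule finite_subset[of _ "{..<Suc N}"]) auto
    then show ?thesis using f unfolding shapes_def by auto
  qed
  have "strip (?t N) (?t (Suc N))"
    using f unfolding strip_def shapes_def by auto
  moreover have "shape_size (?t N) + f N = shape_size (?t (Suc N))" unfolding sz by simp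
  ultimately have mem: "?t N \<in> {e. strip e (?t (Suc N)) \<and> shape_size e + f N = shape_size (?t (Suc N))}" by blast
  have "gt_count N f (?t N) \<le> gt_count (Suc N) f (?t (Suc N))"
    unfolding gt_count.simps by (rule member_le_sum[OF mem]) (use finite_strip_below[OF sh] in auto)
  then show ?case using Suc by simp
qed simp

text \<open>At a dominance-maximal partition of the support, used as weight, every other term
  vanishes and the diagonal Kostka number does not. The bound k \<le> N makes each partition of k a
  weight in N variables.\<close>

lemma kostka_triangular:
  fixes d :: "nat list \<Rightarrow> int"
  assumes supp: "\<And>nu. nu \<notin> partitions k \<Longrightarrow> d nu = 0" and N: "k \<le> N"
    and zero: "\<And>mu. (\<And>i. i \<ge> N \<Longrightarrow> mu i = 0) \<Longrightarrow> (\<Sum>nu\<in>partitions k. d nu * int (kostka N nu mu)) = 0"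
  shows "d nu = 0"
proof (rule ccontr)
  assume nz: "d nu \<noteq> 0"
  let ?S = "{nu \<in> partitions k. d nu \<noteq> 0}"
  \<comment> \<open>Strictly monotone for the dominance order, so a maximizer is a maximal element of the support.\<close>
  let ?P = "\<lambda>nu. \<Sum>j\<in>{..N}. \<Sum>i<j. row_fun nu i"
  have "finite ?S" using finite_partitions by simp
  moreover have "nu \<in> ?S" using nz supp by blast
  ultimately have mx: "Max (?P ` ?S) \<in> ?P ` ?S" by (intro Max_in) auto
  obtain la where la: "la \<in> ?S" "?P la = Max (?P ` ?S)"
    by (rule imageE[OF mx]) (rule that, assumption, erule sym)
  have maxP: "?P nu \<le> ?P la" if "nu \<in> ?S" for nu
    unfolding la(2) by (rule Max_ge) (use \<open>finite ?S\<close> that in auto)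
  let ?mu = "row_fun la"
  have ls: "?mu \<in> shapes_of k" using la(1) bij_row_fun[of k] by (auto simp: bij_betw_def)
  have mu0: "?mu i = 0" if "i \<ge> N" for i using shapes_of_vanish[OF ls, of i] that N by simp
  have other: "d nu * int (kostka N nu ?mu) = 0" if nu: "nu \<in> partitions k" "nu \<noteq> la" for nu
  proof (rule ccontr)
    assume "d nu * int (kostka N nu ?mu) \<noteq> 0"
    then have dn: "d nu \<noteq> 0" and "gt_count N ?mu (row_fun nu) \<noteq> 0"
      using kostka_eq_gt_count[OF nu(1), of N ?mu] mu0 by auto
    note g = gt_count_nonzero[OF this(2)]
    have le: "(\<Sum>i<j. ?mu i) \<le> (\<Sum>i<j. row_fun nu i)" if "j \<in> {..N}" for j using g(3) that by simp
    have "?P nu \<le> ?P la" by (rule maxP) (use nu dn in simp)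
    moreover have "?P la \<le> ?P nu" by (rule sum_mono) (rule le)
    ultimately have Peq: "?P la = ?P nu" by simp
    have eq: "(\<Sum>i<j. ?mu i) = (\<Sum>i<j. row_fun nu i)" if "j \<in> {..N}" for j
      by (rule sum_mono_inv[OF Peq le that]) auto
    have "?mu = row_fun nu"
    proof
      fix i
      show "?mu i = row_fun nu i"
      proof (cases "i < N")
        case True
        then show ?thesis using eq[of i] eq[of "Suc i"] by simp
      next
        case False
        then show ?thesis using g(2)[of i] mu0[of i] by simp
      qed
    qed
    then have "la = nu" using la(1) nu(1) bij_row_fun[of k] by (auto simp: bij_betw_def dest: inj_onD)
    then show False using nu(2) by simp
  qed
  have lap: "la \<in> partitions k" using la(1) by simp
  have "0 = (\<Sum>nu\<in>partitions k. d nu * int (kostka N nu ?mu))" by (rule zero[symmetric]) (rule mu0)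
  also have "\<dots> = d la * int (kostka N la ?mu) + (\<Sum>nu\<in>partitions k - {la}. d nu * int (kostka N nu ?mu))"
    by (rule sum.remove[OF finite_partitions lap])
  also have "(\<Sum>nu\<in>partitions k - {la}. d nu * int (kostka N nu ?mu)) = 0"
    by (rule sum.neutral) (use other in auto)
  finally have "d la * int (kostka N la ?mu) = 0" by simp
  moreover have "kostka N la ?mu \<noteq> 0"
  proof -
    have "(\<lambda>i. if i < N then ?mu i else 0) = ?mu" using mu0 by (auto simp: fun_eq_iff not_less)
    then have "gt_count N ?mu ?mu \<noteq> 0" using gt_count_diagonal[of ?mu N] ls by (simp add: shapes_of_def)
    then show ?thesis using kostka_eq_gt_count[OF lap, of N ?mu] mu0 by simp
  qed
  ultimately show False using la(1) by simp
qed

theorem ch_eq_sum_kostka: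
  assumes k: "n + m = k" "k > 0" and mu0: "\<And>i. i \<ge> N \<Longrightarrow> mu i = 0"
  shows "ch N n m mu = (\<Sum>nu\<in>partitions k. signed_count k m nu * kostka N nu mu)"
proof -
  let ?W = "{v \<in> super_words n m mu. list_maj super_desc v mod k = 1 mod k}"
  have ch: "ch N n m mu = card ?W" using ch_eq_card[of N mu n m] mu0 k by simp
  have "finite {i. mu i > 0}"
  proof (rule finite_subset[of _ "{..<N}"])
    show "{i. mu i > 0} \<subseteq> {..<N}"
    proof
      fix i assume "i \<in> {i. mu i > 0}"
      then show "i \<in> {..<N}" using mu0[of i] by (cases "i < N") auto
    qed
  qed simp
  then obtain M where M: "mu = count M" using count_Abs_multiset by metis
  have MN: "set_mset M \<subseteq> {..<N}"
  proof
    fix i assume "i \<in># M"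
    then have "mu i \<noteq> 0" by (simp add: M)
    then show "i \<in> {..<N}" using mu0[of i] by (cases "i < N") auto
  qed
  show ?thesis
  proof (cases "size M = k")
    case False
    \<comment> \<open>If the weight has the wrong total, there are neither words nor semistandard
      tableaux, and both sides are 0.\<close>
    have "super_words n m mu = {}"
    proof (intro equals0I)
      fix v assume "v \<in> super_words n m mu"
      then have "length v = k" "count (mset (map fst v)) = count M"
        using k M by (auto simp: super_words_def wweight_eq_count)
      then have "mset (map fst v) = M" "length v = k" by (simp_all add: multiset_eq_iff fun_eq_iff)
      then show False using False by (metis length_map size_mset)
    qed
    then have "ch N n m mu = 0" unfolding ch by simp
    moreover have "kostka N nu mu = 0" if nu: "nu \<in> partitions k" for nu
    proof (rule ccontr)
      assume "kostka N nu mu \<noteq> 0"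
      then have "gt_count N mu (row_fun nu) \<noteq> 0" using kostka_eq_gt_count[OF nu, of N mu] mu0 by simp
      from gt_count_nonzero(1)[OF this] have "k = (\<Sum>i<N. count M i)"
        using nu row_fun_size[of nu] by (simp add: partitions_def M)
      also have "\<dots> = size M"
        unfolding size_multiset_overloaded_eq using MN
        by (intro sum.mono_neutral_right) (auto simp: not_in_iff)
      finally show False using False by simp
    qed
    ultimately show ?thesis by simp
  next
    case True
    let ?Q = "\<lambda>X. {D\<in>Pow {1..<k}. maj_one k D X}"
    let ?t = "\<lambda>f D. card {T \<in> syt f. tab_desc f T = D}"
    let ?w = "\<lambda>D. card {w. mset w = M \<and> word_desc w = D}"
    have finM: "finite {w. mset w = M}"
      using finite_permutations_of_multiset[of M] by (simp add: permutations_of_multiset_def)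
    have "(\<Sum>nu\<in>partitions k. signed_count k m nu * kostka N nu mu) =
       (\<Sum>nu\<in>partitions k. (\<Sum>X\<in>neg_sets k m. \<Sum>D\<in>?Q X. ?t (row_fun nu) D) * gt_count N mu (row_fun nu))"
      by (rule sum.cong[OF refl]) (simp add: signed_count_eq kostka_eq_gt_count[OF _ mu0])
    also have "\<dots> = (\<Sum>f\<in>shapes_of k. (\<Sum>X\<in>neg_sets k m. \<Sum>D\<in>?Q X. ?t f D) * gt_count N mu f)"
      by (rule sum.reindex_bij_betw[OF bij_row_fun])
    also have "\<dots> = (\<Sum>X\<in>neg_sets k m. \<Sum>D\<in>?Q X. \<Sum>f\<in>shapes_of k. ?t f D * gt_count N mu f)"
      unfolding sum_distrib_right
      by (subst sum.swap, rule sum.cong[OF refl], subst sum.swap, rule refl)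
    also have "\<dots> = (\<Sum>X\<in>neg_sets k m. \<Sum>D\<in>?Q X. ?w D)"
      unfolding M by (intro sum.cong refl sum_card_syt_gt_count[OF MN True]) auto
    also have "\<dots> = (\<Sum>X\<in>neg_sets k m. card {w. mset w = M \<and> length w = k \<and> maj_one k (word_desc w) X})"
    proof (rule sum.cong[OF refl])
      fix X
      have len: "length w = k" if "mset w = M" for w using that True by auto
      have "word_desc w \<in> Pow {1..<k}" if "mset w = M" for w
        using len[OF that] by (auto simp: word_desc_def)
      then have "{w. mset w = M \<and> length w = k \<and> maj_one k (word_desc w) X} =
          (\<Union>D\<in>?Q X. {w. mset w = M \<and> word_desc w = D})" using len by auto
      moreover have "card (\<Union>D\<in>?Q X. {w. mset w = M \<and> word_desc w = D}) = (\<Sum>D\<in>?Q X. ?w D)"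
      proof (rule card_UN_disjoint)
        show "\<forall>D\<in>?Q X. finite {w. mset w = M \<and> word_desc w = D}"
          using finM by (auto intro: rev_finite_subset)
      qed auto
      ultimately show "(\<Sum>D\<in>?Q X. ?w D) = card {w. mset w = M \<and> length w = k \<and> maj_one k (word_desc w) X}" by simp
    qed
    also have "\<dots> = card ?W" by (rule card_super_words[OF M k(1), symmetric])
    finally show ?thesis unfolding ch ..
  qed
qed

theorem theorem1p5:
  fixes n m :: nat and la :: "nat list"
  assumes "n + m > 0"
    and "la \<in> partitions (n + m)"
  shows "\<forall>\<^sub>F N in sequentially.
           schur_coeff N n m la =
           int (card {(T, S) \<in> SYT_pm la.
                   maj la T S mod (n + m) = 1 mod (n + m) \<and> neg T S = m})"
proof (rule eventually_sequentiallyI)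
  \<comment> \<open>A partition of n + m has at most n + m rows, so this many variables suffice for
    uniqueness.\<close>
  fix N assume N: "n + m \<le> N"
  let ?k = "n + m"
  \<comment> \<open>Extended by 0 off the partitions, as the characterization of the coefficient
    family prescribes.\<close>
  let ?c = "\<lambda>nu. if nu \<in> partitions ?k then int (signed_count ?k m nu) else 0"
  let ?P = "\<lambda>c. (\<forall>nu. nu \<notin> partitions ?k \<longrightarrow> c nu = 0) \<and>
        (\<forall>mu. (\<forall>i\<ge>N. mu i = 0) \<longrightarrow>
           int (ch N n m mu) = (\<Sum>nu\<in>partitions ?k. c nu * int (kostka N nu mu)))"
  have P: "?P ?c"
    using ch_eq_sum_kostka[of n m ?k N] assms(1) by (simp add: of_nat_sum)
  have "(THE c. ?P c) = ?c"
  proof (rule the_equality)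
    show "?P ?c" by (rule P)
  next
    fix c assume c: "?P c"
    \<comment> \<open>The difference of two solutions pairs to zero with every weight, and
      triangularity applies to it.\<close>
    have "c nu - ?c nu = 0" for nu
    proof (rule kostka_triangular[where d = "\<lambda>nu. c nu - ?c nu", OF _ N])
      fix nu assume "nu \<notin> partitions ?k"
      then show "c nu - ?c nu = 0" using c by simp
    next
      fix mu :: "nat \<Rightarrow> nat" assume mu: "\<And>i. i \<ge> N \<Longrightarrow> mu i = 0"
      have z: "\<forall>i\<ge>N. mu i = 0" using mu by simp
      have "(\<Sum>nu\<in>partitions ?k. c nu * int (kostka N nu mu)) = int (ch N n m mu)"
        by (rule mp[OF spec[OF conjunct2[OF c]] z, symmetric])
      moreover have "(\<Sum>nu\<in>partitions ?k. ?c nu * int (kostka N nu mu)) = int (ch N n m mu)"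
        by (rule mp[OF spec[OF conjunct2[OF P]] z, symmetric])
      ultimately show "(\<Sum>nu\<in>partitions ?k. (c nu - ?c nu) * int (kostka N nu mu)) = 0"
        by (simp only: left_diff_distrib sum_subtractf)
    qed
    then show "c = ?c" by (intro ext) (simp only: right_minus_eq)
  qed
  then show "schur_coeff N n m la = int (card {(T, S) \<in> SYT_pm la.
      maj la T S mod (n + m) = 1 mod (n + m) \<and> neg T S = m})"
    unfolding schur_coeff_def using assms(2) by (simp add: signed_count_def)
qed

end
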